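(* The operad $\mathcal{PSB}$ is isomorphic, as a symmetric operad in $\mathbb{K}$-vector spaces, to the operad $\mathcal{P}ost\mathcal{L}ie$ governing post-Lie algebras.
   Context: Conventions. $\mathbb{K}$ is a field of characteristic zero. Operads are symmetric operads in $\mathbb{K}$-vector spaces, concentrated in arities $n\ge 1$, given by partial compositions $\circ_i:\mathcal{O}(m)\otimes\mathcal{O}(n)\to\mathcal{O}(m+n-1)$, $1\le i\le m$. For an operadic ideal $\mathcal{I}\subset\mathcal{O}$, $\mathcal{O}/\mathcal{I}$ is the quotient operad. Post-Lie algebras. A post-Lie algebra is a Lie algebra $(\mathfrak{g},[-,-])$ with a bilinear product $\triangleright$ such that $z\triangleright[x,y]=[z\triangleright x,y]+[x,z\triangleright y]$ and $[x,y]\triangleright z=\mathrm{a}(x,y,z)-\mathrm{a}(y,x,z)$, where $\mathrm{a}(x,y,z)=x\triangleright(y\triangleright z)-(x\triangleright y)\triangleright z$. $\mathcal{P}ost\mathcal{L}ie$ is the quadratic operad generated by $[-,-],\triangleright$ with these relations. Trees. A planar rooted tree is an isomorphism class of contractible graphs embedded in the plane with a distinguished root vertex carrying a root half-edge. Trees are drawn with the root at the bottom; edges are oriented toward the root; incoming edges of a vertex are ordered left to right. For a non-root vertex $v$, its $\prec$-successor $v^+$ is the target of its outgoing edge. A partially labeled tree with $n$ labels is a planar rooted tree $T$ with a subset $U$ of its vertices and a bijection $U\to\{1,\dots,n\}$; it is fully labeled if $U$ consists of all the vertices. $\mathcal{PT}_p(n)$ is the vector space with basis the partially labeled trees with $n$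 labels, with $\mathbb{S}_n$ permuting labels. For $T\in\mathcal{PT}_p(m)$, $R\in\mathcal{PT}_p(n)$ trees and $1\le i\le m$, let $In(i)$ be the ordered set of incoming edges of the vertex of $T$ labeled $i$. For a map $\phi$ from $In(i)$ to the set of labeled vertices of $R$, $T\circ_i^\phi R$ is obtained by replacing the vertex $i$ by $R$ (identifying the outgoing edge of $i$ with the root-edge of $R$) and grafting, for each labeled vertex $w$ of $R$, the edges of $\phi^{-1}(w)$ onto $w$, in their order, to the left of all incoming edges $w$ has in $R$ (i.e. in the minimal angle of $w$); labels $<i$ of $T$ are kept, labels of $R$ are shifted by $i-1$, labels $>i$ of $T$ are shifted by $n-1$. Set $T\circ_i R=\sum_\phi T\circ_i^\phi R$. The operad $\mathcal{LW}$. $\mathcal{L}(n)$ is spanned by the fully labeled trees with $n$ vertices. For $n\ge2$, $\mathcal{W}(n)\subset\mathcal{PT}_p(n)$ is spanned by the partially labeled trees such that: (a) the root is unlabeled; (b) if a non-root vertex is unlabeled, so is its $\prec$-successor; (c) each unlabeled vertex has exactly two incoming edges. $\mathcal{LW}(1)=\mathcal{L}(1)$, $\mathcal{LW}(n)=\mathcal{L}(n)\oplus\mathcal{W}(n)$ for $n\ge2$. For a tree $R\in\mathcal{W}(n)$ with set of unlabeled vertices $V_{unl}(R)$ and $\sigma=(\sigma_v)_v\in\mathbb{S}_2^{V_{unl}(R)}$, $R_\sigma$ is obtained from $R$ by exchanging, at every unlabeled vertex $v$ with $\sigma_v\ne id$, the two maximal subtrees sitting above $v$ (labels move along with the vertices),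 and $\epsilon(\sigma)=\prod_v \mathrm{sign}(\sigma_v)$. $Con(R)$ is $R$ with all edges joining two unlabeled vertices contracted. For an unlabeled non-root vertex $r$, $Con_r$ contracts the edge from $r$ to $r^+$, the merged vertex keeping the label of $r^+$, if any. Partial compositions of $\mathcal{LW}$: for $T\in\mathcal{LW}(m)$ and $S\in\mathcal{L}(n)$, $T\circ_iS$ is as in $\mathcal{PT}_p$. For a tree $T\in\mathcal{LW}(m)$ and a tree $R\in\mathcal{W}(n)$, with $v$ the vertex of $T$ labeled $i$: if $v$ has a $\prec$-successor and it is labeled, the composition is $\sum_{\sigma\in\mathbb{S}_2^{V_{unl}(R)}}\epsilon(\sigma)\,Con_r(T\circ_iCon(R_\sigma))$, where $r$ is the root of $Con(R_\sigma)$ seen inside $T\circ_iCon(R_\sigma)$; otherwise it is $T\circ_iR$ as in $\mathcal{PT}_p$. With these compositions $\mathcal{LW}$ is an operad. The operad $\mathcal{PSB}$. Write $C(\bullet;A,B)$ for the tree with unlabeled root and left and right subtrees $A$, $B$. $\mathcal{I}$ is the operadic ideal of $\mathcal{LW}$ generated by $C(\bullet;1,2)+C(\bullet;2,1)$ and $C(\bullet;1,C(\bullet;2,3))-C(\bullet;C(\bullet;1,2),3)-C(\bullet;2,C(\bullet;1,3))$. Then $\mathcal{PSB}:=\mathcal{LW}/\mathcal{I}$. *)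

theory Defs
  imports
    "Jordan_Normal_Form.VS_Connect"
    "HOL-Algebra.AbelCoset"
    "HOL-Combinatorics.Permutations"
    "HOL-Library.Poly_Mapping"
begin

section \<open>Symmetric operads in vector spaces\<close>

text \<open>
  The ground field is a type \<open>'k\<close>, viewed as the ring record \<^term>\<open>class_ring\<close> so that vector spaces
  with a carrier, in particular quotient spaces, are available.
  \<open>opcomp P m n i a b\<close> is \<open>a \<circ>\<^sub>i b\<close> for \<open>a \<in> P(m)\<close>, \<open>b \<in> P(n)\<close>; \<open>opact P n \<sigma>\<close> is the left action
  of a permutation \<open>\<sigma>\<close> of \<open>{1..n}\<close>, thought of as renaming input \<open>j\<close> to \<open>\<sigma> j\<close>.
  Operads are concentrated in arities \<open>n \<ge> 1\<close>: the component in arity \<open>0\<close> is never used.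
\<close>

record ('k, 'v) operad =
  opspace :: "nat \<Rightarrow> ('k, 'v) module"
  opunit :: 'v
  opcomp :: "nat \<Rightarrow> nat \<Rightarrow> nat \<Rightarrow> 'v \<Rightarrow> 'v \<Rightarrow> 'v"
  opact :: "nat \<Rightarrow> (nat \<Rightarrow> nat) \<Rightarrow> 'v \<Rightarrow> 'v"

abbreviation opcarrier :: "('k, 'v) operad \<Rightarrow> nat \<Rightarrow> 'v set" where
  "opcarrier P n \<equiv> carrier (opspace P n)"

text \<open>
  The permutation \<open>\<sigma> \<circ>\<^sub>i \<tau>\<close> of \<open>{1..m+n-1}\<close> with \<open>(\<sigma> a) \<circ>\<^bsub>\<sigma> i\<^esub> (\<tau> b) = (\<sigma> \<circ>\<^sub>i \<tau>) (a \<circ>\<^sub>i b)\<close>: the inputs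
  of \<open>b\<close> occupy the block \<open>i, \<dots>, i+n-1\<close> on the right and \<open>\<sigma> i, \<dots>, \<sigma> i+n-1\<close> on the left.
\<close>

definition perm_comp :: "nat \<Rightarrow> nat \<Rightarrow> (nat \<Rightarrow> nat) \<Rightarrow> (nat \<Rightarrow> nat) \<Rightarrow> nat \<Rightarrow> nat" where
  "perm_comp n i \<sigma> \<tau> p =
    (let shift = (\<lambda>j. if j < \<sigma> i then j else j + n - 1)
     in if p < i then shift (\<sigma> p)
        else if p < i + n then \<tau> (p - i + 1) + \<sigma> i - 1
        else shift (\<sigma> (p - n + 1)))"

locale symmetric_operad =
  fixes P :: "('k::field, 'v) operad"
  assumes space: "n \<ge> 1 \<Longrightarrow> vectorspace class_ring (opspace P n)"
    and unit_closed: "opunit P \<in> opcarrier P 1"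
    and comp_linear_right:
      "\<lbrakk>1 \<le> i; i \<le> m; n \<ge> 1; a \<in> opcarrier P m\<rbrakk> \<Longrightarrow>
        linear_map class_ring (opspace P n) (opspace P (m + n - 1)) (\<lambda>b. opcomp P m n i a b)"
    and comp_linear_left:
      "\<lbrakk>1 \<le> i; i \<le> m; n \<ge> 1; b \<in> opcarrier P n\<rbrakk> \<Longrightarrow>
        linear_map class_ring (opspace P m) (opspace P (m + n - 1)) (\<lambda>a. opcomp P m n i a b)"
    and act_linear:
      "\<lbrakk>n \<ge> 1; \<sigma> permutes {1..n}\<rbrakk> \<Longrightarrow>
        linear_map class_ring (opspace P n) (opspace P n) (opact P n \<sigma>)"
    and act_id: "\<lbrakk>n \<ge> 1; a \<in> opcarrier P n\<rbrakk> \<Longrightarrow> opact P n id a = a"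
    and act_comp:
      "\<lbrakk>n \<ge> 1; \<sigma> permutes {1..n}; \<tau> permutes {1..n}; a \<in> opcarrier P n\<rbrakk> \<Longrightarrow>
        opact P n (\<sigma> \<circ> \<tau>) a = opact P n \<sigma> (opact P n \<tau> a)"
    and unit_left: "\<lbrakk>n \<ge> 1; a \<in> opcarrier P n\<rbrakk> \<Longrightarrow> opcomp P 1 n 1 (opunit P) a = a"
    and unit_right:
      "\<lbrakk>1 \<le> i; i \<le> n; a \<in> opcarrier P n\<rbrakk> \<Longrightarrow> opcomp P n 1 i a (opunit P) = a"
    and assoc_sequential:
      "\<lbrakk>1 \<le> i; i \<le> m; 1 \<le> j; j \<le> n; q \<ge> 1;
        a \<in> opcarrier P m; b \<in> opcarrier P n; c \<in> opcarrier P q\<rbrakk> \<Longrightarrow>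
        opcomp P (m + n - 1) q (i + j - 1) (opcomp P m n i a b) c =
        opcomp P m (n + q - 1) i a (opcomp P n q j b c)"
    and assoc_parallel:
      "\<lbrakk>1 \<le> i; i < k; k \<le> m; n \<ge> 1; q \<ge> 1;
        a \<in> opcarrier P m; b \<in> opcarrier P n; c \<in> opcarrier P q\<rbrakk> \<Longrightarrow>
        opcomp P (m + n - 1) q (k + n - 1) (opcomp P m n i a b) c =
        opcomp P (m + q - 1) n i (opcomp P m q k a c) b"
    and equivariant:
      "\<lbrakk>1 \<le> i; i \<le> m; n \<ge> 1; \<sigma> permutes {1..m}; \<tau> permutes {1..n};
        a \<in> opcarrier P m; b \<in> opcarrier P n\<rbrakk> \<Longrightarrow>
        opcomp P m n (\<sigma> i) (opact P m \<sigma> a) (opact P n \<tau> b) =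
        opact P (m + n - 1) (perm_comp n i \<sigma> \<tau>) (opcomp P m n i a b)"

definition operad_iso ::
    "('k::field, 'v) operad \<Rightarrow> ('k, 'w) operad \<Rightarrow> (nat \<Rightarrow> 'v \<Rightarrow> 'w) \<Rightarrow> bool" where
  "operad_iso P Q f \<longleftrightarrow>
    (\<forall>n\<ge>1. linear_map class_ring (opspace P n) (opspace Q n) (f n) \<and>
            bij_betw (f n) (opcarrier P n) (opcarrier Q n)) \<and>
    f 1 (opunit P) = opunit Q \<and>
    (\<forall>m n i. \<forall>a\<in>opcarrier P m. \<forall>b\<in>opcarrier P n. 1 \<le> i \<and> i \<le> m \<and> n \<ge> 1 \<longrightarrow>
      f (m + n - 1) (opcomp P m n i a b) = opcomp Q m n i (f m a) (f n b)) \<and>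
    (\<forall>n \<sigma>. \<forall>a\<in>opcarrier P n. n \<ge> 1 \<and> \<sigma> permutes {1..n} \<longrightarrow>
      f n (opact P n \<sigma> a) = opact Q n \<sigma> (f n a))"

definition operad_isomorphic :: "('k::field, 'v) operad \<Rightarrow> ('k, 'w) operad \<Rightarrow> bool" where
  "operad_isomorphic P Q \<longleftrightarrow>
    symmetric_operad P \<and> symmetric_operad Q \<and> (\<exists>f. operad_iso P Q f)"


subsection \<open>Ideals and quotients\<close>

definition operad_ideal :: "('k::field, 'v) operad \<Rightarrow> (nat \<Rightarrow> 'v set) \<Rightarrow> bool" where
  "operad_ideal P I \<longleftrightarrow>
    (\<forall>n\<ge>1. VectorSpace.subspace class_ring (I n) (opspace P n)) \<and>
    (\<forall>n \<sigma>. \<forall>x\<in>I n. n \<ge> 1 \<and> \<sigma> permutes {1..n} \<longrightarrow> opact P n \<sigma> x \<in> I n) \<and>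
    (\<forall>m n i. \<forall>x\<in>I m. \<forall>b\<in>opcarrier P n. 1 \<le> i \<and> i \<le> m \<and> n \<ge> 1 \<longrightarrow>
      opcomp P m n i x b \<in> I (m + n - 1)) \<and>
    (\<forall>m n i. \<forall>a\<in>opcarrier P m. \<forall>x\<in>I n. 1 \<le> i \<and> i \<le> m \<and> n \<ge> 1 \<longrightarrow>
      opcomp P m n i a x \<in> I (m + n - 1))"

definition generated_ideal ::
    "('k::field, 'v) operad \<Rightarrow> (nat \<Rightarrow> 'v set) \<Rightarrow> nat \<Rightarrow> 'v set" where
  "generated_ideal P G n = \<Inter>{I n | I. operad_ideal P I \<and> (\<forall>r\<ge>1. G r \<subseteq> I r)}"

text \<open>The fields \<open>mult\<close> and \<open>one\<close> of a module record play no role.\<close>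

definition quotient_space :: "('k, 'v) module \<Rightarrow> 'v set \<Rightarrow> ('k, 'v set) module" where
  "quotient_space V U =
    \<lparr>carrier = a_rcosets\<^bsub>V\<^esub> U, mult = (\<lambda>A B. U), one = U,
     zero = U, add = (\<lambda>A B. A <+>\<^bsub>V\<^esub> B),
     smult = (\<lambda>c A. \<Union>a\<in>A. U +>\<^bsub>V\<^esub> (c \<odot>\<^bsub>V\<^esub> a))\<rparr>"

definition quotient_operad :: "('k, 'v) operad \<Rightarrow> (nat \<Rightarrow> 'v set) \<Rightarrow> ('k, 'v set) operad" where
  "quotient_operad P I =
    \<lparr>opspace = (\<lambda>n. quotient_space (opspace P n) (I n)),
     opunit = I 1 +>\<^bsub>opspace P 1\<^esub> opunit P,
     opcomp = (\<lambda>m n i A B. \<Union>a\<in>A. \<Union>b\<in>B.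
        I (m + n - 1) +>\<^bsub>opspace P (m + n - 1)\<^esub> opcomp P m n i a b),
     opact = (\<lambda>n \<sigma> A. \<Union>a\<in>A. I n +>\<^bsub>opspace P n\<^esub> opact P n \<sigma> a)\<rparr>"


subsection \<open>Spaces with a given basis\<close>

text \<open>Finite linear combinations of basis elements are elements of \<^typ>\<open>'b \<Rightarrow>\<^sub>0 'k\<close>.\<close>

definition basis_vec :: "'b \<Rightarrow> 'b \<Rightarrow>\<^sub>0 'k::field" where
  "basis_vec t = Poly_Mapping.single t 1"

definition scal :: "'k::field \<Rightarrow> ('b \<Rightarrow>\<^sub>0 'k) \<Rightarrow> 'b \<Rightarrow>\<^sub>0 'k" where
  "scal c = Poly_Mapping.map ((*) c)"

definition free_space :: "'b set \<Rightarrow> ('k::field, 'b \<Rightarrow>\<^sub>0 'k) module" where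
  "free_space B =
    \<lparr>carrier = {x. Poly_Mapping.keys x \<subseteq> B}, mult = (\<lambda>x y. 0), one = 0,
     zero = 0, add = (+), smult = scal\<rparr>"

definition lin_ext :: "('b \<Rightarrow> 'c \<Rightarrow>\<^sub>0 'k) \<Rightarrow> ('b \<Rightarrow>\<^sub>0 'k) \<Rightarrow> 'c \<Rightarrow>\<^sub>0 'k::field" where
  "lin_ext f x = (\<Sum>t\<in>Poly_Mapping.keys x. scal (Poly_Mapping.lookup x t) (f t))"

definition bilin_ext ::
    "('a \<Rightarrow> 'b \<Rightarrow> 'c \<Rightarrow>\<^sub>0 'k) \<Rightarrow> ('a \<Rightarrow>\<^sub>0 'k) \<Rightarrow> ('b \<Rightarrow>\<^sub>0 'k) \<Rightarrow> 'c \<Rightarrow>\<^sub>0 'k::field" where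
  "bilin_ext f x y = lin_ext (\<lambda>s. lin_ext (\<lambda>t. f s t) y) x"


section \<open>The operad governing post-Lie algebras\<close>

subsection \<open>The free operad on binary generators without symmetries\<close>

datatype ('g, 'l) op_tree = Input 'l | App 'g "('g, 'l) op_tree" "('g, 'l) op_tree"

primrec inputs :: "('g, 'l) op_tree \<Rightarrow> 'l list" where
  "inputs (Input j) = [j]"
| "inputs (App g s t) = inputs s @ inputs t"

definition op_trees :: "nat \<Rightarrow> ('g, nat) op_tree set" where
  "op_trees n = {t. distinct (inputs t) \<and> set (inputs t) = {1..n}}"

primrec op_subst :: "('l \<Rightarrow> ('g, 'm) op_tree) \<Rightarrow> ('g, 'l) op_tree \<Rightarrow> ('g, 'm) op_tree" where
  "op_subst f (Input j) = f j"
| "op_subst f (App g s t) = App g (op_subst f s) (op_subst f t)"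

definition op_tree_comp ::
    "nat \<Rightarrow> nat \<Rightarrow> ('g, nat) op_tree \<Rightarrow> ('g, nat) op_tree \<Rightarrow> ('g, nat) op_tree" where
  "op_tree_comp n i T R =
    op_subst (\<lambda>j. if j < i then Input j
                   else if j = i then map_op_tree id (\<lambda>k. k + i - 1) R
                   else Input (j + n - 1)) T"

definition free_binary_operad :: "('k::field, ('g, nat) op_tree \<Rightarrow>\<^sub>0 'k) operad" where
  "free_binary_operad =
    \<lparr>opspace = (\<lambda>n. free_space (op_trees n)),
     opunit = basis_vec (Input 1),
     opcomp = (\<lambda>m n i. bilin_ext (\<lambda>T R. basis_vec (op_tree_comp n i T R))),
     opact = (\<lambda>n \<sigma>. lin_ext (\<lambda>T. basis_vec (map_op_tree id \<sigma> T)))\<rparr>"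


subsection \<open>Generators and relations\<close>

datatype post_lie_gen = Bracket | Triangle

type_synonym 'k post_lie_term = "(post_lie_gen, nat) op_tree \<Rightarrow>\<^sub>0 'k"

definition var :: "nat \<Rightarrow> 'k::field post_lie_term" where
  "var j = basis_vec (Input j)"

definition br :: "'k::field post_lie_term \<Rightarrow> 'k post_lie_term \<Rightarrow> 'k post_lie_term" where
  "br = bilin_ext (\<lambda>s t. basis_vec (App Bracket s t))"

definition tri :: "'k::field post_lie_term \<Rightarrow> 'k post_lie_term \<Rightarrow> 'k post_lie_term" (infixr "\<rhd>" 75)
  where "tri = bilin_ext (\<lambda>s t. basis_vec (App Triangle s t))"

definition assoc ::
    "'k::field post_lie_term \<Rightarrow> 'k post_lie_term \<Rightarrow> 'k post_lie_term \<Rightarrow> 'k post_lie_term" where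
  "assoc x y z = x \<rhd> (y \<rhd> z) - (x \<rhd> y) \<rhd> z"

text \<open>
  The antisymmetry of the bracket generator is imposed as the relation in arity \<open>2\<close>.
\<close>

definition post_lie_relations :: "nat \<Rightarrow> 'k::field post_lie_term set" where
  "post_lie_relations n =
    (let x = var 1; y = var 2; z = var 3
     in if n = 2 then {br x y + br y x}
        else if n = 3 then
          {br x (br y z) + br y (br z x) + br z (br x y),
           z \<rhd> br x y - (br (z \<rhd> x) y + br x (z \<rhd> y)),
           br x y \<rhd> z - (assoc x y z - assoc y x z)}
        else {})"

definition PostLie :: "('k::field, 'k post_lie_term set) operad" where
  "PostLie = quotient_operad free_binary_operad
     (generated_ideal free_binary_operad post_lie_relations)"


section \<open>Partially labeled planar rooted trees\<close>

text \<open>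
  \<open>Node a ts\<close> has root label \<open>a\<close> (\<^const>\<open>None\<close> if unlabeled); \<open>ts\<close> lists the subtrees at the
  incoming edges of the root, from left to right.
\<close>

datatype 'a ptree = Node (root_label: "'a option") (branches: "'a ptree list")

text \<open>
  A vertex is addressed by the path leading to it from the root: \<open>[]\<close> is the root and \<open>p @ [k]\<close>
  is the source of the \<open>k\<close>-th incoming edge of \<open>p\<close>. So the successor of a non-root vertex \<open>p\<close> is
  \<^term>\<open>butlast p\<close>.
\<close>

fun verts :: "'a ptree \<Rightarrow> nat list set" where
  "verts (Node a ts) = insert [] {k # p | k p. k < length ts \<and> p \<in> map verts ts ! k}"

fun subtree_at :: "'a ptree \<Rightarrow> nat list \<Rightarrow> 'a ptree" where
  "subtree_at t [] = t"
| "subtree_at t (k # p) = subtree_at (branches t ! k) p"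

fun replace_at :: "'a ptree \<Rightarrow> nat list \<Rightarrow> 'a ptree \<Rightarrow> 'a ptree" where
  "replace_at t [] s = s"
| "replace_at (Node a ts) (k # p) s = Node a (ts[k := replace_at (ts ! k) p s])"

definition label_at :: "'a ptree \<Rightarrow> nat list \<Rightarrow> 'a option" where
  "label_at t p = root_label (subtree_at t p)"

definition incoming :: "'a ptree \<Rightarrow> nat list \<Rightarrow> 'a ptree list" where
  "incoming t p = branches (subtree_at t p)"

definition unlabeled :: "'a ptree \<Rightarrow> nat list set" where
  "unlabeled t = {p \<in> verts t. label_at t p = None}"

definition vertex :: "'a ptree \<Rightarrow> 'a \<Rightarrow> nat list" where
  "vertex t i = (THE p. p \<in> verts t \<and> label_at t p = Some i)"

definition PT :: "nat \<Rightarrow> nat ptree set" where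
  "PT n = {t. bij_betw (\<lambda>p. the (label_at t p)) (verts t - unlabeled t) {1..n}}"

primrec graft :: "('a \<Rightarrow> 'a ptree list) \<Rightarrow> 'a ptree \<Rightarrow> 'a ptree" where
  "graft g (Node a ts) =
    Node a ((case a of None \<Rightarrow> [] | Some w \<Rightarrow> g w) @ map (graft g) ts)"

text \<open>
  \<open>pt_comp n i T R\<close> is \<open>T \<circ>\<^sub>i R = \<Sum>\<^sub>\<phi> T \<circ>\<^sub>i\<^sup>\<phi> R\<close> for \<open>R\<close> with \<open>n\<close> labels. The labels of \<open>T\<close> and \<open>R\<close>
  are first shifted to their final values (\<open>i\<close> keeps its label until it is replaced); a map
  \<open>\<phi>\<close> from the incoming edges of \<open>i\<close>, given by their positions, to the labeled vertices of \<open>R\<close>,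
  given by their labels, is encoded as an extensional function.
\<close>

definition pt_comp :: "nat \<Rightarrow> nat \<Rightarrow> nat ptree \<Rightarrow> nat ptree \<Rightarrow> nat ptree \<Rightarrow>\<^sub>0 'k::field" where
  "pt_comp n i T R =
    (let T' = map_ptree (\<lambda>j. if j \<le> i then j else j + n - 1) T;
         R' = map_ptree (\<lambda>j. j + i - 1) R;
         v = vertex T' i;
         es = incoming T' v
     in \<Sum>\<phi>\<in>{..<length es} \<rightarrow>\<^sub>E set_ptree R'.
          basis_vec (replace_at T' v
            (graft (\<lambda>w. [es ! k. k \<leftarrow> [0..<length es], \<phi> k = w]) R')))"


section \<open>The operad LW\<close>

definition L_trees :: "nat \<Rightarrow> nat ptree set" where
  "L_trees n = {t \<in> PT n. unlabeled t = {}}"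

definition W_trees :: "nat \<Rightarrow> nat ptree set" where
  "W_trees n =
    {t \<in> PT n. n \<ge> 2 \<and>
       label_at t [] = None \<and>
       (\<forall>p\<in>unlabeled t. p \<noteq> [] \<longrightarrow> label_at t (butlast p) = None) \<and>
       (\<forall>p\<in>unlabeled t. length (incoming t p) = 2)}"

text \<open>
  An element \<open>\<sigma>\<close> of \<open>S\<^sub>2\<^bsup>V\<^esup>\<close>, where \<open>V\<close> is the set of unlabeled vertices of \<open>R\<close>, is encoded as the
  set \<open>A \<subseteq> V\<close> of those \<open>v\<close> with \<open>\<sigma>\<^sub>v \<noteq> id\<close>; thus \<open>\<epsilon>(\<sigma>) = (-1)\<^bsup>card A\<^esup>\<close> and \<open>R\<^sub>\<sigma> = exchange A R\<close>.
  Addresses in \<open>A\<close> refer to \<open>R\<close> before any exchange. Elements of \<open>A\<close> have two incoming edges, so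
  that \<^const>\<open>rev\<close> swaps them.
\<close>

function exchange :: "nat list set \<Rightarrow> 'a ptree \<Rightarrow> 'a ptree" where
  "exchange A (Node a ts) =
    Node a ((if [] \<in> A then rev else id)
      (map (\<lambda>k. exchange {p. k # p \<in> A} (ts ! k)) [0..<length ts]))"
  by pat_completeness auto
termination
  by (relation "measure (size \<circ> snd)") (auto simp: less_Suc_eq_le intro!: trans_le_add2 size_list_estimation')

text \<open>\<open>Con\<close>: contraction of all edges joining two unlabeled vertices.\<close>

fun contract_unlabeled :: "'a ptree \<Rightarrow> 'a ptree" where
  "contract_unlabeled (Node a ts) =
    Node a (concat (map (\<lambda>t. if a = None \<and> root_label t = None
                              then branches (contract_unlabeled t)
                              else [contract_unlabeled t]) ts))"

text \<open>Contraction of the edge going out of the non-root vertex \<open>r\<close>.\<close>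

definition contract_edge :: "nat list \<Rightarrow> 'a ptree \<Rightarrow> 'a ptree" where
  "contract_edge r t =
    (let s = butlast r; k = last r; es = incoming t s
     in replace_at t s (Node (label_at t s) (take k es @ incoming t r @ drop (Suc k) es)))"

text \<open>
  In \<open>T \<circ>\<^sub>i Con(R\<^sub>\<sigma>)\<close> the root of \<open>Con(R\<^sub>\<sigma>)\<close> has the address that the vertex labeled \<open>i\<close> has in \<open>T\<close>.
\<close>

definition lw_comp :: "nat \<Rightarrow> nat \<Rightarrow> nat ptree \<Rightarrow> nat ptree \<Rightarrow> nat ptree \<Rightarrow>\<^sub>0 'k::field" where
  "lw_comp n i T R =
    (let v = vertex T i
     in if R \<in> W_trees n \<and> v \<noteq> [] \<and> label_at T (butlast v) \<noteq> None
        then \<Sum>A\<in>Pow (unlabeled R).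
               scal ((- 1) ^ card A)
                 (lin_ext (\<lambda>t. basis_vec (contract_edge v t))
                   (pt_comp n i T (contract_unlabeled (exchange A R))))
        else pt_comp n i T R)"

definition LW :: "('k::field, nat ptree \<Rightarrow>\<^sub>0 'k) operad" where
  "LW =
    \<lparr>opspace = (\<lambda>n. free_space (L_trees n \<union> W_trees n)),
     opunit = basis_vec (Node (Some 1) []),
     opcomp = (\<lambda>m n i. bilin_ext (lw_comp n i)),
     opact = (\<lambda>n \<sigma>. lin_ext (\<lambda>t. basis_vec (map_ptree \<sigma> t)))\<rparr>"


section \<open>The quotient operad PSB\<close>

abbreviation leaf :: "'a \<Rightarrow> 'a ptree" where
  "leaf i \<equiv> Node (Some i) []"

abbreviation corolla :: "'a ptree \<Rightarrow> 'a ptree \<Rightarrow> 'a ptree" where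
  "corolla s t \<equiv> Node None [s, t]"

definition psb_relations :: "nat \<Rightarrow> (nat ptree \<Rightarrow>\<^sub>0 'k::field) set" where
  "psb_relations n =
    (if n = 2 then
       {basis_vec (corolla (leaf 1) (leaf 2)) + basis_vec (corolla (leaf 2) (leaf 1))}
     else if n = 3 then
       {basis_vec (corolla (leaf 1) (corolla (leaf 2) (leaf 3)))
        - basis_vec (corolla (corolla (leaf 1) (leaf 2)) (leaf 3))
        - basis_vec (corolla (leaf 2) (corolla (leaf 1) (leaf 3)))}
     else {})"

definition PSB :: "('k::field, (nat ptree \<Rightarrow>\<^sub>0 'k) set) operad" where
  "PSB = quotient_operad LW (generated_ideal LW psb_relations)"

end

theory Submission
  imports Defs
begin

text \<open>
  Let \<open>A\<close> be spanned by binary brackets of planar labeled trees. Expanding brackets as commutators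
  turns an element of \<open>A\<close> into a combination of words in planar trees; letting such a word act by
  grafting it, undivided and leftmost, onto every vertex in turn defines a product on \<open>A\<close> that
  satisfies the two mixed post-Lie axioms exactly. Conversely, in every algebra with these two
  axioms a planar tree with root \<open>a\<close> and branches \<open>t\<^sub>1, \<dots>, t\<^sub>k\<close> can be evaluated by the Guin-Oudom
  action of \<open>t\<^sub>1 \<dots> t\<^sub>k\<close> on the value of \<open>a\<close>, and this evaluation is a homomorphism. Evaluation in \<open>A\<close>
  itself is the composition of \<open>LW\<close>. Hence the homomorphism from the free operad to \<open>A\<close> is a
  surjective morphism onto \<open>LW\<close>, which thereby inherits the operad axioms; evaluation in the free
  operad modulo the two axioms shows that these generate its kernel. What remains of the relations
  on either side is antisymmetry and the Jacobi identity.
\<close>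

section \<open>Linear extension\<close>

text \<open>The composition of \<open>LW\<close> is awkward to verify directly: its two cases, the
  signs and the contraction interact in every associativity law. They have one source. A value
  substituted at a vertex whose successor is labeled acts on that successor, and an acting element
  matters only through its commutators; a value substituted anywhere else keeps its brackets. The
  sum over exchanges is the expansion of commutators, and the contraction turns the resulting word
  into branches. Brackets are left free, as binary trees, rather than taken in the free Lie algebra
  on planar trees. The two mixed axioms hold there without antisymmetry or Jacobi, so the Lie
  relations can be imposed afterwards on both sides, as ideals compared inside one free operad. The
  remaining obstacle is that evaluation takes place in a free algebra with arbitrary terms, whereas
  an operadic ideal consists of combinations of trees using each input once. An operadic ideal is
  extended to the algebra by testing multilinear components only; terms with a repeated input are in
  the extension automatically.\<close>

abbreviation supp :: "('b \<Rightarrow>\<^sub>0 'k::zero) \<Rightarrow> 'b set" where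
  "supp \<equiv> Poly_Mapping.keys"

text \<open>Linearity is required on all finite combinations, without a carrier, so that identities
  can be checked on basis vectors by rewriting. Carriers return only when operad records are
  formed.\<close>

definition is_lin :: "(('b \<Rightarrow>\<^sub>0 'k::field) \<Rightarrow> ('c \<Rightarrow>\<^sub>0 'k)) \<Rightarrow> bool" where
  "is_lin F \<longleftrightarrow> (\<forall>x y. F (x + y) = F x + F y) \<and> (\<forall>c x. F (scal c x) = scal c (F x))"

lemma lookup_scal [simp]: "Poly_Mapping.lookup (scal c x) t = c * Poly_Mapping.lookup x t"
  unfolding scal_def by (simp add: Poly_Mapping.map.rep_eq when_def)

lemma scal_simps [simp]:
  "scal c (x + y) = scal c x + scal c y" "scal c (x - y) = scal c x - scal c y"
  "scal c (- x) = - scal c x" "scal c 0 = 0" "scal 0 x = 0" "scal 1 x = x"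
  "scal a (scal b x) = scal (a * b) x" "scal (- c) x = - scal c x"
  by (auto intro!: poly_mapping_eqI simp: lookup_add lookup_minus algebra_simps)

lemma scal_add_left: "scal (a + b) x = scal a x + scal b x"
  by (auto intro!: poly_mapping_eqI simp: lookup_add algebra_simps)

lemma scal_sum: "scal c (sum f S) = (\<Sum>s\<in>S. scal c (f s))"
  by (induct S rule: infinite_finite_induct) auto

lemma is_linI:
  "(\<And>x y. F (x + y) = F x + F y) \<Longrightarrow> (\<And>c x. F (scal c x) = scal c (F x)) \<Longrightarrow> is_lin F"
  by (simp add: is_lin_def)

lemma is_lin_simps:
  assumes "is_lin F"
  shows "F (x + y) = F x + F y" "F (x - y) = F x - F y" "F (- x) = - F x"
    "F 0 = 0" "F (scal c x) = scal c (F x)" "F (sum g S) = (\<Sum>s\<in>S. F (g s))"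
proof -
  show add: "F (x + y) = F x + F y" for x y using assms by (simp add: is_lin_def)
  show sc: "F (scal c x) = scal c (F x)" for c x using assms by (simp add: is_lin_def)
  show zero: "F 0 = 0" using sc[of 0 0] by simp
  show neg: "F (- x) = - F x" for x using sc[of "-1" x] by simp
  show "F (x - y) = F x - F y" using add[of x "- y"] neg[of y] by simp
  show "F (sum g S) = (\<Sum>s\<in>S. F (g s))"
    by (induct S rule: infinite_finite_induct) (auto simp: add zero)
qed

lemma lin_ext_superset:
  assumes "finite S" "supp x \<subseteq> S"
  shows "lin_ext f x = (\<Sum>t\<in>S. scal (Poly_Mapping.lookup x t) (f t))"
  unfolding lin_ext_def using assms
  by (intro sum.mono_neutral_left) (auto simp: in_keys_iff)

lemma is_lin_lin_ext [simp, intro]: "is_lin (lin_ext f)"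
proof (rule is_linI)
  fix x y :: "'a \<Rightarrow>\<^sub>0 'b" and c
  let ?S = "supp x \<union> supp y"
  have "supp (x + y) \<subseteq> ?S" by (rule Poly_Mapping.keys_add)
  then show "lin_ext f (x + y) = lin_ext f x + lin_ext f y"
    by (simp add: lin_ext_superset[of ?S] lookup_add scal_add_left sum.distrib)
  have "supp (scal c x) \<subseteq> supp x" by (auto simp: in_keys_iff)
  then show "lin_ext f (scal c x) = scal c (lin_ext f x)"
    by (simp add: lin_ext_superset[of "supp x"] scal_sum)
qed

lemmas lin_ext_simps [simp] = is_lin_simps[OF is_lin_lin_ext]

lemma lin_ext_basis [simp]: "lin_ext f (basis_vec t) = f t"
  by (simp add: lin_ext_def basis_vec_def)

lemma lookup_basis_vec: "Poly_Mapping.lookup (basis_vec s) t = (if s = t then 1 else 0)"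
  by (simp add: basis_vec_def lookup_single when_def)

lemma lin_ext_basis_vec [simp]: "lin_ext basis_vec x = x"
proof (rule poly_mapping_eqI)
  fix t
  have "(\<Sum>s\<in>supp x. Poly_Mapping.lookup x s * (if s = t then 1 else 0)) =
      (\<Sum>s\<in>supp x. if s = t then Poly_Mapping.lookup x s else 0)"
    by (intro sum.cong) auto
  then show "Poly_Mapping.lookup (lin_ext basis_vec x) t = Poly_Mapping.lookup x t"
    by (simp add: lin_ext_def lookup_sum lookup_basis_vec in_keys_iff)
qed

lemma lin_lin_ext: "is_lin F \<Longrightarrow> F (lin_ext f x) = lin_ext (\<lambda>t. F (f t)) x"
  by (simp add: lin_ext_def is_lin_simps)

lemma lin_ext_cong:
  "x = y \<Longrightarrow> (\<And>t. t \<in> supp y \<Longrightarrow> f t = g t) \<Longrightarrow> lin_ext f x = lin_ext g y"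
  by (simp add: lin_ext_def)

lemma lin_eq_lin_ext: "is_lin F \<Longrightarrow> F x = lin_ext (\<lambda>t. F (basis_vec t)) x"
  using lin_lin_ext[of F basis_vec x] by simp

lemma lin_eqI:
  assumes "is_lin F" "is_lin G" "\<And>t. t \<in> supp x \<Longrightarrow> F (basis_vec t) = G (basis_vec t)"
  shows "F x = G x"
proof -
  have "lin_ext (\<lambda>t. F (basis_vec t)) x = lin_ext (\<lambda>t. G (basis_vec t)) x"
    using assms(3) by (intro lin_ext_cong) auto
  then show ?thesis using lin_eq_lin_ext[OF assms(1)] lin_eq_lin_ext[OF assms(2)] by metis
qed

lemma lin_ext_fun_simps [simp]:
  "lin_ext (\<lambda>t. f t + g t) x = lin_ext f x + lin_ext g x"
  "lin_ext (\<lambda>t. f t - g t) x = lin_ext f x - lin_ext g x"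
  "lin_ext (\<lambda>t. - f t) x = - lin_ext f x"
  "lin_ext (\<lambda>t. 0) x = 0"
  "lin_ext (\<lambda>t. scal c (f t)) x = scal c (lin_ext f x)"
  by (auto simp: lin_ext_def sum.distrib sum_subtractf sum_negf scal_sum mult.commute)

lemma lin_ext_fun_sum: "lin_ext (\<lambda>t. \<Sum>s\<in>S. f s t) x = (\<Sum>s\<in>S. lin_ext (f s) x)"
  by (induct S rule: infinite_finite_induct) auto

lemma lin_ext_lin_ext: "lin_ext f (lin_ext g x) = lin_ext (\<lambda>t. lin_ext f (g t)) x"
  by (rule lin_lin_ext) simp

text \<open>Two finite sums may be exchanged. This identifies the two nestings of linear extensions
  that arise when independent insertions are made in different orders.\<close>

lemma lin_ext_swap:
  "lin_ext (\<lambda>s. lin_ext (\<lambda>t. f s t) y) x = lin_ext (\<lambda>t. lin_ext (\<lambda>s. f s t) x) y"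
  unfolding lin_ext_def scal_sum by (subst sum.swap) (simp add: mult.commute)

lemma is_lin_intros [intro]:
  "is_lin (\<lambda>x. x)" "is_lin (\<lambda>x. 0)"
  "is_lin F \<Longrightarrow> is_lin G \<Longrightarrow> is_lin (\<lambda>x. F x + G x)"
  "is_lin F \<Longrightarrow> is_lin G \<Longrightarrow> is_lin (\<lambda>x. F x - G x)"
  "is_lin F \<Longrightarrow> is_lin (\<lambda>x. - F x)"
  "is_lin F \<Longrightarrow> is_lin (\<lambda>x. scal c (F x))"
  "is_lin F \<Longrightarrow> is_lin (\<lambda>x. lin_ext f (F x))"
  by (auto simp: is_lin_def mult.commute)

lemma is_lin_sum: "(\<And>s. s \<in> S \<Longrightarrow> is_lin (F s)) \<Longrightarrow> is_lin (\<lambda>x. \<Sum>s\<in>S. F s x)"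
  by (induct S rule: infinite_finite_induct) auto

lemma is_lin_compose: "is_lin F \<Longrightarrow> is_lin G \<Longrightarrow> is_lin (\<lambda>x. F (G x))"
  by (simp add: is_lin_def)

lemma is_lin_lin_ext_fun: "(\<And>t. is_lin (F t)) \<Longrightarrow> is_lin (\<lambda>x. lin_ext (\<lambda>t. F t x) y)"
  by (simp add: is_lin_def)

lemma is_lin_bilin_ext [simp, intro]: "is_lin (bilin_ext f x)" "is_lin (\<lambda>x. bilin_ext f x y)"
  unfolding bilin_ext_def by (auto intro!: is_lin_lin_ext_fun)

lemmas bilin_ext_simps [simp] = is_lin_simps[OF is_lin_bilin_ext(1)] is_lin_simps[OF is_lin_bilin_ext(2)]

lemma bilin_ext_basis:
  "bilin_ext f (basis_vec s) y = lin_ext (f s) y"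
  "bilin_ext f x (basis_vec t) = lin_ext (\<lambda>s. f s t) x"
  by (simp_all add: bilin_ext_def)

lemma keys_basis_vec [simp]: "supp (basis_vec t :: _ \<Rightarrow>\<^sub>0 'k::field) = {t}"
  by (simp add: basis_vec_def)

lemma keys_scal: "supp (scal c x) \<subseteq> supp x"
  by (auto simp: in_keys_iff)

lemma keys_minus_subset:
  "supp (x - y :: _ \<Rightarrow>\<^sub>0 'k::field) \<subseteq> supp x \<union> supp y"
  by (auto simp: in_keys_iff lookup_minus)

lemma keys_sum_subset: "supp (sum f S) \<subseteq> (\<Union>s\<in>S. supp (f s))"
proof (induct S rule: infinite_finite_induct)
  case (insert s S)
  then show ?case using Poly_Mapping.keys_add[of "f s" "sum f S"] by auto
qed auto

lemma keys_lin_ext: "supp (lin_ext f x) \<subseteq> (\<Union>t\<in>supp x. supp (f t))"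
  unfolding lin_ext_def using keys_sum_subset[of _ "supp x"] keys_scal by fastforce

section \<open>An algebra of bracketed planar trees\<close>

abbreviation lmap :: "('b \<Rightarrow> 'c) \<Rightarrow> ('b \<Rightarrow>\<^sub>0 'k::field) \<Rightarrow> 'c \<Rightarrow>\<^sub>0 'k" where
  "lmap h \<equiv> lin_ext (\<lambda>t. basis_vec (h t))"

text \<open>Only basis vectors in the supports have to be compared, so an identity known for trees
  of given arities yields one for combinations of such trees.\<close>

lemma trilin_eqI:
  assumes "\<And>y z. is_lin (\<lambda>x. F x y z)" "\<And>x z. is_lin (\<lambda>y. F x y z)" "\<And>x y. is_lin (\<lambda>z. F x y z)"
    and "\<And>y z. is_lin (\<lambda>x. G x y z)" "\<And>x z. is_lin (\<lambda>y. G x y z)" "\<And>x y. is_lin (\<lambda>z. G x y z)"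
    and "\<And>r s t. r \<in> supp x \<Longrightarrow> s \<in> supp y \<Longrightarrow> t \<in> supp z \<Longrightarrow>
      F (basis_vec r) (basis_vec s) (basis_vec t) = G (basis_vec r) (basis_vec s) (basis_vec t)"
  shows "F x y z = G x y z"
proof -
  have 1: "F (basis_vec r) (basis_vec s) z = G (basis_vec r) (basis_vec s) z"
    if "r \<in> supp x" "s \<in> supp y" for r s
    by (rule lin_eqI[OF assms(3,6)]) (rule assms(7)[OF that])
  have 2: "F (basis_vec r) y z = G (basis_vec r) y z" if "r \<in> supp x" for r
    by (rule lin_eqI[OF assms(2,5)]) (rule 1[OF that])
  show ?thesis by (rule lin_eqI[OF assms(1,4)]) (rule 2)
qed

text \<open>Inductive steps for symmetric identities have this shape: the difference of the two
  sides on a compound object is the sum of the differences on its parts.\<close>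

lemma eq_by_differences:
  fixes a b :: "'b::ab_group_add"
  assumes "a - b = (c - d) + (e - f)" "c = d" "e = f"
  shows "a = b"
  using assms by simp

text \<open>Up to the embedding \<open>eW\<close> into \<^typ>\<open>'a ptree\<close> below, the trees \<open>Leaf t\<close> span \<open>L\<close> and the trees
  \<open>Br a b\<close> span \<open>W\<close>.\<close>

datatype 'a pl = PN 'a "'a pl list"

datatype 'a lw = Leaf "'a pl" | Br "'a lw" "'a lw"

text \<open>\<open>ins w t\<close> attaches the word \<open>w\<close>, undivided, to every vertex of \<open>t\<close> in turn; \<open>insF w\<close> is the
  induced derivation on words.\<close>

fun ins :: "'a pl list \<Rightarrow> 'a pl \<Rightarrow> 'a pl \<Rightarrow>\<^sub>0 'k::field"
  and insF :: "'a pl list \<Rightarrow> 'a pl list \<Rightarrow> 'a pl list \<Rightarrow>\<^sub>0 'k" where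
  "ins w (PN a ts) = basis_vec (PN a (w @ ts)) + lmap (PN a) (insF w ts)"
| "insF w [] = 0"
| "insF w (t # ts) = lmap (\<lambda>t'. t' # ts) (ins w t) + lmap (\<lambda>ts'. t # ts') (insF w ts)"

lemma insF_append:
  "insF w (us @ ts) = lmap (\<lambda>u. u @ ts) (insF w us) + lmap (\<lambda>t. us @ t) (insF w ts)"
  by (induct us) (simp_all add: lin_ext_lin_ext)

text \<open>Written by positions, the derivation has the same form as the correction sum in the
  recursion of \<open>act\<close>.\<close>

lemma insF_index:
  "insF w ts = (\<Sum>j<length ts. lmap (\<lambda>t'. ts[j := t']) (ins w (ts ! j)))"
proof (induct ts)
  case (Cons t ts)
  then show ?case
    by (simp add: lin_ext_lin_ext sum.lessThan_Suc_shift del: sum.lessThan_Suc)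
qed simp

text \<open>When \<open>w2\<close> and then \<open>w1\<close> are attached, \<open>w1\<close> lands
  on the vertex that received \<open>w2\<close>, inside a tree of \<open>w2\<close>, or on another
  vertex of \<open>t\<close>. The two subtracted terms are the first two cases; the third is
  symmetric in the two words. Leftmost attachment is why the first case gives
  \<open>w1 @ w2\<close>.\<close>

lemma fixes w1 w2 :: "'a pl list"
  shows ins_ins: "lin_ext (ins w1) (ins w2 t) - ins (w1 @ w2) t - lin_ext (\<lambda>w. ins w t) (insF w1 w2) =
      (lin_ext (ins w2) (ins w1 t) - ins (w2 @ w1) t - lin_ext (\<lambda>w. ins w t) (insF w2 w1)
        :: 'a pl \<Rightarrow>\<^sub>0 'k::field)"
    and insF_insF: "lin_ext (insF w1) (insF w2 ts) - insF (w1 @ w2) ts - lin_ext (\<lambda>w. insF w ts) (insF w1 w2) =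
      (lin_ext (insF w2) (insF w1 ts) - insF (w2 @ w1) ts - lin_ext (\<lambda>w. insF w ts) (insF w2 w1)
        :: 'a pl list \<Rightarrow>\<^sub>0 'k)"
proof (induct w1 t and w1 ts rule: ins_insF.induct)
  case (1 w1 a ts)
  from arg_cong[OF this, of "lmap (PN a)"] show ?case
    by (simp add: lin_ext_lin_ext insF_append algebra_simps)
next
  case (2 w1)
  then show ?case by simp
next
  case (3 w1 t ts)
  \<comment> \<open>The terms with one word in the head and the other in the tail occur on both
    sides, in opposite nesting.\<close>
  note swap = lin_ext_swap[of "\<lambda>ts' t'. basis_vec (t' # ts')"]
  show ?case
    by (rule eq_by_differences[OF _ arg_cong[OF 3(1), of "lmap (\<lambda>t. t # ts)"]
          arg_cong[OF 3(2), of "lmap (\<lambda>ts. t # ts)"]])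
      (simp add: lin_ext_lin_ext swap[of "ins w1 t" "insF w2 ts"] swap[of "ins w2 t" "insF w1 ts"]
        algebra_simps)
qed

section \<open>The product given by commutator expansion\<close>

definition cat :: "('b list \<Rightarrow>\<^sub>0 'k::field) \<Rightarrow> ('b list \<Rightarrow>\<^sub>0 'k) \<Rightarrow> 'b list \<Rightarrow>\<^sub>0 'k" where
  "cat = bilin_ext (\<lambda>u v. basis_vec (u @ v))"

lemma cat_basis [simp]:
  "cat (basis_vec u) y = lmap (\<lambda>v. u @ v) y" "cat x (basis_vec v) = lmap (\<lambda>u. u @ v) x"
  by (simp_all add: cat_def bilin_ext_basis)

lemma is_lin_cat [simp, intro]: "is_lin (cat x)" "is_lin (\<lambda>x. cat x y)"
  by (simp_all add: cat_def)

lemmas cat_simps [simp] = is_lin_simps[OF is_lin_cat(1)] is_lin_simps[OF is_lin_cat(2)]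

lemma insF_cat:
  "lin_ext (insF w) (cat x y) = cat (lin_ext (insF w) x) y + cat x (lin_ext (insF w) y)"
  by (simp add: cat_def bilin_ext_def lin_ext_lin_ext insF_append)
    (simp add: lin_ext_swap[of _ _ y])

primrec expand :: "'a lw \<Rightarrow> 'a pl list \<Rightarrow>\<^sub>0 'k::field" where
  "expand (Leaf t) = basis_vec [t]"
| "expand (Br a b) = cat (expand a) (expand b) - cat (expand b) (expand a)"

primrec insW :: "'a pl list \<Rightarrow> 'a lw \<Rightarrow> 'a lw \<Rightarrow>\<^sub>0 'k::field" where
  "insW w (Leaf t) = lmap Leaf (ins w t)"
| "insW w (Br a b) = lmap (\<lambda>a'. Br a' b) (insW w a) + lmap (\<lambda>b'. Br a b') (insW w b)"

text \<open>Only the acting argument is expanded into words; the other keeps its formal brackets.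
  The product can therefore satisfy the mixed axioms although \<open>Br\<close> is neither
  antisymmetric nor subject to the Jacobi identity.\<close>

definition gr :: "'a lw \<Rightarrow> 'a lw \<Rightarrow> 'a lw \<Rightarrow>\<^sub>0 'k::field" where
  "gr a b = lin_ext (\<lambda>w. insW w b) (expand a)"

definition grL :: "('a lw \<Rightarrow>\<^sub>0 'k::field) \<Rightarrow> ('a lw \<Rightarrow>\<^sub>0 'k) \<Rightarrow> 'a lw \<Rightarrow>\<^sub>0 'k" where
  "grL = bilin_ext gr"

definition brL :: "('a lw \<Rightarrow>\<^sub>0 'k::field) \<Rightarrow> ('a lw \<Rightarrow>\<^sub>0 'k) \<Rightarrow> 'a lw \<Rightarrow>\<^sub>0 'k" where
  "brL = bilin_ext (\<lambda>a b. basis_vec (Br a b))"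

lemma is_lin_brL_grL [simp, intro]:
  "is_lin (brL x)" "is_lin (\<lambda>x. brL x y)" "is_lin (grL x)" "is_lin (\<lambda>x. grL x y)"
  by (simp_all add: brL_def grL_def)

lemmas brL_grL_simps [simp] =
  is_lin_simps[OF is_lin_brL_grL(1)] is_lin_simps[OF is_lin_brL_grL(2)]
  is_lin_simps[OF is_lin_brL_grL(3)] is_lin_simps[OF is_lin_brL_grL(4)]

lemma brL_basis:
  "brL (basis_vec a) y = lmap (Br a) y" "brL x (basis_vec b) = lmap (\<lambda>a. Br a b) x"
  by (simp_all add: brL_def bilin_ext_basis)

lemma grL_basis:
  "grL (basis_vec a) y = lin_ext (gr a) y" "grL x (basis_vec b) = lin_ext (\<lambda>a. gr a b) x"
  by (simp_all add: grL_def bilin_ext_basis)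

text \<open>Insertion is a derivation both of \<open>Br\<close> and of concatenation, hence commutes
  with forming commutators.\<close>

lemma expand_insW: "lin_ext expand (insW w b) = lin_ext (insF w) (expand b)"
proof (induct b)
  case (Leaf t)
  then show ?case by (simp add: lin_ext_lin_ext)
next
  case (Br a b)
  have 1: "lin_ext (\<lambda>a'. cat (expand a') y) x = cat (lin_ext expand x) y" for x y
    using lin_lin_ext[of "\<lambda>u. cat u y" expand x] by auto
  have 2: "lin_ext (\<lambda>a'. cat y (expand a')) x = cat y (lin_ext expand x)" for x y
    using lin_lin_ext[of "cat y" expand x] by auto
  show ?case by (simp add: lin_ext_lin_ext insF_cat 1 2 Br algebra_simps)
qed

text \<open>The identity for single planar trees passes to brackets, since insertions into different
  arguments of a bracket commute.\<close>

lemma insW_insW: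
  "lin_ext (insW w1) (insW w2 b) - insW (w1 @ w2) b - lin_ext (\<lambda>w. insW w b) (insF w1 w2) =
    lin_ext (insW w2) (insW w1 b) - insW (w2 @ w1) b - lin_ext (\<lambda>w. insW w b) (insF w2 w1)"
proof (induct b)
  case (Leaf t)
  from arg_cong[OF ins_ins[of w1 w2 t], of "lmap Leaf"] show ?case
    by (simp add: lin_ext_lin_ext algebra_simps)
next
  case (Br a b)
  note swap = lin_ext_swap[of "\<lambda>b' a'. basis_vec (Br a' b')"]
  show ?case
    by (rule eq_by_differences[OF _ arg_cong[OF Br(1), of "lmap (\<lambda>a. Br a b)"]
          arg_cong[OF Br(2), of "lmap (Br a)"]])
      (simp add: lin_ext_lin_ext swap[of "insW w1 a" "insW w2 b"] swap[of "insW w2 a" "insW w1 b"]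
        algebra_simps)
qed

lemma grL_brL: "grL z (brL x y) = brL (grL z x) y + brL x (grL z y)"
proof (rule trilin_eqI[of "\<lambda>z x y. grL z (brL x y)" "\<lambda>z x y. brL (grL z x) y + brL x (grL z y)"])
  fix r s t :: "'a lw"
  show "grL (basis_vec r) (brL (basis_vec s) (basis_vec t)) =
    brL (grL (basis_vec r) (basis_vec s)) (basis_vec t) + brL (basis_vec s) (grL (basis_vec r) (basis_vec t))"
    by (simp add: brL_basis grL_basis gr_def lin_ext_lin_ext)
qed (auto simp: is_lin_def)

text \<open>The bracket acts by the words \<open>u @ v\<close> minus \<open>v @ u\<close>, and
  \<open>insW_insW\<close> equates this antisymmetrization with that of the associators.\<close>

lemma grL_brL_left:
  "grL (brL x y) z = grL x (grL y z) - grL (grL x y) z - (grL y (grL x z) - grL (grL y x) z)"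
proof (rule trilin_eqI[of "\<lambda>x y z. grL (brL x y) z"])
  fix a b c :: "'a lw"
  \<comment> \<open>By \<open>expand_insW\<close>, the words of the product of \<open>a\<close> and
    \<open>b\<close> arise by inserting words of \<open>a\<close> into words of
    \<open>b\<close>.\<close>
  have l: "grL (grL (basis_vec a) (basis_vec b)) (basis_vec c) =
      lin_ext (\<lambda>u. lin_ext (\<lambda>v. lin_ext (\<lambda>w. insW w c) (insF u v)) (expand b)) (expand a)" for a b
  proof -
    have "grL (grL (basis_vec a) (basis_vec b)) (basis_vec c) =
        lin_ext (\<lambda>u. lin_ext (\<lambda>w. insW w c) (lin_ext expand (insW u b))) (expand a)"
      by (simp add: grL_basis gr_def lin_ext_lin_ext)
    then show ?thesis by (simp add: expand_insW lin_ext_lin_ext)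
  qed
  have r: "grL (basis_vec a) (grL (basis_vec b) (basis_vec c)) =
      lin_ext (\<lambda>u. lin_ext (\<lambda>v. lin_ext (insW u) (insW v c)) (expand b)) (expand a)" for a b
    by (simp add: grL_basis gr_def[abs_def] lin_ext_lin_ext) (simp add: lin_ext_swap[of _ "expand a"])
  have k: "grL (brL (basis_vec a) (basis_vec b)) (basis_vec c) =
      lin_ext (\<lambda>u. lin_ext (\<lambda>v. insW (u @ v) c - insW (v @ u) c) (expand b)) (expand a)"
    by (simp add: grL_basis brL_basis gr_def lin_ext_lin_ext cat_def bilin_ext_def)
      (simp add: lin_ext_swap[of _ "expand a" "expand b"])
  show "grL (brL (basis_vec a) (basis_vec b)) (basis_vec c) =
      grL (basis_vec a) (grL (basis_vec b) (basis_vec c)) -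
      grL (grL (basis_vec a) (basis_vec b)) (basis_vec c) -
      (grL (basis_vec b) (grL (basis_vec a) (basis_vec c)) -
        grL (grL (basis_vec b) (basis_vec a)) (basis_vec c))"
    unfolding l r k
    unfolding lin_ext_swap[of _ "expand a" "expand b"] lin_ext_fun_simps(2)[symmetric]
    by (intro lin_ext_cong refl) (use insW_insW in \<open>auto simp: algebra_simps\<close>)
qed (auto simp: is_lin_def)

section \<open>Evaluation of bracketed trees\<close>

lemma bilinear_lin_ext:
  assumes "\<And>x. is_lin (F x)" "\<And>y. is_lin (\<lambda>x. F x y)"
  shows "F (lin_ext f x) (lin_ext g y) = lin_ext (\<lambda>s. lin_ext (\<lambda>t. F (f s) (g t)) y) x"
proof -
  have "F (lin_ext f x) (lin_ext g y) = lin_ext (\<lambda>s. F (f s) (lin_ext g y)) x"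
    by (rule lin_lin_ext[OF assms(2)])
  then show ?thesis by (simp add: lin_lin_ext[OF assms(1)])
qed

text \<open>\<open>act tr xs y\<close> is the Guin-Oudom extension of the product \<open>tr\<close> to words acting from the left.\<close>

fun act :: "(('q \<Rightarrow>\<^sub>0 'k::field) \<Rightarrow> ('q \<Rightarrow>\<^sub>0 'k) \<Rightarrow> 'q \<Rightarrow>\<^sub>0 'k) \<Rightarrow>
    ('q \<Rightarrow>\<^sub>0 'k) list \<Rightarrow> ('q \<Rightarrow>\<^sub>0 'k) \<Rightarrow> 'q \<Rightarrow>\<^sub>0 'k" where
  "act tr [] y = y"
| "act tr (x # xs) y = tr x (act tr xs y) - (\<Sum>j<length xs. act tr (xs[j := tr x (xs ! j)]) y)"

declare act.simps(2) [simp del]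

primrec ev :: "(('q \<Rightarrow>\<^sub>0 'k::field) \<Rightarrow> ('q \<Rightarrow>\<^sub>0 'k) \<Rightarrow> 'q \<Rightarrow>\<^sub>0 'k) \<Rightarrow>
    ('a \<Rightarrow> 'q \<Rightarrow>\<^sub>0 'k) \<Rightarrow> 'a pl \<Rightarrow> 'q \<Rightarrow>\<^sub>0 'k" where
  "ev tr h (PN a ts) = act tr (map (ev tr h) ts) (h a)"

primrec evW :: "(('q \<Rightarrow>\<^sub>0 'k::field) \<Rightarrow> ('q \<Rightarrow>\<^sub>0 'k) \<Rightarrow> 'q \<Rightarrow>\<^sub>0 'k) \<Rightarrow>
    (('q \<Rightarrow>\<^sub>0 'k) \<Rightarrow> ('q \<Rightarrow>\<^sub>0 'k) \<Rightarrow> 'q \<Rightarrow>\<^sub>0 'k) \<Rightarrow>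
    ('a \<Rightarrow> 'q \<Rightarrow>\<^sub>0 'k) \<Rightarrow> 'a lw \<Rightarrow> 'q \<Rightarrow>\<^sub>0 'k" where
  "evW bk tr h (Leaf t) = ev tr h t"
| "evW bk tr h (Br a b) = bk (evW bk tr h a) (evW bk tr h b)"

lemma ev_cong: "(\<And>a. a \<in> set_pl t \<Longrightarrow> h a = h' a) \<Longrightarrow> ev tr h t = ev tr h' t"
proof (induct t)
  case (PN a ts)
  then have "map (ev tr h) ts = map (ev tr h') ts" by (intro map_cong) auto
  moreover have "h a = h' a" using PN(2) by simp
  ultimately show ?case by (simp only: ev.simps)
qed

lemma evW_cong: "(\<And>a. a \<in> set_lw t \<Longrightarrow> h a = h' a) \<Longrightarrow> evW bk tr h t = evW bk tr h' t"
  by (induct t) (auto intro: ev_cong)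

section \<open>Multilinearity and naturality of the Guin-Oudom action\<close>

locale bilinear_ops =
  fixes bk tr :: "('q \<Rightarrow>\<^sub>0 'k::field) \<Rightarrow> ('q \<Rightarrow>\<^sub>0 'k) \<Rightarrow> 'q \<Rightarrow>\<^sub>0 'k"
  assumes is_lin_ops [simp, intro]:
    "is_lin (bk x)" "is_lin (\<lambda>x. bk x y)" "is_lin (tr x)" "is_lin (\<lambda>x. tr x y)"
begin

lemmas ops_simps [simp] = is_lin_simps[OF is_lin_ops(1)] is_lin_simps[OF is_lin_ops(2)]
  is_lin_simps[OF is_lin_ops(3)] is_lin_simps[OF is_lin_ops(4)]

text \<open>The recursion of \<open>act\<close> calls itself on modified lists of the length of the
  tail, so the induction runs over the length.\<close>

lemma is_lin_act [simp, intro]: "is_lin (act tr xs)"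
proof (induct xs rule: length_induct)
  case (1 xs)
  then show ?case
  proof (cases xs)
    case Nil
    then show ?thesis by (simp add: is_lin_def)
  next
    case (Cons x zs)
    have "is_lin (\<lambda>y. tr x (act tr zs y))"
      using 1 Cons by (intro is_lin_compose[of "tr x" "act tr zs"]) auto
    moreover have "is_lin (\<lambda>y. \<Sum>j<length zs. act tr (zs[j := tr x (zs ! j)]) y)"
      using 1 Cons by (intro is_lin_sum) auto
    ultimately show ?thesis using Cons by (auto simp: act.simps(2)[abs_def])
  qed
qed

text \<open>The correction in which \<open>x\<close> acts on the distinguished slot \<open>k\<close>
  is separated from the others, where the update at \<open>k\<close> can be performed last. This
  makes the dependence on slot \<open>k\<close> visible.\<close>

lemma act_update_Cons:
  assumes "k < length xs"
  shows "act tr (x # xs[k := z]) y = tr x (act tr (xs[k := z]) y) -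
    (act tr (xs[k := tr x z]) y +
      (\<Sum>j\<in>{..<length xs} - {k}. act tr (xs[j := tr x (xs ! j), k := z]) y))"
proof -
  have "(\<Sum>j<length xs. act tr (xs[k := z, j := tr x (xs[k := z] ! j)]) y) =
      act tr (xs[k := tr x z]) y +
      (\<Sum>j\<in>{..<length xs} - {k}. act tr (xs[k := z, j := tr x (xs[k := z] ! j)]) y)"
    using assms by (subst sum.remove[of _ k]) auto
  also have "(\<Sum>j\<in>{..<length xs} - {k}. act tr (xs[k := z, j := tr x (xs[k := z] ! j)]) y) =
      (\<Sum>j\<in>{..<length xs} - {k}. act tr (xs[j := tr x (xs ! j), k := z]) y)"
    by (intro sum.cong refl) (auto simp: list_update_swap)
  finally show ?thesis by (simp add: act.simps)
qed

text \<open>An entry at the head enters once through \<open>tr\<close> directly and otherwise inside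
  single slots of a shorter list; an entry further on is handled by
  \<open>act_update_Cons\<close>.\<close>

lemma is_lin_act_slot: "k < length xs \<Longrightarrow> is_lin (\<lambda>z. act tr (xs[k := z]) y)"
proof (induct xs arbitrary: k rule: length_induct)
  case (1 xs)
  then obtain x zs where xs: "xs = x # zs" by (cases xs) auto
  show ?case
  proof (cases k)
    case 0
    have "is_lin (\<lambda>z. act tr (zs[j := tr z (zs ! j)]) y)" if "j < length zs" for j
      using 1(1) that xs
      by (intro is_lin_compose[of "\<lambda>z. act tr (zs[j := z]) y" "\<lambda>z. tr z (zs ! j)"]) auto
    then have "is_lin (\<lambda>z. \<Sum>j<length zs. act tr (zs[j := tr z (zs ! j)]) y)"
      by (intro is_lin_sum) auto
    then show ?thesis by (auto simp: xs 0 act.simps)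
  next
    case (Suc l)
    then have l: "l < length zs" using 1(2) xs by simp
    have IH: "is_lin (\<lambda>z. act tr (ws[l := z]) y)" if "length ws = length zs" for ws
      using 1(1) that xs l by auto
    have "is_lin (\<lambda>z. tr x (act tr (zs[l := z]) y))"
      by (rule is_lin_compose[of "tr x"]) (auto intro: IH)
    moreover have "is_lin (\<lambda>z. act tr (zs[l := tr x z]) y)"
      by (rule is_lin_compose[of "\<lambda>z. act tr (zs[l := z]) y" "tr x"]) (auto intro: IH)
    moreover have "is_lin (\<lambda>z. \<Sum>j\<in>{..<length zs} - {l}. act tr (zs[j := tr x (zs ! j), l := z]) y)"
      by (intro is_lin_sum IH) auto
    ultimately show ?thesis by (auto simp: xs Suc act_update_Cons[OF l])
  qed
qed

lemma act_lin_ext_slot: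
  "k < length xs \<Longrightarrow> lin_ext (\<lambda>t. act tr (xs[k := f t]) y) z = act tr (xs[k := lin_ext f z]) y"
  using lin_lin_ext[OF is_lin_act_slot] by metis

lemma act_hom:
  assumes "\<And>x y. F (tr x y) = tr' (F x) (F y)" "is_lin F"
  shows "F (act tr xs y) = act tr' (map F xs) (F y)"
proof (induct xs rule: length_induct)
  case (1 xs)
  then show ?case
    by (cases xs) (simp_all add: act.simps is_lin_simps[OF assms(2)] assms(1) map_update)
qed

lemma ev_hom:
  assumes "\<And>x y. F (tr x y) = tr' (F x) (F y)" "is_lin F"
  shows "F (ev tr h t) = ev tr' (\<lambda>a. F (h a)) t"
proof (induct t)
  case (PN a ts)
  then have "map (F \<circ> ev tr h) ts = map (ev tr' (\<lambda>a. F (h a))) ts" by (intro map_cong) auto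
  then have "act tr' (map (F \<circ> ev tr h) ts) (F (h a)) = act tr' (map (ev tr' (\<lambda>a. F (h a))) ts) (F (h a))"
    by (simp only:)
  then show ?case by (simp add: act_hom[of F, OF assms] del: map_eq_conv)
qed

lemma evW_hom:
  assumes "\<And>x y. F (tr x y) = tr' (F x) (F y)" "\<And>x y. F (bk x y) = bk' (F x) (F y)" "is_lin F"
  shows "F (evW bk tr h t) = evW bk' tr' (\<lambda>a. F (h a)) t"
  by (induct t) (simp_all add: ev_hom[of F, OF assms(1,3)] assms(2))

end

text \<open>The measure for the induction in \<open>evW_gr\<close>: insertion puts planar trees into
  planar trees and so preserves the number of brackets of the argument acted on.\<close>

primrec nbrackets :: "'a lw \<Rightarrow> nat" where
  "nbrackets (Leaf t) = 0"
| "nbrackets (Br a b) = Suc (nbrackets a + nbrackets b)"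

lemma nbrackets_insW: "c \<in> supp (insW w b :: _ \<Rightarrow>\<^sub>0 'k::field) \<Longrightarrow> nbrackets c = nbrackets b"
proof (induct b arbitrary: c)
  case (Leaf t)
  then show ?case using keys_lin_ext[of "\<lambda>t. basis_vec (Leaf t)"] by fastforce
next
  case (Br a b)
  then have "c \<in> supp (lmap (\<lambda>a'. Br a' b) (insW w a :: _ \<Rightarrow>\<^sub>0 'k)) \<union>
      supp (lmap (\<lambda>b'. Br a b') (insW w b :: _ \<Rightarrow>\<^sub>0 'k))"
    using Poly_Mapping.keys_add by fastforce
  then show ?case
    using keys_lin_ext[of "\<lambda>t. basis_vec (Br t b)"] keys_lin_ext[of "\<lambda>t. basis_vec (Br a t)"] Br(1,2)
    by fastforce
qed

lemma nbrackets_gr: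
  assumes "c \<in> supp (gr a b :: _ \<Rightarrow>\<^sub>0 'k::field)" shows "nbrackets c = nbrackets b"
proof -
  obtain w where "c \<in> supp (insW w b :: _ \<Rightarrow>\<^sub>0 'k)"
    using assms keys_lin_ext[of "\<lambda>w. insW w b"] unfolding gr_def by blast
  then show ?thesis by (rule nbrackets_insW)
qed

text \<open>An algebra with two bilinear products satisfying, modulo the ideal \<open>K\<close>, the post-Lie axioms
  other than antisymmetry and the Jacobi identity.\<close>

locale algebra_modulo = bilinear_ops bk tr
  for bk tr :: "('q \<Rightarrow>\<^sub>0 'k::field) \<Rightarrow> ('q \<Rightarrow>\<^sub>0 'k) \<Rightarrow> 'q \<Rightarrow>\<^sub>0 'k" +
  fixes K :: "('q \<Rightarrow>\<^sub>0 'k) set"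
  assumes K_zero: "0 \<in> K"
    and K_add: "x \<in> K \<Longrightarrow> y \<in> K \<Longrightarrow> x + y \<in> K"
    and K_scal: "x \<in> K \<Longrightarrow> scal c x \<in> K"
    and K_br: "x \<in> K \<Longrightarrow> bk x y \<in> K" "x \<in> K \<Longrightarrow> bk y x \<in> K"
    and K_tri: "x \<in> K \<Longrightarrow> tr x y \<in> K" "x \<in> K \<Longrightarrow> tr y x \<in> K"
    and tr_bk: "tr z (bk x y) - (bk (tr z x) y + bk x (tr z y)) \<in> K"
    and tr_bk_left: "tr (bk x y) z -
      (tr x (tr y z) - tr (tr x y) z - (tr y (tr x z) - tr (tr y x) z)) \<in> K"
begin

definition cg :: "('q \<Rightarrow>\<^sub>0 'k) \<Rightarrow> ('q \<Rightarrow>\<^sub>0 'k) \<Rightarrow> bool" where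
  "cg x y \<longleftrightarrow> x - y \<in> K"

lemma K_minus: "x \<in> K \<Longrightarrow> - x \<in> K"
  using K_scal[of x "-1"] by simp

lemma K_diff: "x \<in> K \<Longrightarrow> y \<in> K \<Longrightarrow> x - y \<in> K"
  using K_add[of x "- y"] K_minus by simp

lemma K_sum: "(\<And>s. s \<in> S \<Longrightarrow> f s \<in> K) \<Longrightarrow> sum f S \<in> K"
  by (induct S rule: infinite_finite_induct) (auto intro: K_zero K_add)

lemma cg_refl [simp, intro]: "cg x x"
  by (simp add: cg_def K_zero)

lemma cg_sym: "cg x y \<Longrightarrow> cg y x"
  unfolding cg_def using K_minus by fastforce

lemma cg_trans [trans]: "cg x y \<Longrightarrow> cg y z \<Longrightarrow> cg x z"
  unfolding cg_def using K_add by fastforce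

lemma cg_add: "cg x x' \<Longrightarrow> cg y y' \<Longrightarrow> cg (x + y) (x' + y')"
  unfolding cg_def using K_add[of "x - x'" "y - y'"] by (simp add: algebra_simps)

lemma cg_diff: "cg x x' \<Longrightarrow> cg y y' \<Longrightarrow> cg (x - y) (x' - y')"
  unfolding cg_def using K_diff[of "x - x'" "y - y'"] by (simp add: algebra_simps)

lemma cg_scal: "cg x x' \<Longrightarrow> cg (scal c x) (scal c x')"
  unfolding cg_def using K_scal[of "x - x'" c] by simp

lemma cg_sum: "(\<And>s. s \<in> S \<Longrightarrow> cg (f s) (g s)) \<Longrightarrow> cg (sum f S) (sum g S)"
  unfolding cg_def sum_subtractf[symmetric] by (rule K_sum)

lemma cg_lin_ext:
  "(\<And>t. t \<in> supp x \<Longrightarrow> cg (f t) (g t)) \<Longrightarrow> cg (lin_ext f x) (lin_ext g x)"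
  unfolding lin_ext_def by (intro cg_sum cg_scal)

lemma cg_bk: "cg x x' \<Longrightarrow> cg y y' \<Longrightarrow> cg (bk x y) (bk x' y')"
  unfolding cg_def using K_add[OF K_br(1)[of "x - x'" y] K_br(2)[of "y - y'" x']] by simp

lemma cg_tri: "cg x x' \<Longrightarrow> cg y y' \<Longrightarrow> cg (tr x y) (tr x' y')"
  unfolding cg_def using K_add[OF K_tri(1)[of "x - x'" y] K_tri(2)[of "y - y'" x']] by simp

text \<open>When the recursion is unfolded, every occurrence of the entry is an argument of
  \<open>tr\<close>, and \<open>K\<close> absorbs \<open>tr\<close> on both sides. Congruent entries
  may thus be exchanged inside \<open>act\<close>.\<close>

lemma act_slot_K: "k < length xs \<Longrightarrow> z \<in> K \<Longrightarrow> act tr (xs[k := z]) y \<in> K"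
proof (induct xs arbitrary: k z rule: length_induct)
  case (1 xs)
  then obtain x zs where xs: "xs = x # zs" by (cases xs) auto
  show ?case
  proof (cases k)
    case 0
    have "act tr (zs[j := tr z (zs ! j)]) y \<in> K" if "j < length zs" for j
      using 1 that xs K_tri(1) by auto
    then show ?thesis using 1(3) xs 0 K_tri(1) by (auto simp: act.simps intro!: K_diff K_sum)
  next
    case (Suc l)
    then have l: "l < length zs" using 1(2) xs by simp
    have IH: "act tr (ws[l := z']) y \<in> K" if "length ws = length zs" "z' \<in> K" for ws z'
      using 1(1) that xs l by auto
    have "(\<Sum>j\<in>{..<length zs} - {l}. act tr (zs[j := tr x (zs ! j), l := z]) y) \<in> K"
      by (intro K_sum IH) (simp_all add: 1)
    then show ?thesis
      using IH[of zs z] IH[of zs "tr x z"] 1(3) K_tri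
      by (simp add: xs Suc act_update_Cons[OF l] K_add K_diff)
  qed
qed

lemma cg_act_slot: "k < length xs \<Longrightarrow> cg z z' \<Longrightarrow> cg (act tr (xs[k := z]) y) (act tr (xs[k := z']) y)"
  using act_slot_K[of k xs "z - z'" y] is_lin_simps(2)[OF is_lin_act_slot[of k xs y], of z z']
  by (simp add: cg_def)

text \<open>Attaching \<open>t\<close> at the root gives \<open>act\<close> with one more entry at
  the head; attaching it inside the branches gives, by induction, the sum subtracted in the
  recursion of \<open>act\<close>. Together they leave the plain product.\<close>

lemma ev_ins: "cg (lin_ext (ev tr h) (ins [t] s)) (tr (ev tr h t) (ev tr h s))"
proof (induct s)
  case (PN a ts)
  let ?xs = "map (ev tr h) ts" and ?x = "ev tr h t"
  have 1: "lin_ext (ev tr h) (ins [t] (PN a ts)) = act tr (?x # ?xs) (h a) +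
      (\<Sum>j<length ts. act tr (?xs[j := lin_ext (ev tr h) (ins [t] (ts ! j))]) (h a))"
    by (simp add: insF_index lin_ext_lin_ext map_update act_lin_ext_slot)
  have "cg (\<Sum>j<length ts. act tr (?xs[j := lin_ext (ev tr h) (ins [t] (ts ! j))]) (h a))
      (\<Sum>j<length ts. act tr (?xs[j := tr ?x (?xs ! j)]) (h a))"
    by (intro cg_sum cg_act_slot) (auto simp: PN)
  then have "cg (lin_ext (ev tr h) (ins [t] (PN a ts))) (act tr (?x # ?xs) (h a) +
      (\<Sum>j<length ts. act tr (?xs[j := tr ?x (?xs ! j)]) (h a)))"
    unfolding 1 by (intro cg_add cg_refl)
  then show ?case by (simp add: act.simps)
qed

lemma evW_insW: "cg (lin_ext (evW bk tr h) (insW [t] b)) (tr (ev tr h t) (evW bk tr h b))"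
proof (induct b)
  case (Leaf s)
  then show ?case by (simp add: lin_ext_lin_ext ev_ins)
next
  case (Br a b)
  have eq: "lin_ext (evW bk tr h) (insW [t] (Br a b)) =
      bk (lin_ext (evW bk tr h) (insW [t] a)) (evW bk tr h b) +
      bk (evW bk tr h a) (lin_ext (evW bk tr h) (insW [t] b))"
    by (simp add: lin_ext_lin_ext lin_lin_ext[of "\<lambda>x. bk x (evW bk tr h b)"] lin_lin_ext[of "bk (evW bk tr h a)"])
  have "cg (lin_ext (evW bk tr h) (insW [t] (Br a b)))
     (bk (tr (ev tr h t) (evW bk tr h a)) (evW bk tr h b) +
      bk (evW bk tr h a) (tr (ev tr h t) (evW bk tr h b)))"
    unfolding eq by (intro cg_add cg_bk cg_refl Br)
  also have "cg \<dots> (tr (ev tr h t) (bk (evW bk tr h a) (evW bk tr h b)))"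
    by (rule cg_sym) (simp add: cg_def tr_bk)
  finally show ?case by simp
qed

text \<open>Brackets in \<open>a\<close> are removed one by one: both \<open>gr\<close> and \<open>tr\<close> satisfy the axiom that expresses
  the action of a bracket by associators.\<close>

theorem evW_gr: "cg (lin_ext (evW bk tr h) (gr a b)) (tr (evW bk tr h a) (evW bk tr h b))"
proof (induct "nbrackets a" arbitrary: a b rule: less_induct)
  case less
  let ?e = "lin_ext (evW bk tr h)"
  \<comment> \<open>The induction hypothesis, extended to combinations whose acting terms have fewer
    brackets; the argument acted on is arbitrary.\<close>
  have lin: "cg (?e (grL x y)) (tr (?e x) (?e y))"
    if "\<And>c. c \<in> supp x \<Longrightarrow> nbrackets c < nbrackets a" for x y
  proof -
    have "cg (lin_ext (\<lambda>c. lin_ext (\<lambda>d. ?e (gr c d)) y) x)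
        (lin_ext (\<lambda>c. lin_ext (\<lambda>d. tr (evW bk tr h c) (evW bk tr h d)) y) x)"
      by (intro cg_lin_ext less) (rule that)
    then show ?thesis
      by (simp add: grL_def bilin_ext_def lin_ext_lin_ext bilinear_lin_ext[of tr])
  qed
  show ?case
  proof (cases a)
    case (Leaf t)
    then show ?thesis by (simp add: gr_def evW_insW)
  next
    case (Br c d)
    have *: "cg (?e (grL (basis_vec r) (grL (basis_vec s) (basis_vec b)) - grL (grL (basis_vec r) (basis_vec s)) (basis_vec b)))
        (tr (evW bk tr h r) (tr (evW bk tr h s) (evW bk tr h b)) -
         tr (tr (evW bk tr h r) (evW bk tr h s)) (evW bk tr h b))"
      if "nbrackets r < nbrackets a" "nbrackets s < nbrackets a" for r s
    proof -
      have "cg (?e (grL (basis_vec r) (grL (basis_vec s) (basis_vec b))))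
          (tr (evW bk tr h r) (?e (grL (basis_vec s) (basis_vec b))))"
        using lin[of "basis_vec r"] that by simp
      also have "cg \<dots> (tr (evW bk tr h r) (tr (evW bk tr h s) (evW bk tr h b)))"
        using lin[of "basis_vec s" "basis_vec b"] that by (intro cg_tri cg_refl) simp
      finally have 1: "cg (?e (grL (basis_vec r) (grL (basis_vec s) (basis_vec b)))) \<dots>" .
      have "cg (?e (grL (grL (basis_vec r) (basis_vec s)) (basis_vec b)))
          (tr (?e (grL (basis_vec r) (basis_vec s))) (evW bk tr h b))"
        using lin[of "grL (basis_vec r) (basis_vec s)" "basis_vec b"] that(2)
        by (simp add: grL_basis nbrackets_gr)
      also have "cg \<dots> (tr (tr (evW bk tr h r) (evW bk tr h s)) (evW bk tr h b))"
        using lin[of "basis_vec r" "basis_vec s"] that by (intro cg_tri cg_refl) simp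
      finally show ?thesis using 1 by (simp add: cg_diff)
    qed
    have small: "nbrackets c < nbrackets a" "nbrackets d < nbrackets a" by (simp_all add: Br)
    \<comment> \<open>After \<open>grL_brL_left\<close> only \<open>c\<close>, \<open>d\<close> and
      the products of the two act. Each product has as many brackets as its right factor, so all of
      them have fewer than \<open>a\<close>.\<close>
    have "gr a b = grL (brL (basis_vec c) (basis_vec d)) (basis_vec b)"
      by (simp add: Br grL_basis brL_basis)
    note eq = this[unfolded grL_brL_left]
    have "cg (?e (gr a b))
        (tr (evW bk tr h c) (tr (evW bk tr h d) (evW bk tr h b)) -
         tr (tr (evW bk tr h c) (evW bk tr h d)) (evW bk tr h b) -
        (tr (evW bk tr h d) (tr (evW bk tr h c) (evW bk tr h b)) -
         tr (tr (evW bk tr h d) (evW bk tr h c)) (evW bk tr h b)))"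
      using cg_diff[OF *[OF small] *[OF small(2,1)]] by (simp only: eq lin_ext_simps(2))
    also have "cg \<dots> (tr (bk (evW bk tr h c) (evW bk tr h d)) (evW bk tr h b))"
      by (rule cg_sym) (simp only: cg_def tr_bk_left)
    finally show ?thesis by (simp add: Br)
  qed
qed

corollary evW_grL:
  "cg (lin_ext (evW bk tr h) (grL x y)) (tr (lin_ext (evW bk tr h) x) (lin_ext (evW bk tr h) y))"
proof -
  have "cg (lin_ext (\<lambda>c. lin_ext (\<lambda>d. lin_ext (evW bk tr h) (gr c d)) y) x)
      (lin_ext (\<lambda>c. lin_ext (\<lambda>d. tr (evW bk tr h c) (evW bk tr h d)) y) x)"
    by (intro cg_lin_ext evW_gr)
  then show ?thesis
    by (simp add: grL_def bilin_ext_def lin_ext_lin_ext bilinear_lin_ext[of tr])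
qed

lemma evW_brL:
  "lin_ext (evW bk tr h) (brL x y) = bk (lin_ext (evW bk tr h) x) (lin_ext (evW bk tr h) y)"
  by (simp add: brL_def bilin_ext_def lin_ext_lin_ext bilinear_lin_ext[of bk])

end

text \<open>With the zero ideal congruence is equality: both mixed axioms hold on the nose, so
  evaluation in this algebra is an exact homomorphism.\<close>

interpretation A: algebra_modulo brL grL "{0}"
  by unfold_locales (auto simp: grL_brL grL_brL_left)

lemma A_evW_grL:
  "lin_ext (evW brL grL h) (grL x y) = grL (lin_ext (evW brL grL h) x) (lin_ext (evW brL grL h) y)"
  using A.evW_grL[of h x y] by (simp add: A.cg_def)

section \<open>Words acting on bracketed trees\<close>

subsection \<open>Acting on a single vertex\<close>

primrec catl :: "('b list \<Rightarrow>\<^sub>0 'k::field) list \<Rightarrow> 'b list \<Rightarrow>\<^sub>0 'k" where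
  "catl [] = basis_vec []"
| "catl (x # xs) = cat x (catl xs)"

definition der :: "('a pl list \<Rightarrow>\<^sub>0 'k::field) \<Rightarrow> ('a pl list \<Rightarrow>\<^sub>0 'k) \<Rightarrow> 'a pl list \<Rightarrow>\<^sub>0 'k" where
  "der = bilin_ext insF"

lemma is_lin_der [simp, intro]: "is_lin (der x)" "is_lin (\<lambda>x. der x y)"
  by (simp_all add: der_def)

lemmas der_simps [simp] = is_lin_simps[OF is_lin_der(1)] is_lin_simps[OF is_lin_der(2)]

lemma der_cat: "der x (cat y z) = cat (der x y) z + cat y (der x z)"
proof -
  have "der x (cat y z) = lin_ext (\<lambda>w. cat (lin_ext (insF w) y) z + cat y (lin_ext (insF w) z)) x"
    by (simp add: der_def bilin_ext_def insF_cat)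
  then show ?thesis
    by (simp add: der_def bilin_ext_def lin_lin_ext[of "\<lambda>x. cat x z"] lin_lin_ext[of "cat y"])
qed

lemma der_catl: "der x (catl ys) = (\<Sum>j<length ys. catl (ys[j := der x (ys ! j)]))"
proof (induct ys)
  case Nil
  then show ?case by (simp add: der_def bilin_ext_def)
next
  case (Cons y ys)
  then show ?case
    by (simp add: der_cat sum.lessThan_Suc_shift del: sum.lessThan_Suc)
qed

lemma expand_grL: "lin_ext expand (grL x y) = der (lin_ext expand x) (lin_ext expand y)"
  by (simp add: grL_def der_def bilin_ext_def gr_def lin_ext_lin_ext expand_insW)
    (simp add: lin_ext_swap[of _ y])

lemma grL_node:
  "grL x (lmap (\<lambda>w. Leaf (PN a w)) y) =
    lmap (\<lambda>w. Leaf (PN a w)) (cat (lin_ext expand x) y + der (lin_ext expand x) y)"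
  by (simp add: grL_def der_def cat_def bilin_ext_def gr_def lin_ext_lin_ext)
    (simp add: lin_ext_swap[of _ y])

text \<open>Acting on a node either puts a word in front of its branches or inserts it into them.
  The corrections in \<open>act\<close> remove the insertions, so that only concatenation is
  left.\<close>

lemma act_leaf:
  "act grL xs (basis_vec (Leaf (PN a []))) =
    lmap (\<lambda>w. Leaf (PN a w)) (catl (map (lin_ext expand) xs))"
proof (induct xs rule: length_induct)
  case (1 xs)
  then show ?case
    by (cases xs) (simp_all add: act.simps grL_node der_catl map_update expand_grL)
qed

lemma catl_basis: "catl (map (\<lambda>t. basis_vec (f t)) ts) = basis_vec (concat (map f ts))"
  by (induct ts) simp_all

text \<open>By induction every branch evaluates to a single tree, which expands to a one-letter
  word; concatenating these rebuilds the list of branches.\<close>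

lemma ev_relabel:
  "ev grL (\<lambda>a. basis_vec (Leaf (PN (s a) []))) t = (basis_vec (Leaf (map_pl s t)) :: _ \<Rightarrow>\<^sub>0 'c::field)"
proof (induct t)
  case (PN a ts)
  let ?h = "\<lambda>a. basis_vec (Leaf (PN (s a) [])) :: _ \<Rightarrow>\<^sub>0 'c"
  have "map (lin_ext expand) (map (ev grL ?h) ts) = map (\<lambda>t. basis_vec [map_pl s t]) ts"
    using PN by simp
  then show ?case by (simp add: act_leaf catl_basis del: map_map)
qed

lemma evW_relabel:
  "evW brL grL (\<lambda>a. basis_vec (Leaf (PN (s a) []))) t = basis_vec (map_lw s t)"
  by (induct t) (simp_all add: ev_relabel brL_basis)

lemma evW_leaf: "evW brL grL (\<lambda>a. basis_vec (Leaf (PN a []))) t = basis_vec t"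
  using evW_relabel[of "\<lambda>a. a" t] by (simp add: lw.map_ident)

subsection \<open>Operadic trees as bracketed trees\<close>

primrec toA :: "(post_lie_gen, 'a) op_tree \<Rightarrow> 'a lw \<Rightarrow>\<^sub>0 'k::field" where
  "toA (Input j) = basis_vec (Leaf (PN j []))"
| "toA (App g s t) = (case g of Bracket \<Rightarrow> brL | Triangle \<Rightarrow> grL) (toA s) (toA t)"

text \<open>Substitution into a formal product is evaluation of that product, and evaluation in the
  algebra of bracketed trees is a homomorphism. This is the bridge from composition in the free
  operad to \<open>evW\<close>.\<close>

lemma toA_subst: "toA (op_subst h u) = lin_ext (evW brL grL (\<lambda>j. toA (h j))) (toA u)"
  by (induct u) (simp_all add: A.evW_brL A_evW_grL split: post_lie_gen.split)

lemma op_subst_Input: "op_subst (\<lambda>j. Input (s j)) u = map_op_tree id s u"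
  by (induct u) simp_all

lemma toA_map: "toA (map_op_tree id s u) = (lmap (map_lw s) (toA u) :: _ \<Rightarrow>\<^sub>0 'k::field)"
proof -
  have "evW brL grL (\<lambda>j. basis_vec (Leaf (PN (s j) []))) = (\<lambda>t. basis_vec (map_lw s t) :: _ \<Rightarrow>\<^sub>0 'k)"
    by (rule ext) (rule evW_relabel)
  then show ?thesis by (simp add: op_subst_Input[symmetric] toA_subst)
qed

subsection \<open>Grafting words onto a bracketed tree\<close>

primrec labP :: "'a pl \<Rightarrow> 'a list" where
  "labP (PN a ts) = a # concat (map labP ts)"

primrec labW :: "'a lw \<Rightarrow> 'a list" where
  "labW (Leaf t) = labP t"
| "labW (Br s t) = labW s @ labW t"

lemma set_labP [simp]: "set (labP t) = set_pl t"
  by (induct t) auto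

lemma set_labW [simp]: "set (labW t) = set_lw t"
  by (induct t) auto

lemma finite_set_lw [simp, intro]: "finite (set_lw t)"
  by (metis List.finite_set set_labW)

primrec graftP :: "('a \<Rightarrow> 'a pl list) \<Rightarrow> 'a pl \<Rightarrow> 'a pl" where
  "graftP g (PN a ts) = PN a (g a @ map (graftP g) ts)"

primrec graftW :: "('a \<Rightarrow> 'a pl list) \<Rightarrow> 'a lw \<Rightarrow> 'a lw" where
  "graftW g (Leaf t) = Leaf (graftP g t)"
| "graftW g (Br s t) = Br (graftW g s) (graftW g t)"

lemma graftP_cong: "(\<And>a. a \<in> set_pl t \<Longrightarrow> g a = g' a) \<Longrightarrow> graftP g t = graftP g' t"
  by (induct t) auto

lemma graftW_cong: "(\<And>a. a \<in> set_lw t \<Longrightarrow> g a = g' a) \<Longrightarrow> graftW g t = graftW g' t"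
  by (induct t) (auto intro: graftP_cong)

lemma graftP_upd [simp]: "w \<notin> set_pl t \<Longrightarrow> graftP (g(w := v)) t = graftP g t"
  by (auto intro: graftP_cong)

lemma graftW_upd [simp]: "w \<notin> set_lw t \<Longrightarrow> graftW (g(w := v)) t = graftW g t"
  by (auto intro: graftW_cong)

lemma distinct_concat_map_nth:
  assumes "distinct (concat (map f ts))" "k < length ts" "l < length ts" "k \<noteq> l"
  shows "set (f (ts ! k)) \<inter> set (f (ts ! l)) = {}"
  using assms
proof (induct ts arbitrary: k l)
  case (Cons t ts)
  have disj: "set (f t) \<inter> set (f u) = {}" if "u \<in> set ts" for u
    using Cons(2) that by fastforce
  show ?case
  proof (cases k)
    case 0
    then show ?thesis using Cons(4,5) disj[of "ts ! (l - 1)"] by (cases l) auto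
  next
    case (Suc k')
    then show ?thesis using Cons disj[of "ts ! k'"] by (cases l) auto
  qed
qed simp

lemma distinct_concat_map_nthD:
  "distinct (concat (map f ts)) \<Longrightarrow> k < length ts \<Longrightarrow> distinct (f (ts ! k))"
  by (induct ts arbitrary: k) (auto simp: nth_Cons split: nat.split)

lemma sum_set_pl_list:
  assumes "distinct (concat (map labP ts))"
  shows "(\<Sum>w\<in>(\<Union>t\<in>set ts. set_pl t). f w) = (\<Sum>j<length ts. \<Sum>w\<in>set_pl (ts ! j). f w)"
  using assms
proof (induct ts)
  case (Cons t ts)
  have "(\<Sum>w\<in>(\<Union>t\<in>set (t # ts). set_pl t). f w) =
      (\<Sum>w\<in>set_pl t. f w) + (\<Sum>w\<in>(\<Union>t\<in>set ts. set_pl t). f w)"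
    using Cons(2) by (simp add: sum.union_disjoint)
  then show ?case using Cons
    by (simp add: sum.lessThan_Suc_shift del: sum.lessThan_Suc)
qed simp

text \<open>A vertex of the grafted tree is either a vertex \<open>w\<close> of \<open>t\<close>,
  where \<open>s\<close> becomes the first grafted tree, or lies in a tree grafted onto some
  \<open>w\<close>. As labels are distinct, either change amounts to an update of \<open>g\<close>
  at \<open>w\<close> alone.\<close>

lemma ins_graftP:
  assumes "distinct (labP t)"
  shows "ins [s] (graftP g t) = (\<Sum>w\<in>set_pl t.
    lmap (\<lambda>v. graftP (g(w := v)) t) (basis_vec (s # g w) + insF [s] (g w)) :: _ \<Rightarrow>\<^sub>0 'k::field)"
  using assms
proof (induct t)
  case (PN a ts)
  let ?D = "\<lambda>w. basis_vec (s # g w) + insF [s] (g w) :: _ \<Rightarrow>\<^sub>0 'k"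
  let ?M = "map (graftP g) ts"
  have a: "a \<notin> (\<Union>t\<in>set ts. set_pl t)" and d: "distinct (concat (map labP ts))"
    using PN(2) by auto
  have ins: "ins [s] (graftP g (PN a ts)) = lmap (\<lambda>v. PN a (v @ ?M)) (?D a) +
      (\<Sum>j<length ts. lmap (\<lambda>t'. PN a (g a @ ?M[j := t'])) (ins [s] (graftP g (ts ! j))))"
    by (simp add: insF_append insF_index[of "[s]" ?M] lin_ext_lin_ext)
  have "lmap (\<lambda>t'. PN a (g a @ ?M[j := t'])) (ins [s] (graftP g (ts ! j))) =
      (\<Sum>w\<in>set_pl (ts ! j). lmap (\<lambda>v. graftP (g(w := v)) (PN a ts)) (?D w))"
    if j: "j < length ts" for j
  proof -
    have "lmap (\<lambda>t'. PN a (g a @ ?M[j := t'])) (ins [s] (graftP g (ts ! j))) =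
        (\<Sum>w\<in>set_pl (ts ! j). lmap (\<lambda>v. PN a (g a @ ?M[j := graftP (g(w := v)) (ts ! j)])) (?D w))"
      using PN(1)[of "ts ! j"] j distinct_concat_map_nthD[OF d j]
      by (simp add: lin_ext_lin_ext del: fun_upd_apply)
    also have "\<dots> = (\<Sum>w\<in>set_pl (ts ! j). lmap (\<lambda>v. graftP (g(w := v)) (PN a ts)) (?D w))"
    proof (rule sum.cong[OF refl])
      fix w assume w: "w \<in> set_pl (ts ! j)"
      have "?M[j := graftP (g(w := v)) (ts ! j)] = map (graftP (g(w := v))) ts" for v
      proof (rule nth_equalityI)
        fix l assume "l < length (?M[j := graftP (g(w := v)) (ts ! j)])"
        then show "?M[j := graftP (g(w := v)) (ts ! j)] ! l = map (graftP (g(w := v))) ts ! l"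
          using w distinct_concat_map_nth[OF d j, of l]
            by (cases "l = j") (auto simp: disjoint_iff simp del: fun_upd_apply)
      qed simp
      moreover have "w \<noteq> a" using w a j nth_mem by blast
      ultimately show "lmap (\<lambda>v. PN a (g a @ ?M[j := graftP (g(w := v)) (ts ! j)])) (?D w) =
          lmap (\<lambda>v. graftP (g(w := v)) (PN a ts)) (?D w)" by simp
    qed
    finally show ?thesis .
  qed
  then have *: "(\<Sum>j<length ts. lmap (\<lambda>t'. PN a (g a @ ?M[j := t'])) (ins [s] (graftP g (ts ! j)))) =
      (\<Sum>w\<in>(\<Union>t\<in>set ts. set_pl t). lmap (\<lambda>v. graftP (g(w := v)) (PN a ts)) (?D w))"
    by (simp add: sum_set_pl_list[OF d])
  have "map (graftP (g(a := v))) ts = ?M" for v using a by simp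
  then have "lmap (\<lambda>v. PN a (v @ ?M)) (?D a) = lmap (\<lambda>v. graftP (g(a := v)) (PN a ts)) (?D a)"
    by (simp only: graftP.simps fun_upd_same)
  then show ?case using a unfolding ins * by (subst pl.set) simp
qed

lemma insW_graftW:
  assumes "distinct (labW t)"
  shows "insW [s] (graftW g t) = (\<Sum>w\<in>set_lw t.
    lmap (\<lambda>v. graftW (g(w := v)) t) (basis_vec (s # g w) + insF [s] (g w)) :: _ \<Rightarrow>\<^sub>0 'k::field)"
  using assms
proof (induct t)
  case (Leaf t)
  then have "lmap Leaf (ins [s] (graftP g t)) = (\<Sum>w\<in>set_pl t.
      lmap (\<lambda>v. Leaf (graftP (g(w := v)) t)) (basis_vec (s # g w) + insF [s] (g w)) :: _ \<Rightarrow>\<^sub>0 'k)"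
    by (simp add: ins_graftP lin_ext_lin_ext)
  then show ?case by (simp del: fun_upd_apply)
next
  case (Br a b)
  let ?D = "\<lambda>w. basis_vec (s # g w) + insF [s] (g w) :: _ \<Rightarrow>\<^sub>0 'k"
  have disj: "set_lw a \<inter> set_lw b = {}" using Br(3) by simp
  have "lmap (\<lambda>a'. Br a' (graftW g b)) (insW [s] (graftW g a)) =
      (\<Sum>w\<in>set_lw a. lmap (\<lambda>v. Br (graftW (g(w := v)) a) (graftW g b)) (?D w))"
    using Br by (simp add: lin_ext_lin_ext del: fun_upd_apply)
  also have "\<dots> = (\<Sum>w\<in>set_lw a. lmap (\<lambda>v. graftW (g(w := v)) (Br a b)) (?D w))"
    using disj by (intro sum.cong refl) (simp add: disjoint_iff)
  finally have 1: "lmap (\<lambda>a'. Br a' (graftW g b)) (insW [s] (graftW g a)) = \<dots>" .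
  have "lmap (\<lambda>b'. Br (graftW g a) b') (insW [s] (graftW g b)) =
      (\<Sum>w\<in>set_lw b. lmap (\<lambda>v. Br (graftW g a) (graftW (g(w := v)) b)) (?D w))"
    using Br by (simp add: lin_ext_lin_ext del: fun_upd_apply)
  also have "\<dots> = (\<Sum>w\<in>set_lw b. lmap (\<lambda>v. graftW (g(w := v)) (Br a b)) (?D w))"
  proof (intro sum.cong refl)
    fix w assume "w \<in> set_lw b"
    then have "w \<notin> set_lw a" using disj by auto
    then show "lmap (\<lambda>v. Br (graftW g a) (graftW (g(w := v)) b)) (?D w) =
        lmap (\<lambda>v. graftW (g(w := v)) (Br a b)) (?D w)"
      by (simp del: fun_upd_apply)
  qed
  finally have 2: "lmap (\<lambda>b'. Br (graftW g a) b') (insW [s] (graftW g b)) = \<dots>" .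
  show ?case using disj unfolding graftW.simps(2) insW.simps 1 2 by (simp add: sum.union_disjoint)
qed

section \<open>Distributing a list of trees over vertices\<close>

definition sel :: "'b list \<Rightarrow> (nat \<Rightarrow> 'c) \<Rightarrow> 'c \<Rightarrow> 'b list" where
  "sel ss \<phi> w = [ss ! k. k \<leftarrow> [0..<length ss], \<phi> k = w]"

text \<open>The comprehension in \<open>sel\<close> is the one occurring in \<open>pt_comp\<close>;
  as a filter on positions it is easier to split along the list.\<close>

lemma sel_alt: "sel ss \<phi> w = map ((!) ss) (filter (\<lambda>k. \<phi> k = w) [0..<length ss])"
proof -
  have "concat (map (\<lambda>k. if \<phi> k = w then [ss ! k] else []) xs) = map ((!) ss) (filter (\<lambda>k. \<phi> k = w) xs)" for xs
    by (induct xs) auto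
  then show ?thesis by (simp add: sel_def)
qed

lemma sel_Nil [simp]: "sel [] \<phi> w = []"
  by (simp add: sel_def)

lemma sel_snoc: "sel (ss @ [s]) \<phi> w = sel ss \<phi> w @ (if \<phi> (length ss) = w then [s] else [])"
proof -
  have "map ((!) (ss @ [s])) (filter (\<lambda>k. \<phi> k = w) [0..<length ss]) =
      map ((!) ss) (filter (\<lambda>k. \<phi> k = w) [0..<length ss])"
    by (intro map_cong) (auto simp: nth_append)
  then show ?thesis by (simp add: sel_alt)
qed

lemma sel_Cons: "sel (s # ss) \<phi> w = (if \<phi> 0 = w then [s] else []) @ sel ss (\<lambda>k. \<phi> (Suc k)) w"
proof -
  have "[0..<length (s # ss)] = 0 # map Suc [0..<length ss]"
    by (simp add: upt_conv_Cons map_Suc_upt del: upt_Suc)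
  then show ?thesis by (simp add: sel_alt filter_map o_def del: upt_Suc)
qed

lemma sel_map: "sel (map f ss) \<phi> w = map f (sel ss \<phi> w)"
  by (simp add: sel_alt)

lemma sel_update_other: "\<phi> j \<noteq> w \<Longrightarrow> sel (ss[j := t]) \<phi> w = sel ss \<phi> w"
  unfolding sel_alt length_list_update by (intro map_cong refl) (auto, metis nth_list_update_neq)

text \<open>Induction from the right fits because the last tree is appended to its selection, and
  updates at earlier positions leave that end alone.\<close>

lemma insF_sel:
  "insF x (sel ss \<phi> w) =
    (\<Sum>j | j < length ss \<and> \<phi> j = w. lmap (\<lambda>t. sel (ss[j := t]) \<phi> w) (ins x (ss ! j)) :: _ \<Rightarrow>\<^sub>0 'k::field)"
proof (induct ss rule: rev_induct)
  case (snoc s ss)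
  let ?e = "if \<phi> (length ss) = w then [s] else []"
  have upd: "sel ((ss @ [s])[j := t]) \<phi> w = sel (ss[j := t]) \<phi> w @ ?e" if "j < length ss" for j t
    using that by (simp add: list_update_append1 sel_snoc[of "ss[j := t]"])
  have 1: "lmap (\<lambda>u. u @ ?e) (insF x (sel ss \<phi> w)) =
     (\<Sum>j | j < length ss \<and> \<phi> j = w. lmap (\<lambda>t. sel ((ss @ [s])[j := t]) \<phi> w) (ins x ((ss @ [s]) ! j)) :: _ \<Rightarrow>\<^sub>0 'k)"
    unfolding snoc lin_ext_simps lin_ext_lin_ext lin_ext_basis
    by (intro sum.cong refl) (simp add: upd nth_append del: list_update_append)
  have 2: "{j. j < length (ss @ [s]) \<and> \<phi> j = w} =
      (if \<phi> (length ss) = w then insert (length ss) else id) {j. j < length ss \<and> \<phi> j = w}"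
    by (auto simp: less_Suc_eq)
  have 3: "lmap (\<lambda>t. sel ((ss @ [s])[length ss := t]) \<phi> w) (ins x ((ss @ [s]) ! length ss)) =
      (lmap (\<lambda>t. sel ss \<phi> w @ t) (insF x ?e) :: _ \<Rightarrow>\<^sub>0 'k)" if "\<phi> (length ss) = w"
    using that by (simp add: sel_snoc lin_ext_lin_ext)
  have "insF x (sel (ss @ [s]) \<phi> w) =
      lmap (\<lambda>u. u @ ?e) (insF x (sel ss \<phi> w)) + (lmap (\<lambda>t. sel ss \<phi> w @ t) (insF x ?e) :: _ \<Rightarrow>\<^sub>0 'k)"
    by (simp only: sel_snoc insF_append)
  also have "\<dots> = (\<Sum>j | j < length (ss @ [s]) \<and> \<phi> j = w.
      lmap (\<lambda>t. sel ((ss @ [s])[j := t]) \<phi> w) (ins x ((ss @ [s]) ! j)) :: _ \<Rightarrow>\<^sub>0 'k)"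
    unfolding 1 2 using 3 by (cases "\<phi> (length ss) = w") (simp_all add: add.commute)
  finally show ?case .
qed simp

text \<open>A function on \<open>{..<Suc k}\<close> is a value at 0 and a shifted function. The
  split is at 0 because \<open>act\<close> adds its new entry at the head; \<open>case_nat\<close>
  preserves the value \<open>undefined\<close> outside the domain.\<close>

lemma sum_PiE_Suc:
  fixes S :: "'c set"
  shows
  "(\<Sum>\<psi>\<in>{..<Suc k} \<rightarrow>\<^sub>E S. F \<psi>) =
    (\<Sum>\<phi>\<in>{..<k} \<rightarrow>\<^sub>E S. \<Sum>w\<in>S. F (case_nat w \<phi>))"
proof -
  let ?c = "\<lambda>\<phi> w. case_nat w \<phi>"
  have c: "?c \<phi> w \<in> {..<Suc k} \<rightarrow>\<^sub>E S" if "\<phi> \<in> {..<k} \<rightarrow>\<^sub>E S" "w \<in> S" for \<phi> w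
  proof (rule PiE_I)
    fix i assume "i \<in> {..<Suc k}"
    then show "?c \<phi> w i \<in> S" using that by (cases i) auto
  next
    fix i assume "i \<notin> {..<Suc k}"
    then show "?c \<phi> w i = undefined" using that(1) by (cases i) (auto elim: PiE_arb)
  qed
  have d: "(\<lambda>j. \<psi> (Suc j)) \<in> {..<k} \<rightarrow>\<^sub>E S" "\<psi> 0 \<in> S" if "\<psi> \<in> {..<Suc k} \<rightarrow>\<^sub>E S" for \<psi>
    using that by (auto intro!: PiE_I elim: PiE_arb)
  have e: "?c (\<lambda>j. \<psi> (Suc j)) (\<psi> 0) = \<psi>" for \<psi> :: "nat \<Rightarrow> 'c"
    by (rule ext) (simp split: nat.split)
  have "(\<Sum>\<psi>\<in>{..<Suc k} \<rightarrow>\<^sub>E S. F \<psi>) =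
     (\<Sum>p\<in>({..<k} \<rightarrow>\<^sub>E S) \<times> S. F (?c (fst p) (snd p)))"
    by (rule sum.reindex_bij_witness[of _ "\<lambda>p. ?c (fst p) (snd p)" "\<lambda>\<psi>. (\<lambda>j. \<psi> (Suc j), \<psi> 0)"])
      (simp_all add: c d e mem_Times_iff)
  then show ?thesis by (simp add: sum.cartesian_product case_prod_unfold)
qed

text \<open>Iterating the product would also graft a tree onto those grafted before it. The
  corrections of \<open>act\<close> cancel these terms, and what is left distributes the trees
  independently over the vertices of \<open>b\<close>, as in the composition of partially labeled
  trees.\<close>

lemma act_graftW:
  assumes "distinct (labW b)"
  shows "act grL (map (\<lambda>s. basis_vec (Leaf s)) ss) (basis_vec b) =
    (\<Sum>\<phi>\<in>{..<length ss} \<rightarrow>\<^sub>E set_lw b. basis_vec (graftW (sel ss \<phi>) b) :: _ \<Rightarrow>\<^sub>0 'k::field)"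
proof (induct ss rule: length_induct)
  case (1 ss)
  show ?case
  proof (cases ss)
    case Nil
    have "graftP (\<lambda>w. []) t = t" for t :: "'a pl" by (induct t) (simp add: map_idI)
    then have "graftW (\<lambda>w. []) b = b" by (induct b) simp_all
    then show ?thesis by (simp add: Nil)
  next
    case (Cons s zs)
    let ?S = "set_lw b" and ?P = "{..<length zs} \<rightarrow>\<^sub>E set_lw b"
    let ?xs = "map (\<lambda>s. basis_vec (Leaf s) :: _ \<Rightarrow>\<^sub>0 'k) zs"
    have slot: "act grL (?xs[j := grL (basis_vec (Leaf s)) (?xs ! j)]) (basis_vec b) =
        (\<Sum>\<phi>\<in>?P. lmap (\<lambda>t. graftW (sel (zs[j := t]) \<phi>) b) (ins [s] (zs ! j)))"
      if j: "j < length zs" for j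
    proof -
      have "grL (basis_vec (Leaf s)) (?xs ! j) = lmap Leaf (ins [s] (zs ! j))"
        using j by (simp add: grL_basis gr_def)
      then have "act grL (?xs[j := grL (basis_vec (Leaf s)) (?xs ! j)]) (basis_vec b) =
          lin_ext (\<lambda>t. act grL (map (\<lambda>s. basis_vec (Leaf s)) (zs[j := t])) (basis_vec b)) (ins [s] (zs ! j))"
        using j A.act_lin_ext_slot[of j ?xs "\<lambda>t. basis_vec (Leaf t)"] by (simp add: map_update)
      also have "\<dots> = lin_ext (\<lambda>t. \<Sum>\<phi>\<in>?P. basis_vec (graftW (sel (zs[j := t]) \<phi>) b)) (ins [s] (zs ! j))"
      proof -
        have "act grL (map (\<lambda>s. basis_vec (Leaf s)) (zs[j := t])) (basis_vec b) =
            (\<Sum>\<phi>\<in>?P. basis_vec (graftW (sel (zs[j := t]) \<phi>) b) :: _ \<Rightarrow>\<^sub>0 'k)" for t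
          using 1[rule_format, of "zs[j := t]"] Cons by simp
        then show ?thesis by simp
      qed
      finally show ?thesis by (simp add: lin_ext_fun_sum)
    qed
    \<comment> \<open>The tree \<open>s\<close> lands on a vertex \<open>w\<close> of
      \<open>b\<close>, extending the map by the value \<open>w\<close> at 0, or on a vertex of some
      \<open>zs ! j\<close>; the latter terms are those in \<open>slot\<close>.\<close>
    have head: "grL (basis_vec (Leaf s)) (basis_vec (graftW (sel zs \<phi>) b)) =
        (\<Sum>w\<in>?S. basis_vec (graftW (sel (s # zs) (case_nat w \<phi>)) b)) +
        (\<Sum>j<length zs. lmap (\<lambda>t. graftW (sel (zs[j := t]) \<phi>) b) (ins [s] (zs ! j)) :: _ \<Rightarrow>\<^sub>0 'k)"
      if \<phi>: "\<phi> \<in> ?P" for \<phi>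
    proof -
      have 1: "(sel zs \<phi>)(w := s # sel zs \<phi> w) = sel (s # zs) (case_nat w \<phi>)" for w
        by (auto simp: sel_Cons fun_eq_iff)
      have "lmap (\<lambda>v. graftW ((sel zs \<phi>)(w := v)) b) (insF [s] (sel zs \<phi> w)) =
          (\<Sum>j | j \<in> {..<length zs} \<and> \<phi> j = w. lmap (\<lambda>t. graftW (sel (zs[j := t]) \<phi>) b) (ins [s] (zs ! j)) :: _ \<Rightarrow>\<^sub>0 'k)" for w
      proof -
        have "(sel zs \<phi>)(w := sel (zs[j := t]) \<phi> w) = sel (zs[j := t]) \<phi>" if "\<phi> j = w" for j t
          using that by (auto simp: fun_eq_iff sel_update_other)
        then show ?thesis by (auto simp: insF_sel lin_ext_lin_ext intro!: sum.cong)
      qed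
      then have "(\<Sum>w\<in>?S. lmap (\<lambda>v. graftW ((sel zs \<phi>)(w := v)) b) (insF [s] (sel zs \<phi> w))) =
          (\<Sum>w\<in>?S. \<Sum>j | j \<in> {..<length zs} \<and> \<phi> j = w.
            lmap (\<lambda>t. graftW (sel (zs[j := t]) \<phi>) b) (ins [s] (zs ! j)) :: _ \<Rightarrow>\<^sub>0 'k)"
        by simp
      \<comment> \<open>Each position is assigned to exactly one vertex, so the sums over vertices
        and over their fibres combine.\<close>
      also have "\<dots> = (\<Sum>j<length zs. lmap (\<lambda>t. graftW (sel (zs[j := t]) \<phi>) b) (ins [s] (zs ! j)))"
        using \<phi> by (intro sum.group) auto
      finally show ?thesis
        by (simp add: grL_basis gr_def 1 sum.distrib insW_graftW[OF assms] del: fun_upd_apply)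
    qed
    have "act grL ?xs (basis_vec b) = (\<Sum>\<phi>\<in>?P. basis_vec (graftW (sel zs \<phi>) b))"
      using 1 Cons by simp
    then have "act grL (map (\<lambda>s. basis_vec (Leaf s)) ss) (basis_vec b) =
        (\<Sum>\<phi>\<in>?P. grL (basis_vec (Leaf s)) (basis_vec (graftW (sel zs \<phi>) b))) -
        (\<Sum>j<length zs. \<Sum>\<phi>\<in>?P. lmap (\<lambda>t. graftW (sel (zs[j := t]) \<phi>) b) (ins [s] (zs ! j)) :: _ \<Rightarrow>\<^sub>0 'k)"
      using slot by (simp add: Cons act.simps)
    also have "\<dots> = (\<Sum>\<phi>\<in>?P. \<Sum>w\<in>?S.
        basis_vec (graftW (sel (s # zs) (case_nat w \<phi>)) b))"
      using head by (simp add: sum.distrib sum.swap[of _ "{..<length zs}" ?P])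
    finally show ?thesis by (simp add: Cons sum_PiE_Suc del: lessThan_Suc)
  qed
qed

section \<open>The composition of \<open>LW\<close>\<close>

subsection \<open>Bracketed trees as partially labeled trees\<close>

primrec eP :: "'a pl \<Rightarrow> 'a ptree" where
  "eP (PN a ts) = Node (Some a) (map eP ts)"

primrec eW :: "'a lw \<Rightarrow> 'a ptree" where
  "eW (Leaf t) = eP t"
| "eW (Br s t) = Node None [eW s, eW t]"

lemma eP_inject: "eP s = eP t \<longleftrightarrow> s = t"
proof (induct s arbitrary: t)
  case (PN a ts)
  obtain b us where t: "t = PN b us" by (cases t)
  have "map eP ts = map eP us \<longleftrightarrow> ts = us"
    using PN by (auto simp: list_eq_iff_nth_eq)
  then show ?case by (simp add: t)
qed

lemma root_label_eP [simp]: "root_label (eP t) \<noteq> None"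
  by (cases t) simp

lemma eW_inject: "eW s = eW t \<longleftrightarrow> s = t"
proof (induct s arbitrary: t)
  case (Leaf s)
  have "eP s \<noteq> Node None xs" for xs using root_label_eP[of s] by (metis ptree.sel(1))
  then show ?case by (cases t) (auto simp: eP_inject)
next
  case (Br a b)
  have "Node None xs \<noteq> eP t" for xs t using root_label_eP[of t] by (metis ptree.sel(1))
  then show ?case using Br by (cases t) auto
qed

lemma map_ptree_eP [simp]: "map_ptree f (eP t) = eP (map_pl f t)"
  by (induct t) simp

lemma map_ptree_eW [simp]: "map_ptree f (eW t) = eW (map_lw f t)"
  by (induct t) simp_all

lemma set_ptree_eP [simp]: "set_ptree (eP t) = set_pl t"
  by (induct t) auto

lemma set_ptree_eW [simp]: "set_ptree (eW t) = set_lw t"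
  by (induct t) auto

lemma graft_eP: "graft (\<lambda>w. map eP (g w)) (eP t) = eP (graftP g t)"
  by (induct t) simp

lemma graft_eW: "graft (\<lambda>w. map eP (g w)) (eW t) = eW (graftW g t)"
  by (induct t) (simp_all add: graft_eP)

subsection \<open>Vertices and labels\<close>

declare verts.simps [simp del]

lemma verts_Node: "p \<in> verts (Node a ts) \<longleftrightarrow> p = [] \<or> (\<exists>k q. p = k # q \<and> k < length ts \<and> q \<in> verts (ts ! k))"
  by (auto simp: verts.simps)

lemma Nil_in_verts [simp]: "[] \<in> verts t"
  by (cases t) (simp add: verts_Node)

lemma label_at_simps [simp]:
  "label_at (Node a ts) [] = a" "label_at (Node a ts) (k # p) = label_at (ts ! k) p"
  by (simp_all add: label_at_def)

text \<open>An enumeration of the vertices parallel to that of the labels in \<open>labs\<close>; it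
  turns the bijection required by \<open>PT\<close> into distinctness of a list of labels.\<close>

fun vlist :: "'a ptree \<Rightarrow> nat list list" and vlists :: "nat \<Rightarrow> 'a ptree list \<Rightarrow> nat list list" where
  "vlist (Node a ts) = [] # vlists 0 ts"
| "vlists k [] = []"
| "vlists k (t # ts) = map ((#) k) (vlist t) @ vlists (Suc k) ts"

primrec labs :: "'a ptree \<Rightarrow> 'a option list" where
  "labs (Node a ts) = a # concat (map labs ts)"

lemma
  fixes t :: "'a ptree" and ts :: "'a ptree list"
  shows set_vlist: "set (vlist t) = verts t"
    and set_vlists: "set (vlists k ts) = {(k + j) # p | j p. j < length ts \<and> p \<in> verts (ts ! j)}"
proof (induct t and k ts rule: vlist_vlists.induct)
  case (1 a ts)
  then show ?case by (auto simp: verts_Node)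
next
  case (3 k t ts)
  have "p \<in> set (vlists k (t # ts)) \<longleftrightarrow>
      p \<in> {(k + j) # p | j p. j < length (t # ts) \<and> p \<in> verts ((t # ts) ! j)}" for p
  proof
    assume "p \<in> set (vlists k (t # ts))"
    then consider q where "p = k # q" "q \<in> verts t"
      | j q where "p = (Suc k + j) # q" "j < length ts" "q \<in> verts (ts ! j)"
      using 3 by auto
    then show "p \<in> {(k + j) # p | j p. j < length (t # ts) \<and> p \<in> verts ((t # ts) ! j)}"
    proof cases
      case 1
      then show ?thesis by (intro CollectI exI[of _ 0] exI[of _ q]) simp
    next
      case (2 j)
      then show ?thesis by (intro CollectI exI[of _ "Suc j"] exI[of _ q]) simp
    qed
  next
    assume "p \<in> {(k + j) # p | j p. j < length (t # ts) \<and> p \<in> verts ((t # ts) ! j)}"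
    then obtain j q where p: "p = (k + j) # q" "j < length (t # ts)" "q \<in> verts ((t # ts) ! j)" by blast
    show "p \<in> set (vlists k (t # ts))"
    proof (cases j)
      case 0
      then show ?thesis using p 3 by auto
    next
      case (Suc l)
      then have "p \<in> {(Suc k + j) # p | j p. j < length ts \<and> p \<in> verts (ts ! j)}"
        using p by (intro CollectI exI[of _ l] exI[of _ q]) simp
      then show ?thesis using 3 by simp
    qed
  qed
  then show ?case by blast
qed simp

lemma
  fixes t :: "'a ptree" and ts :: "'a ptree list"
  shows distinct_vlist: "distinct (vlist t)" and distinct_vlists: "distinct (vlists k ts)"
  by (induct t and k ts rule: vlist_vlists.induct)
    (auto simp: set_vlists distinct_map)

text \<open>Addresses in \<open>vlists k ts\<close> start counting at \<open>k\<close>; the prefix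
  \<open>us\<close> of length \<open>k\<close> supplies the branches before
  \<open>ts\<close>.\<close>

lemma
  fixes t :: "'a ptree" and ts :: "'a ptree list"
  shows map_label_vlist: "map (label_at t) (vlist t) = labs t"
    and map_label_vlists: "k = length us \<Longrightarrow> map (label_at (Node a (us @ ts))) (vlists k ts) = concat (map labs ts)"
proof (induct t and k ts arbitrary: and us a rule: vlist_vlists.induct)
  case (1 b ts)
  then show ?case using 1[of "[]" b] by simp
next
  case (3 k t ts)
  then show ?case using 3(2)[of "us @ [t]" a] by (simp add: nth_append o_def)
qed simp

definition plabels :: "'a ptree \<Rightarrow> 'a list" where
  "plabels t = map the (filter (\<lambda>a. a \<noteq> None) (labs t))"

lemma bij_betw_labels:
  "bij_betw (\<lambda>p. the (label_at t p)) (verts t - unlabeled t) S \<longleftrightarrow> distinct (plabels t) \<and> set (plabels t) = S"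
proof -
  let ?xs = "filter (\<lambda>p. label_at t p \<noteq> None) (vlist t)" and ?f = "\<lambda>p. the (label_at t p)"
  have xs: "set ?xs = verts t - unlabeled t" by (auto simp: set_vlist unlabeled_def)
  have f: "map ?f ?xs = plabels t"
    by (simp add: plabels_def map_label_vlist[symmetric] filter_map o_def)
  have "distinct (map ?f ?xs) \<longleftrightarrow> inj_on ?f (set ?xs)"
    unfolding distinct_map by (simp add: distinct_vlist)
  moreover have "set (map ?f ?xs) = ?f ` set ?xs" by (rule set_map)
  ultimately show ?thesis unfolding bij_betw_def xs f by (simp only:)
qed

lemma PT_iff: "t \<in> PT n \<longleftrightarrow> distinct (plabels t) \<and> set (plabels t) = {1..n}"
  by (simp add: PT_def bij_betw_labels)

lemma vertex_eqI:
  assumes "distinct (plabels t)" "p \<in> verts t" "label_at t p = Some i"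
  shows "vertex t i = p"
proof -
  have inj: "inj_on (\<lambda>p. the (label_at t p)) (verts t - unlabeled t)"
    using bij_betw_labels[of t "set (plabels t)"] assms(1) bij_betw_imp_inj_on by blast
  have "q = p" if "q \<in> verts t" "label_at t q = Some i" for q
    by (rule inj_onD[OF inj]) (use that assms(2,3) in \<open>simp_all add: unlabeled_def\<close>)
  then show ?thesis unfolding vertex_def using assms(2,3) by (intro the_equality) blast+
qed

lemma labs_eP: "labs (eP t) = map Some (labP t)"
proof (induct t)
  case (PN a ts)
  then have "map (labs \<circ> eP) ts = map (map Some \<circ> labP) ts" by simp
  then show ?case by (simp add: map_concat del: map_eq_conv)
qed

lemma plabels_eW [simp]: "plabels (eW t) = labW t"
  by (induct t) (simp_all add: plabels_def labs_eP filter_map o_def)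

lemma set_pl_label: "p \<in> verts (eP t) \<Longrightarrow> label_at (eP t) p = Some i \<Longrightarrow> i \<in> set_pl t"
  by (induct t arbitrary: p) (fastforce simp: verts_Node)

lemma set_lw_label: "p \<in> verts (eW t) \<Longrightarrow> label_at (eW t) p = Some i \<Longrightarrow> i \<in> set_lw t"
proof (induct t arbitrary: p)
  case (Leaf t)
  then show ?case by (simp add: set_pl_label)
next
  case (Br a b)
  then show ?case by (fastforce simp: verts_Node less_Suc_eq)
qed

lemma obtain_vertex:
  assumes "i \<in> set_lw t"
  obtains p where "p \<in> verts (eW t)" "label_at (eW t) p = Some i"
proof -
  have "i \<in> set (plabels (eW t))" using assms by simp
  then have "Some i \<in> set (labs (eW t))" unfolding plabels_def by auto
  then show ?thesis using that unfolding map_label_vlist[symmetric] by (auto simp: set_vlist)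
qed

lemma verts_map_ptree [simp]: "verts (map_ptree f t) = verts t"
proof (induct t)
  case (Node a ts)
  then show ?case by (auto simp: verts_Node set_eq_iff)
qed

lemma subtree_at_map: "p \<in> verts t \<Longrightarrow> subtree_at (map_ptree f t) p = map_ptree f (subtree_at t p)"
proof (induct t arbitrary: p)
  case (Node a ts)
  then show ?case by (auto simp: verts_Node)
qed

lemma label_at_eP: "p \<in> verts (eP t) \<Longrightarrow> label_at (eP t) p \<noteq> None"
  by (induct t arbitrary: p) (fastforce simp: verts_Node)

lemma label_at_butlast_eP: "p \<in> verts (eP t) \<Longrightarrow> p \<noteq> [] \<Longrightarrow> label_at (eP t) (butlast p) \<noteq> None"
proof (induct t arbitrary: p)
  case (PN a ts)
  then obtain k q where "p = k # q" "k < length ts" "q \<in> verts (eP (ts ! k))" by (auto simp: verts_Node)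
  then show ?case using PN(1)[of "ts ! k" q] by (cases "q = []") auto
qed

lemma subtree_at_eP: "p \<in> verts (eP t) \<Longrightarrow> \<exists>s. subtree_at (eP t) p = eP s"
proof (induct t arbitrary: p)
  case (PN a ts)
  show ?case
  proof (cases p)
    case Nil
    then show ?thesis by (intro exI[of _ "PN a ts"]) simp
  next
    case (Cons k q)
    then show ?thesis using PN(1)[of "ts ! k" q] PN(2) by (auto simp: verts_Node)
  qed
qed

lemma subtree_at_eW:
  "p \<in> verts (eW t) \<Longrightarrow> label_at (eW t) p = Some i \<Longrightarrow> \<exists>cs. subtree_at (eW t) p = Node (Some i) (map eP cs)"
proof (induct t arbitrary: p)
  case (Leaf t)
  then obtain s where s: "subtree_at (eP t) p = eP s" using subtree_at_eP by force
  then show ?case using Leaf by (cases s) (auto simp: label_at_def)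
next
  case (Br a b)
  then show ?case by (fastforce simp: verts_Node less_Suc_eq)
qed

subsection \<open>Evaluation with a single substituted vertex\<close>

text \<open>The effect of substituting a word at \<open>p\<close>: the word takes the place of the
  subtree at \<open>p\<close> among the branches of its successor. At the root there is no
  successor, and the value chosen there is a default.\<close>

fun spl :: "'a pl \<Rightarrow> nat list \<Rightarrow> 'a pl list \<Rightarrow> 'a pl" where
  "spl t [] w = t"
| "spl (PN a ts) [k] w = PN a (take k ts @ w @ drop (Suc k) ts)"
| "spl (PN a ts) (k # l # p) w = PN a (ts[k := spl (ts ! k) (l # p) w])"

lemma contract_edge_Cons:
  "k < length ts \<Longrightarrow> q \<noteq> [] \<Longrightarrow> contract_edge (k # q) (Node a ts) = Node a (ts[k := contract_edge q (ts ! k)])"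
  by (simp add: contract_edge_def incoming_def Let_def)

lemma contract_edge_single:
  "contract_edge [k] (Node a ts) = Node a (take k ts @ branches (ts ! k) @ drop (Suc k) ts)"
  by (simp add: contract_edge_def incoming_def Let_def)

lemma contract_edge_spl:
  "p \<in> verts (eP t) \<Longrightarrow> p \<noteq> [] \<Longrightarrow>
    contract_edge p (replace_at (eP t) p (Node None (map eP w))) = eP (spl t p w)"
proof (induct t p w rule: spl.induct)
  case (2 a ts k w)
  then show ?case by (auto simp: verts_Node contract_edge_single take_map drop_map)
next
  case (3 a ts k l p w)
  then show ?case by (auto simp: verts_Node contract_edge_Cons map_update)
qed simp

text \<open>An unlabeled vertex with one branch disappears on contraction. Hence a fully labeled
  tree, expanded to a one-letter word, is substituted without any change.\<close>

lemma contract_edge_replace: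
  "p \<in> verts t \<Longrightarrow> p \<noteq> [] \<Longrightarrow> contract_edge p (replace_at t p (Node None [s])) = replace_at t p s"
proof (induct p arbitrary: t)
  case (Cons k q)
  obtain a ts where t: "t = Node a ts" by (cases t)
  show ?case
  proof (cases "q = []")
    case True
    then show ?thesis using Cons(2) by (auto simp: t contract_edge_single verts_Node upd_conv_take_nth_drop nth_append)
  next
    case False
    then show ?thesis using Cons by (auto simp: t contract_edge_Cons verts_Node)
  qed
qed simp

lemma catl_single:
  "k < length ts \<Longrightarrow> catl ((map (\<lambda>t. basis_vec [f t]) ts)[k := y]) =
    lmap (\<lambda>w. map f (take k ts) @ w @ map f (drop (Suc k) ts)) y"
proof (induct ts arbitrary: k)
  case (Cons t ts)
  show ?case
  proof (cases k)
    case 0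
    have "catl (map (\<lambda>t. basis_vec [f t]) ts) = (basis_vec (map f ts) :: _ \<Rightarrow>\<^sub>0 'c)"
      using catl_basis[of "\<lambda>t. [f t]" ts] by (simp add: concat_map_singleton)
    then show ?thesis by (simp add: 0)
  next
    case (Suc l)
    then show ?thesis using Cons by (simp add: lin_ext_lin_ext)
  qed
qed simp

lemma ev_relabel_cong:
  assumes "\<And>a. a \<in> set_pl t \<Longrightarrow> h a = basis_vec (Leaf (PN (s a) []))"
  shows "ev grL h t = basis_vec (Leaf (map_pl s t))"
proof -
  have "ev grL h t = ev grL (\<lambda>a. basis_vec (Leaf (PN (s a) []))) t" by (rule ev_cong) (rule assms)
  then show ?thesis by (simp add: ev_relabel)
qed

lemma evW_relabel_cong:
  assumes "\<And>a. a \<in> set_lw t \<Longrightarrow> h a = basis_vec (Leaf (PN (s a) []))"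
  shows "evW brL grL h t = basis_vec (map_lw s t)"
proof -
  have "evW brL grL h t = evW brL grL (\<lambda>a. basis_vec (Leaf (PN (s a) []))) t" by (rule evW_cong) (rule assms)
  then show ?thesis by (simp add: evW_relabel)
qed

text \<open>If \<open>i\<close> is not the root, its value is used as an entry of \<open>act\<close>
  on a single vertex, where by \<open>act_leaf\<close> it counts only through its expansion into
  words. Each word is spliced in at that place; closer to the root only single planar trees
  occur.\<close>

lemma ev_single:
  fixes h :: "'a \<Rightarrow> 'b lw \<Rightarrow>\<^sub>0 'k::field"
  assumes "distinct (labP t)" "p \<in> verts (eP t)"
    and "subtree_at (eP t) p = Node (Some i) (map eP cs)"
    and "\<And>a. a \<in> set_pl t \<Longrightarrow> a \<noteq> i \<Longrightarrow> h a = basis_vec (Leaf (PN (s a) []))"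
    and X: "X = act grL (map (\<lambda>c. basis_vec (Leaf (map_pl s c))) cs) (h i)"
  shows "ev grL h t = (if p = [] then X
    else lmap (\<lambda>w. Leaf (spl (map_pl s t) p w)) (lin_ext expand X))"
  using assms(1-4)
proof (induct t arbitrary: p)
  case (PN a ts)
  show ?case
  proof (cases p)
    case Nil
    then have "map eP ts = map eP cs" "a = i" using PN(4) by simp_all
    then have cs: "cs = ts" by (simp add: inj_map_eq_map inj_def eP_inject)
    have "map (ev grL h) ts = map (\<lambda>c. basis_vec (Leaf (map_pl s c))) ts"
    proof (rule map_cong[OF refl])
      fix t assume "t \<in> set ts"
      then show "ev grL h t = basis_vec (Leaf (map_pl s t))"
        using PN(2) \<open>a = i\<close> by (intro ev_relabel_cong PN(5)) auto
    qed
    then have "act grL (map (ev grL h) ts) (h a) = X" unfolding X cs \<open>a = i\<close> by (simp only:)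
    then show ?thesis using Nil by simp
  next
    case (Cons k q)
    have k: "k < length ts" and q: "q \<in> verts (eP (ts ! k))"
      and sub: "subtree_at (eP (ts ! k)) q = Node (Some i) (map eP cs)"
      using PN(3,4) by (auto simp: Cons verts_Node)
    have i: "i \<in> set_pl (ts ! k)" using set_pl_label[OF q] sub by (simp add: label_at_def)
    have d: "distinct (concat (map labP ts))" "a \<notin> (\<Union>t\<in>set ts. set_pl t)" using PN(2) by auto
    then have "a \<noteq> i" using i k nth_mem by blast
    then have ha: "h a = basis_vec (Leaf (PN (s a) []))" by (intro PN(5)) auto
    let ?f = "\<lambda>t. basis_vec [map_pl s t] :: 'b pl list \<Rightarrow>\<^sub>0 'k"
    let ?Y = "lin_ext expand (ev grL h (ts ! k))"
    \<comment> \<open>Distinctness of labels puts \<open>i\<close> in branch \<open>k\<close> only;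
      the other branches are merely relabeled.\<close>
    have "map (lin_ext expand) (map (ev grL h) ts) = (map ?f ts)[k := ?Y]"
    proof (rule nth_equalityI)
      fix j assume "j < length (map (lin_ext expand) (map (ev grL h) ts))"
      then have j: "j < length ts" by simp
      show "map (lin_ext expand) (map (ev grL h) ts) ! j = (map ?f ts)[k := ?Y] ! j"
      proof (cases "j = k")
        case False
        then have "i \<notin> set_pl (ts ! j)"
          using distinct_concat_map_nth[OF d(1) j k] i by auto
        then have "ev grL h (ts ! j) = basis_vec (Leaf (map_pl s (ts ! j)))"
          using j nth_mem by (intro ev_relabel_cong PN(5)) auto
        then show ?thesis using False j by simp
      qed (use j in simp)
    qed simp
    then have ev: "ev grL h (PN a ts) =
        lmap (\<lambda>w. Leaf (PN (s a) (map (map_pl s) (take k ts) @ w @ map (map_pl s) (drop (Suc k) ts)))) ?Y"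
      by (simp add: ha act_leaf catl_single[OF k] lin_ext_lin_ext del: map_map)
    have IH: "ev grL h (ts ! k) = (if q = [] then X
        else lmap (\<lambda>w. Leaf (spl (map_pl s (ts ! k)) q w)) (lin_ext expand X))"
      using nth_mem[OF k] by (intro PN(1) distinct_concat_map_nthD[OF d(1) k] q sub PN(5)) auto
    \<comment> \<open>If \<open>i\<close> is the root of the branch, its words themselves enter the
      list of branches; otherwise the branch has already become a combination of single
      trees.\<close>
    show ?thesis
    proof (cases q)
      case Nil
      then show ?thesis unfolding ev IH by (simp add: Cons take_map drop_map)
    next
      case q': (Cons l r)
      then show ?thesis unfolding ev IH
        by (simp add: Cons lin_ext_lin_ext k upd_conv_take_nth_drop take_map drop_map)
    qed
  qed
qed

text \<open>The root, or a vertex right above a bracket, receives its value with brackets intact; a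
  vertex above a labeled one receives the expansion. These are the two cases of
  \<open>lw_comp\<close>.\<close>

lemma evW_single:
  fixes h :: "'a \<Rightarrow> 'b lw \<Rightarrow>\<^sub>0 'k::field"
  assumes "distinct (labW t)" "p \<in> verts (eW t)"
    and "subtree_at (eW t) p = Node (Some i) (map eP cs)"
    and "\<And>a. a \<in> set_lw t \<Longrightarrow> a \<noteq> i \<Longrightarrow> h a = basis_vec (Leaf (PN (s a) []))"
    and X: "X = act grL (map (\<lambda>c. basis_vec (Leaf (map_pl s c))) cs) (h i)"
  shows "lmap eW (evW brL grL h t) = (if p = [] \<or> label_at (eW t) (butlast p) = None
    then lmap (\<lambda>u. replace_at (eW (map_lw s t)) p (eW u)) X
    else lmap (\<lambda>w. contract_edge p (replace_at (eW (map_lw s t)) p (Node None (map eP w)))) (lin_ext expand X))"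
  using assms(1-4)
proof (induct t arbitrary: p)
  case (Leaf t)
  have p: "p \<in> verts (eP t)" using Leaf(2) by simp
  have ev: "ev grL h t = (if p = [] then X
    else lmap (\<lambda>w. Leaf (spl (map_pl s t) p w)) (lin_ext expand X))"
    by (rule ev_single[where i = i and cs = cs and s = s and h = h and X = X]) (use Leaf p X in simp_all)
  show ?case
  proof (cases "p = []")
    case True
    then show ?thesis by (simp add: ev)
  next
    case False
    have "p \<in> verts (eP (map_pl s t))" using p by (metis map_ptree_eP verts_map_ptree)
    then show ?thesis using False label_at_butlast_eP[OF p]
      by (auto simp add: ev lin_ext_lin_ext contract_edge_spl)
  qed
next
  case (Br a b)
  have ne: "p \<noteq> []" using Br(5) by auto
  then obtain k q where pk: "p = k # q" "k < 2" "q \<in> verts ([eW a, eW b] ! k)"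
    using Br(4) by (auto simp: verts_Node)
  then consider "k = 0" | "k = 1" by linarith
  then show ?case
  proof cases
    case 1
    have q: "q \<in> verts (eW a)" and sub: "subtree_at (eW a) q = Node (Some i) (map eP cs)"
      using pk Br(5) by (simp_all add: 1)
    then have "i \<in> set_lw a" by (intro set_lw_label[OF q]) (simp add: label_at_def)
    then have "i \<notin> set_lw b" using Br(3) by auto
    then have b: "evW brL grL h b = basis_vec (map_lw s b)"
      using Br(6) by (intro evW_relabel_cong) auto
    have IH: "lmap eW (evW brL grL h a) = (if q = [] \<or> label_at (eW a) (butlast q) = None
      then lmap (\<lambda>u. replace_at (eW (map_lw s a)) q (eW u)) X
      else lmap (\<lambda>w. contract_edge q (replace_at (eW (map_lw s a)) q (Node None (map eP w)))) (lin_ext expand X))"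
      by (rule Br(1)[OF _ q sub]) (use Br(3,6) in auto)
    have "lmap eW (evW brL grL h (Br a b)) =
        lmap (\<lambda>u. Node None [u, eW (map_lw s b)]) (lmap eW (evW brL grL h a))"
      by (simp add: b brL_basis lin_ext_lin_ext)
    then show ?thesis unfolding IH
      by (cases "q = []") (simp_all add: lin_ext_lin_ext pk 1 contract_edge_Cons)
  next
    case 2
    have q: "q \<in> verts (eW b)" and sub: "subtree_at (eW b) q = Node (Some i) (map eP cs)"
      using pk Br(5) by (simp_all add: 2)
    then have "i \<in> set_lw b" by (intro set_lw_label[OF q]) (simp add: label_at_def)
    then have "i \<notin> set_lw a" using Br(3) by auto
    then have a: "evW brL grL h a = basis_vec (map_lw s a)"
      using Br(6) by (intro evW_relabel_cong) auto
    have IH: "lmap eW (evW brL grL h b) = (if q = [] \<or> label_at (eW b) (butlast q) = None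
      then lmap (\<lambda>u. replace_at (eW (map_lw s b)) q (eW u)) X
      else lmap (\<lambda>w. contract_edge q (replace_at (eW (map_lw s b)) q (Node None (map eP w)))) (lin_ext expand X))"
      by (rule Br(2)[OF _ q sub]) (use Br(3,6) in auto)
    have "lmap eW (evW brL grL h (Br a b)) =
        lmap (\<lambda>u. Node None [eW (map_lw s a), u]) (lmap eW (evW brL grL h b))"
      by (simp add: a brL_basis lin_ext_lin_ext)
    then show ?thesis unfolding IH
      by (cases "q = []") (simp_all add: lin_ext_lin_ext pk 2 contract_edge_Cons)
  qed
qed

subsection \<open>Expanding brackets\<close>

lemma lmap_cat: "lmap (map f) (cat x y) = cat (lmap (map f) x) (lmap (map f) y)"
  by (simp add: cat_def bilin_ext_def lin_ext_lin_ext)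

lemma expand_map_lw: "expand (map_lw f t) = lmap (map (map_pl f)) (expand t)"
  by (induct t) (simp_all add: lmap_cat)

lemma expand_graftW: "expand (graftW g t) = lmap (map (graftP g)) (expand t)"
  by (induct t) (simp_all add: lmap_cat)

text \<open>The word contributed by one choice of exchanges in the expansion of nested commutators.
  Addresses in the set refer to the tree before exchanging, as in \<open>exchange\<close>.\<close>

primrec wordA :: "'a lw \<Rightarrow> nat list set \<Rightarrow> 'a pl list" where
  "wordA (Leaf t) = (\<lambda>A. [t])"
| "wordA (Br a b) = (\<lambda>A. if [] \<in> A then wordA b {p. 1 # p \<in> A} @ wordA a {p. 0 # p \<in> A}
     else wordA a {p. 0 # p \<in> A} @ wordA b {p. 1 # p \<in> A})"

lemma unlabeled_eP [simp]: "unlabeled (eP t) = {}"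
  using label_at_eP by (auto simp: unlabeled_def)

lemma unlabeled_Br:
  "unlabeled (eW (Br a b)) = insert [] ((#) 0 ` unlabeled (eW a) \<union> (#) 1 ` unlabeled (eW b))"
  by (auto simp: unlabeled_def verts_Node less_Suc_eq)

lemma finite_unlabeled: "finite (unlabeled t)"
proof -
  have "finite (verts t)" unfolding set_vlist[symmetric] by simp
  then show ?thesis by (simp add: unlabeled_def)
qed

text \<open>Each commutator contributes a choice of order, with sign -1 for the exchanged one. The
  choices at all unlabeled vertices give the signed sum in the composition of
  \<open>LW\<close>.\<close>

lemma expand_eq_sum:
  "expand t = (\<Sum>A\<in>Pow (unlabeled (eW t)). scal ((- 1) ^ card A) (basis_vec (wordA t A)) :: _ \<Rightarrow>\<^sub>0 'k::field)"
proof (induct t)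
  case (Leaf t)
  then show ?case by simp
next
  case (Br a b)
  let ?Ua = "unlabeled (eW a)" and ?Ub = "unlabeled (eW b)"
  \<comment> \<open>A set of addresses is a bit for the root together with sets for the two
    subtrees; \<open>?J\<close> reassembles it.\<close>
  let ?J = "\<lambda>e A B. (if e then {[]} else {}) \<union> ((#) (0::nat) ` A \<union> (#) 1 ` B) :: nat list set"
  let ?c = "\<lambda>A. scal ((- 1) ^ card A) :: _ \<Rightarrow> _ \<Rightarrow>\<^sub>0 'k"
  have card: "card (?J e A B) = (if e then 1 else 0) + (card A + card B)" if "finite A" "finite B" for e A B
  proof -
    have "card ((#) (0::nat) ` A \<union> (#) 1 ` B) = card A + card B"
      using that by (subst card_Un_disjoint) (auto simp: card_image)
    then show ?thesis using that by (cases e) (auto simp: card_insert_if)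
  qed
  have pre: "{p. 0 # p \<in> ?J e A B} = A" "{p. 1 # p \<in> ?J e A B} = B" "[] \<in> ?J e A B \<longleftrightarrow> e" for e A B
    by auto
  have rejoin: "?J ([] \<in> A) {p. 0 # p \<in> A} {p. 1 # p \<in> A} = A"
    if "A \<in> Pow (insert [] ((#) 0 ` ?Ua \<union> (#) 1 ` ?Ub))" for A
    using that by (auto simp: image_iff)
  have "(\<Sum>A\<in>Pow (unlabeled (eW (Br a b))). ?c A (basis_vec (wordA (Br a b) A))) =
     (\<Sum>q\<in>UNIV \<times> (Pow ?Ua \<times> Pow ?Ub). ?c (?J (fst q) (fst (snd q)) (snd (snd q)))
        (basis_vec (wordA (Br a b) (?J (fst q) (fst (snd q)) (snd (snd q))))))"
    unfolding unlabeled_Br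
    by (rule sum.reindex_bij_witness[of _ "\<lambda>q. ?J (fst q) (fst (snd q)) (snd (snd q))"
          "\<lambda>A. ([] \<in> A, {p. 0 # p \<in> A}, {p. 1 # p \<in> A})"])
      (simp_all only: fst_conv snd_conv pre rejoin prod.collapse mem_Times_iff, auto split: if_splits)
  also have "\<dots> = (\<Sum>e\<in>UNIV. \<Sum>A\<in>Pow ?Ua. \<Sum>B\<in>Pow ?Ub. ?c (?J e A B) (basis_vec (wordA (Br a b) (?J e A B))))"
    by (simp add: sum.cartesian_product case_prod_unfold)
  also have "\<dots> = (\<Sum>e\<in>UNIV. \<Sum>A\<in>Pow ?Ua. \<Sum>B\<in>Pow ?Ub. scal ((if e then - 1 else 1) * ((- 1) ^ card A * (- 1) ^ card B))
      (basis_vec (if e then wordA b B @ wordA a A else wordA a A @ wordA b B)))"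
  proof (intro sum.cong refl)
    fix e A B assume "A \<in> Pow ?Ua" "B \<in> Pow ?Ub"
    then have "finite A" "finite B" using finite_unlabeled finite_subset by blast+
    from card[OF this, of e] show "?c (?J e A B) (basis_vec (wordA (Br a b) (?J e A B))) =
      scal ((if e then - 1 else 1) * ((- 1) ^ card A * (- 1) ^ card B))
      (basis_vec (if e then wordA b B @ wordA a A else wordA a A @ wordA b B))"
      by (simp only: wordA.simps pre) (simp add: power_add)
  qed
  also have "\<dots> = (\<Sum>A\<in>Pow ?Ua. \<Sum>B\<in>Pow ?Ub. scal ((- 1) ^ card A * (- 1) ^ card B) (basis_vec (wordA a A @ wordA b B))) -
     (\<Sum>A\<in>Pow ?Ua. \<Sum>B\<in>Pow ?Ub. scal ((- 1) ^ card A * (- 1) ^ card B) (basis_vec (wordA b B @ wordA a A)))"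
    by (simp add: UNIV_bool sum_negf)
  also have "\<dots> = cat (expand a) (expand b) - cat (expand b) (expand a)"
    unfolding Br by (simp add: scal_sum mult.commute sum.swap[of _ "Pow ?Ub"])
  finally show ?case by simp
qed

declare exchange.simps [simp del]

lemma exchange_empty: "exchange {} t = t"
proof (induct t)
  case (Node a ts)
  have "map (\<lambda>k. exchange {} (ts ! k)) [0..<length ts] = map (\<lambda>k. ts ! k) [0..<length ts]"
    by (intro map_cong refl Node) auto
  then show ?case by (simp add: exchange.simps map_nth)
qed

lemma contract_eP: "contract_unlabeled (eP t) = eP t"
proof (induct t)
  case (PN a ts)
  then have "concat (map (\<lambda>t. [contract_unlabeled (eP t)]) ts) = map eP ts"
    by (simp add: concat_map_singleton)
  then show ?case by (simp add: o_def)
qed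

text \<open>Contracting the binary top flattens the exchanged tree into one corolla whose branches
  are the letters of the word. The statement about the root label travels along because it decides
  whether a branch is dissolved into its parent.\<close>

lemma contract_exchange:
  "A \<subseteq> unlabeled (eW t) \<Longrightarrow>
    (root_label (exchange A (eW t)) = None \<longleftrightarrow> (\<exists>a b. t = Br a b)) \<and>
    contract_unlabeled (exchange A (eW t)) =
      (case t of Leaf s \<Rightarrow> eP s | Br a b \<Rightarrow> Node None (map eP (wordA t A)))"
proof (induct t arbitrary: A)
  case (Leaf t)
  then show ?case by (simp add: exchange_empty contract_eP)
next
  case (Br a b)
  let ?A0 = "{p. 0 # p \<in> A}" and ?A1 = "{p. Suc 0 # p \<in> A}"
  have 0: "?A0 \<subseteq> unlabeled (eW a)" and 1: "?A1 \<subseteq> unlabeled (eW b)"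
    using Br(3) unfolding unlabeled_Br by auto
  have ex: "exchange A (eW (Br a b)) = Node None ((if [] \<in> A then rev else id) [exchange ?A0 (eW a), exchange ?A1 (eW b)])"
    by (simp add: exchange.simps upt_conv_Cons)
  have w: "(if root_label (exchange B (eW c)) = None then branches (contract_unlabeled (exchange B (eW c)))
     else [contract_unlabeled (exchange B (eW c))]) = map eP (wordA c B)"
    if "(root_label (exchange B (eW c)) = None \<longleftrightarrow> (\<exists>a b. c = Br a b)) \<and>
      contract_unlabeled (exchange B (eW c)) =
      (case c of Leaf s \<Rightarrow> eP s | Br a b \<Rightarrow> Node None (map eP (wordA c B)))" for B and c :: "'a lw"
    using that by (cases c) auto
  show ?case
    using w[OF Br(1)[OF 0]] w[OF Br(2)[OF 1]] unfolding ex by simp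
qed

lemma set_wordA: "(\<Union>s\<in>set (wordA t A). set_pl s) = set_lw t"
  by (induct t arbitrary: A) auto

subsection \<open>Comparison of the compositions\<close>

lemma labP_map: "labP (map_pl f t) = map f (labP t)"
proof (induct t)
  case (PN a ts)
  then have "map (labP \<circ> map_pl f) ts = map (map f \<circ> labP) ts" by simp
  then show ?case by (simp add: map_concat del: map_eq_conv)
qed

lemma labW_map: "labW (map_lw f t) = map f (labW t)"
  by (induct t) (simp_all add: labP_map)

definition valid :: "nat \<Rightarrow> nat lw \<Rightarrow> bool" where
  "valid n t \<longleftrightarrow> distinct (labW t) \<and> set_lw t = {1..n}"

lemma eW_in_PT: "eW t \<in> PT n \<longleftrightarrow> valid n t"
  by (simp add: PT_iff valid_def)

lemma set_lw_nonempty: "set_lw t \<noteq> {}"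
proof -
  have "set_pl s \<noteq> {}" for s :: "'a pl" by (cases s) simp
  then show ?thesis by (induct t) auto
qed

text \<open>The conditions on unlabeled vertices are built into \<open>Br\<close>; the bound
  \<open>n \<ge> 2\<close> holds since both arguments of a bracket carry a label.\<close>

lemma eW_in_W_trees: "valid n t \<Longrightarrow> eW t \<in> W_trees n \<longleftrightarrow> (\<exists>a b. t = Br a b)"
proof
  assume v: "valid n t"
  {
    assume "eW t \<in> W_trees n"
    then have "label_at (eW t) [] = None" by (simp add: W_trees_def)
    then show "\<exists>a b. t = Br a b" by (cases t) (auto simp: label_at_def)
  }
  assume "\<exists>a b. t = Br a b"
  then obtain a b where t: "t = Br a b" by blast
  have 1: "label_at (eW t) (butlast p) = None" if "p \<in> unlabeled (eW t)" for t :: "nat lw" and p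
    using that
  proof (induct t arbitrary: p)
    case (Br a b)
    then show ?case unfolding unlabeled_Br by (auto simp: less_Suc_eq)
  qed simp
  have 2: "length (incoming (eW t) p) = 2" if "p \<in> unlabeled (eW t)" for t :: "nat lw" and p
    using that
  proof (induct t arbitrary: p)
    case (Br a b)
    then show ?case unfolding unlabeled_Br by (auto simp: incoming_def)
  qed simp
  have "set_lw a \<inter> set_lw b = {}" "set_lw a \<union> set_lw b = {1..n}" using v by (auto simp: t valid_def)
  then have "n = card (set_lw a) + card (set_lw b)"
    by (metis card_Un_disjoint card_atLeastAtMost diff_Suc_1 finite_set_lw)
  moreover have "card (set_lw a) \<ge> 1" "card (set_lw b) \<ge> 1"
    using set_lw_nonempty by (simp_all add: Suc_le_eq card_gt_0_iff)
  ultimately have "n \<ge> 2" by simp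
  moreover have "label_at (eW t) [] = None" by (simp add: t)
  ultimately show "eW t \<in> W_trees n"
    unfolding W_trees_def using v 1[of _ t] 2[of _ t] by (simp add: eW_in_PT)
qed

text \<open>The relabeling \<open>s\<close> is injective and fixes \<open>i\<close>, so the vertex
  to be replaced keeps its address \<open>p\<close>, and its incoming edges are the relabeled
  \<open>cs\<close>.\<close>

lemma pt_comp_eq:
  fixes T :: "nat lw"
  assumes T: "distinct (labW T)" "p \<in> verts (eW T)" "subtree_at (eW T) p = Node (Some i) (map eP cs)"
    and "n \<ge> 1" and s: "s = (\<lambda>j. if j \<le> i then j else j + n - 1)" and cs': "cs' = map (map_pl s) cs"
    and R': "R' = map_ptree (\<lambda>j. j + i - 1) R"
  shows "pt_comp n i (eW T) R = (\<Sum>\<phi>\<in>{..<length cs} \<rightarrow>\<^sub>E set_ptree R'.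
    basis_vec (replace_at (eW (map_lw s T)) p (graft (\<lambda>w. map eP (sel cs' \<phi> w)) R')))"
proof -
  have "inj s" using assms(4) by (auto simp: s inj_def)
  then have d: "distinct (plabels (eW (map_lw s T)))"
    using T(1) by (simp add: labW_map distinct_map inj_on_subset[OF \<open>inj s\<close> subset_UNIV])
  have p: "p \<in> verts (eW (map_lw s T))"
    using T(2) by (metis map_ptree_eW verts_map_ptree)
  have sub: "subtree_at (eW (map_lw s T)) p = Node (Some i) (map eP cs')"
    using subtree_at_map[OF T(2), of s] T(3) by (simp add: cs' s)
  have v: "vertex (eW (map_lw s T)) i = p"
    by (rule vertex_eqI[OF d p]) (simp add: label_at_def sub)
  have inc: "incoming (eW (map_lw s T)) p = map eP cs'" by (simp add: incoming_def sub)
  show ?thesis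
    unfolding pt_comp_def Let_def map_ptree_eW s[symmetric] v inc sel_def[symmetric] sel_map R'
    by (simp add: cs')
qed

text \<open>With \<open>R\<close> substituted at \<open>i\<close> and single relabeled vertices
  elsewhere, \<open>evW_single\<close> computes the evaluation from the action of the incoming trees
  on \<open>R\<close>, and \<open>act_graftW\<close> identifies this action with grafting along all
  maps. It remains to match the contracted cases.\<close>

theorem lw_comp_eq:
  fixes T R :: "nat lw" and h :: "nat \<Rightarrow> nat lw \<Rightarrow>\<^sub>0 'k::field"
  assumes T: "valid m T" and R: "valid n R" and i: "1 \<le> i" "i \<le> m" and n: "n \<ge> 1"
    and h: "h i = basis_vec (map_lw (\<lambda>j. j + i - 1) R)"
      "\<And>j. j \<noteq> i \<Longrightarrow> h j = basis_vec (Leaf (PN (if j \<le> i then j else j + n - 1) []))"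
  shows "lw_comp n i (eW T) (eW R) = lmap eW (evW brL grL h T)"
proof -
  have dT: "distinct (labW T)" and dR: "distinct (labW R)" using T R by (simp_all add: valid_def)
  have "i \<in> set_lw T" using T i by (simp add: valid_def)
  then obtain p where p: "p \<in> verts (eW T)" and pi: "label_at (eW T) p = Some i" by (rule obtain_vertex)
  obtain cs where cs: "subtree_at (eW T) p = Node (Some i) (map eP cs)"
    using subtree_at_eW[OF p pi] by blast
  have v: "vertex (eW T) i = p" using dT by (intro vertex_eqI p pi) simp
  define s where "s = (\<lambda>j. if j \<le> i then j else j + n - 1)"
  define r where "r = (\<lambda>j. j + i - 1)"
  define cs' where "cs' = map (map_pl s) cs"
  define T' where "T' = eW (map_lw s T)"
  define R' where "R' = map_lw r R"
  let ?P = "{..<length cs} \<rightarrow>\<^sub>E set_lw R'"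
  have "inj r" using i by (auto simp: r_def inj_def)
  then have dR': "distinct (labW R')" using dR by (simp add: R'_def labW_map distinct_map inj_on_subset[OF \<open>inj r\<close> subset_UNIV])
  define X where "X = act grL (map (\<lambda>c. basis_vec (Leaf (map_pl s c))) cs) (h i)"
  have "X = act grL (map (\<lambda>c. basis_vec (Leaf c)) cs') (basis_vec R')"
    by (simp add: X_def h(1) cs'_def R'_def r_def o_def)
  then have X: "X = (\<Sum>\<phi>\<in>?P. basis_vec (graftW (sel cs' \<phi>) R'))"
    unfolding act_graftW[OF dR'] by (simp add: cs'_def)
  have ev: "lmap eW (evW brL grL h T) = (if p = [] \<or> label_at (eW T) (butlast p) = None
    then lmap (\<lambda>u. replace_at T' p (eW u)) X
    else lmap (\<lambda>w. contract_edge p (replace_at T' p (Node None (map eP w)))) (lin_ext expand X))"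
    unfolding T'_def
    by (rule evW_single[where i = i and s = s and h = h and X = X, OF dT p cs _ X_def]) (simp add: h(2) s_def)
  have pt: "pt_comp n i (eW T) Q = (\<Sum>\<phi>\<in>?P.
      basis_vec (replace_at T' p (graft (\<lambda>w. map eP (sel cs' \<phi> w)) (map_ptree r Q))) :: _ \<Rightarrow>\<^sub>0 'k)"
    if "set_ptree Q = set_lw R" for Q
  proof -
    have "set_ptree (map_ptree r Q) = set_lw R'" by (simp add: ptree.set_map lw.set_map that R'_def)
    then show ?thesis
      using pt_comp_eq[OF dT p cs n s_def cs'_def, of "map_ptree r Q" Q] by (simp add: r_def T'_def)
  qed
  have ptR: "pt_comp n i (eW T) (eW R) = lmap (\<lambda>u. replace_at T' p (eW u)) X"
    by (simp add: pt X graft_eW R'_def[symmetric])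
  have W: "eW R \<in> W_trees n \<longleftrightarrow> (\<exists>a b. R = Br a b)" by (rule eW_in_W_trees[OF R])
  show ?thesis
  proof (cases "p = [] \<or> label_at (eW T) (butlast p) = None")
    case True
    then show ?thesis by (auto simp: ev lw_comp_def Let_def v ptR)
  next
    case labeled: False
    have p': "p \<in> verts T'" using p by (metis T'_def map_ptree_eW verts_map_ptree)
    show ?thesis
    proof (cases R)
      case (Leaf t)
      \<comment> \<open>Here \<open>R\<close> is fully labeled: evaluation goes through one-letter
        words, whereas \<open>lw_comp\<close> composes directly. Contracting the outgoing edge of a
        one-branch vertex reconciles them.\<close>
      then have "lin_ext expand X = (\<Sum>\<phi>\<in>?P. basis_vec [graftP (sel cs' \<phi>) (map_pl r t)])"
        by (simp add: X R'_def)
      moreover have "lmap (\<lambda>u. replace_at T' p (eW u)) X =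
          (\<Sum>\<phi>\<in>?P. basis_vec (replace_at T' p (eP (graftP (sel cs' \<phi>) (map_pl r t)))))"
        by (simp add: X R'_def Leaf)
      moreover have "contract_edge p (replace_at T' p (Node None [u])) = replace_at T' p u" for u
        using labeled p' by (intro contract_edge_replace) auto
      moreover have "eW R \<notin> W_trees n" using W Leaf by simp
      ultimately show ?thesis using labeled by (simp add: ev lw_comp_def Let_def v ptR)
    next
      case (Br a b)
      let ?U = "unlabeled (eW R)"
      let ?G = "\<lambda>A \<phi>. map (graftP (sel cs' \<phi>)) (map (map_pl r) (wordA R A))"
      have Q: "lmap (contract_edge p) (pt_comp n i (eW T) (contract_unlabeled (exchange A (eW R)))) =
          (\<Sum>\<phi>\<in>?P. basis_vec (contract_edge p (replace_at T' p (Node None (map eP (?G A \<phi>))))) :: _ \<Rightarrow>\<^sub>0 'k)"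
        if "A \<in> Pow ?U" for A
      proof -
        have c: "contract_unlabeled (exchange A (eW R)) = Node None (map eP (wordA R A))"
          using contract_exchange[of A R] that Br by simp
        have "set_ptree (Node None (map eP (wordA R A))) = set_lw R"
          using set_wordA[of R A] by simp
        from pt[OF this] show ?thesis
          unfolding c by (simp add: graft_eP o_def)
      qed
      have "lw_comp n i (eW T) (eW R) = (\<Sum>A\<in>Pow ?U. scal ((- 1) ^ card A)
          (\<Sum>\<phi>\<in>?P. basis_vec (contract_edge p (replace_at T' p (Node None (map eP (?G A \<phi>)))))) :: _ \<Rightarrow>\<^sub>0 'k)"
      proof -
        have "eW R \<in> W_trees n" using W Br by blast
        then have "lw_comp n i (eW T) (eW R) = (\<Sum>A\<in>Pow ?U. scal ((- 1) ^ card A)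
          (lmap (contract_edge p) (pt_comp n i (eW T) (contract_unlabeled (exchange A (eW R)))) :: _ \<Rightarrow>\<^sub>0 'k))"
          using labeled by (simp add: lw_comp_def Let_def v)
        also have "\<dots> = (\<Sum>A\<in>Pow ?U. scal ((- 1) ^ card A)
          (\<Sum>\<phi>\<in>?P. basis_vec (contract_edge p (replace_at T' p (Node None (map eP (?G A \<phi>)))))))"
          by (rule sum.cong[OF refl]) (simp only: Q)
        finally show ?thesis .
      qed
      \<comment> \<open>Grafting commutes with expansion, so the exchanges may be chosen in
        \<open>R\<close> itself.\<close>
      moreover have "lin_ext expand X = (\<Sum>\<phi>\<in>?P. \<Sum>A\<in>Pow ?U. scal ((- 1) ^ card A) (basis_vec (?G A \<phi>)))"
        unfolding X lin_ext_simps lin_ext_basis R'_def expand_graftW expand_map_lw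
        by (simp add: expand_eq_sum[of R])
      ultimately show ?thesis unfolding ev if_not_P[OF labeled]
        by (simp add: scal_sum) (rule sum.swap)
    qed
  qed
qed

section \<open>Vector spaces and operads\<close>

lemma linear_map_iff:
  "linear_map class_ring V W f \<longleftrightarrow> vectorspace class_ring V \<and> vectorspace class_ring W \<and>
    (\<forall>x\<in>carrier V. f x \<in> carrier W) \<and>
    (\<forall>x\<in>carrier V. \<forall>y\<in>carrier V. f (x \<oplus>\<^bsub>V\<^esub> y) = f x \<oplus>\<^bsub>W\<^esub> f y) \<and>
    (\<forall>c. \<forall>x\<in>carrier V. f (c \<odot>\<^bsub>V\<^esub> x) = c \<odot>\<^bsub>W\<^esub> f x)"
  for V :: "('k::field, 'v) module" and W :: "('k, 'w) module"
  unfolding linear_map_def mod_hom_def mod_hom_axioms_def LinearCombinations.module_hom_def vectorspace_def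
  by (auto simp: Pi_iff)

text \<open>The axioms lift to \<open>V\<close> along the surjection. Quotient spaces, whose scalar
  multiplication is a union of cosets, get their structure this way.\<close>

lemma vectorspace_surj_image:
  fixes V :: "('k::field, 'v) module" and W :: "('k, 'w) module"
  assumes V: "vectorspace class_ring V" and surj: "f ` carrier V = carrier W"
    and add: "\<And>x y. x \<in> carrier V \<Longrightarrow> y \<in> carrier V \<Longrightarrow> f (x \<oplus>\<^bsub>V\<^esub> y) = f x \<oplus>\<^bsub>W\<^esub> f y"
    and smult: "\<And>c x. x \<in> carrier V \<Longrightarrow> f (c \<odot>\<^bsub>V\<^esub> x) = c \<odot>\<^bsub>W\<^esub> f x"
    and zero: "f \<zero>\<^bsub>V\<^esub> = \<zero>\<^bsub>W\<^esub>"
  shows "vectorspace class_ring W"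
proof -
  interpret V: vectorspace class_ring V by (rule V)
  have cV: "\<zero>\<^bsub>V\<^esub> \<in> carrier V" "\<And>x y. x \<in> carrier V \<Longrightarrow> y \<in> carrier V \<Longrightarrow> x \<oplus>\<^bsub>V\<^esub> y \<in> carrier V"
    "\<And>c x. x \<in> carrier V \<Longrightarrow> c \<odot>\<^bsub>V\<^esub> x \<in> carrier V"
    using V.smult_closed by auto
  have ex: "\<exists>x\<in>carrier V. y = f x" if "y \<in> carrier W" for y using that surj by auto
  have "abelian_group W"
  proof (rule abelian_groupI)
    fix x y assume "x \<in> carrier W" "y \<in> carrier W"
    then obtain a b where "a \<in> carrier V" "b \<in> carrier V" "x = f a" "y = f b" using ex by metis
    then show "x \<oplus>\<^bsub>W\<^esub> y \<in> carrier W" "x \<oplus>\<^bsub>W\<^esub> y = y \<oplus>\<^bsub>W\<^esub> x"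
      using surj cV by (auto simp: add[symmetric] V.a_comm)
  next
    show "\<zero>\<^bsub>W\<^esub> \<in> carrier W" using surj cV(1) zero by (metis image_eqI)
  next
    fix x y z assume "x \<in> carrier W" "y \<in> carrier W" "z \<in> carrier W"
    then obtain a b c where "a \<in> carrier V" "b \<in> carrier V" "c \<in> carrier V" "x = f a" "y = f b" "z = f c"
      using ex by metis
    then show "x \<oplus>\<^bsub>W\<^esub> y \<oplus>\<^bsub>W\<^esub> z = x \<oplus>\<^bsub>W\<^esub> (y \<oplus>\<^bsub>W\<^esub> z)"
      using cV by (simp add: add[symmetric] V.a_assoc)
  next
    fix x assume "x \<in> carrier W"
    then obtain a where a: "a \<in> carrier V" "x = f a" using ex by metis
    then show "\<zero>\<^bsub>W\<^esub> \<oplus>\<^bsub>W\<^esub> x = x" using cV by (simp add: zero[symmetric] add[symmetric])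
    have "f (\<ominus>\<^bsub>V\<^esub> a) \<oplus>\<^bsub>W\<^esub> x = \<zero>\<^bsub>W\<^esub>" using a by (simp add: zero[symmetric] add[symmetric] V.l_neg)
    then show "\<exists>y\<in>carrier W. y \<oplus>\<^bsub>W\<^esub> x = \<zero>\<^bsub>W\<^esub>" using a surj by (metis V.a_inv_closed image_eqI)
  qed
  moreover have "module_axioms class_ring W"
  proof
    fix c :: 'k and x assume "c \<in> carrier class_ring" "x \<in> carrier W"
    then obtain a where "a \<in> carrier V" "x = f a" using ex by metis
    then show "c \<odot>\<^bsub>W\<^esub> x \<in> carrier W" using surj cV by (auto simp: smult[symmetric])
  next
    fix c d :: 'k and x assume "x \<in> carrier W"
    then obtain a where a: "a \<in> carrier V" "x = f a" using ex by metis
    show "(c \<oplus>\<^bsub>class_ring\<^esub> d) \<odot>\<^bsub>W\<^esub> x = c \<odot>\<^bsub>W\<^esub> x \<oplus>\<^bsub>W\<^esub> d \<odot>\<^bsub>W\<^esub> x"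
      using a cV V.smult_l_distr[of c d a] by (simp add: smult[symmetric] add[symmetric])
    show "(c \<otimes>\<^bsub>class_ring\<^esub> d) \<odot>\<^bsub>W\<^esub> x = c \<odot>\<^bsub>W\<^esub> (d \<odot>\<^bsub>W\<^esub> x)"
      using a cV V.smult_assoc1[of c d a] by (simp add: smult[symmetric])
    show "\<one>\<^bsub>class_ring\<^esub> \<odot>\<^bsub>W\<^esub> x = x"
      using a cV V.smult_one[of a] by (simp add: smult[symmetric])
  next
    fix c :: 'k and x y assume "x \<in> carrier W" "y \<in> carrier W"
    then obtain a b where a: "a \<in> carrier V" "b \<in> carrier V" "x = f a" "y = f b" using ex by metis
    then show "c \<odot>\<^bsub>W\<^esub> (x \<oplus>\<^bsub>W\<^esub> y) = c \<odot>\<^bsub>W\<^esub> x \<oplus>\<^bsub>W\<^esub> c \<odot>\<^bsub>W\<^esub> y"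
      using cV V.smult_r_distr[of c a b] by (simp add: smult[symmetric] add[symmetric])
  qed
  ultimately show ?thesis
    using class_field unfolding vectorspace_def Module.module_def by (simp add: field_def domain_def)
qed

lemma free_space_simps [simp]:
  "x \<in> carrier (free_space B) \<longleftrightarrow> supp x \<subseteq> B"
  "x \<oplus>\<^bsub>free_space B\<^esub> y = x + y" "\<zero>\<^bsub>free_space B\<^esub> = 0" "c \<odot>\<^bsub>free_space B\<^esub> x = scal c x"
  by (simp_all add: free_space_def)

lemma keys_subset_closed:
  fixes x y :: "'b \<Rightarrow>\<^sub>0 'k::field"
  assumes "supp x \<subseteq> B"
  shows "supp y \<subseteq> B \<Longrightarrow> supp (x + y) \<subseteq> B"
    "supp y \<subseteq> B \<Longrightarrow> supp (x - y) \<subseteq> B"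
    "supp (scal c x) \<subseteq> B"
  using assms Poly_Mapping.keys_add[of x y] keys_minus_subset[of x y] keys_scal[of c x] by blast+

lemma vectorspace_free_space: "vectorspace class_ring (free_space B :: ('k::field, 'b \<Rightarrow>\<^sub>0 'k) module)"
proof -
  have "field (class_ring :: 'k ring)" by (rule class_field)
  moreover have "abelian_group (free_space B :: ('k, _) module)"
  proof (rule abelian_groupI)
    fix x :: "'b \<Rightarrow>\<^sub>0 'k" assume "x \<in> carrier (free_space B)"
    then show "\<exists>y\<in>carrier (free_space B). y \<oplus>\<^bsub>free_space B\<^esub> x = \<zero>\<^bsub>free_space B\<^esub>"
      by (intro bexI[of _ "- x"]) auto
  qed (simp_all add: keys_subset_closed ac_simps)
  moreover have "module_axioms class_ring (free_space B :: ('k, _) module)"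
    by (rule module_axioms.intro) (simp_all add: keys_subset_closed scal_add_left)
  ultimately show ?thesis
    unfolding vectorspace_def Module.module_def by (simp add: field_def domain_def)
qed

lemma subspace_free_iff:
  "VectorSpace.subspace class_ring U (free_space B :: ('k::field, _) module) \<longleftrightarrow>
    (\<forall>x\<in>U. supp x \<subseteq> B) \<and> 0 \<in> U \<and> (\<forall>x\<in>U. \<forall>y\<in>U. x + y \<in> U) \<and> (\<forall>c. \<forall>x\<in>U. scal c x \<in> U)"
proof -
  have "module class_ring (free_space B :: ('k, _) module)"
    using vectorspace_free_space vectorspace_def by blast
  moreover have "U \<subseteq> carrier (free_space B :: ('k, _) module) \<longleftrightarrow> (\<forall>x\<in>U. supp x \<subseteq> B)"
    by (simp only: subset_eq[of U] free_space_simps)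
  ultimately show ?thesis
    by (simp add: VectorSpace.subspace_def submodule_def vectorspace_free_space) blast
qed

lemma subspaceD:
  assumes "VectorSpace.subspace class_ring U (free_space B :: ('k::field, _) module)"
  shows "\<And>x. x \<in> U \<Longrightarrow> supp x \<subseteq> B" "0 \<in> U" "\<And>x y. x \<in> U \<Longrightarrow> y \<in> U \<Longrightarrow> x + y \<in> U"
    "\<And>c x. x \<in> U \<Longrightarrow> scal c x \<in> U" "\<And>x. x \<in> U \<Longrightarrow> - x \<in> U" "\<And>x y. x \<in> U \<Longrightarrow> y \<in> U \<Longrightarrow> x - y \<in> U"
proof -
  note * = assms[unfolded subspace_free_iff]
  show "\<And>x. x \<in> U \<Longrightarrow> supp x \<subseteq> B" "0 \<in> U" and add: "\<And>x y. x \<in> U \<Longrightarrow> y \<in> U \<Longrightarrow> x + y \<in> U"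
    and scal: "\<And>c x. x \<in> U \<Longrightarrow> scal c x \<in> U"
    using * by auto
  show neg: "- x \<in> U" if "x \<in> U" for x using scal[of x "-1"] that by simp
  show "x - y \<in> U" if "x \<in> U" "y \<in> U" for x y using add[of x "- y"] neg that by simp
qed

lemma linear_map_free_iff:
  "linear_map class_ring (free_space B) (free_space C :: ('k::field, _) module) f \<longleftrightarrow>
    (\<forall>x. supp x \<subseteq> B \<longrightarrow> supp (f x) \<subseteq> C) \<and>
    (\<forall>x y. supp x \<subseteq> B \<longrightarrow> supp y \<subseteq> B \<longrightarrow> f (x + y) = f x + f y) \<and>
    (\<forall>c x. supp x \<subseteq> B \<longrightarrow> f (scal c x) = scal c (f x))"
  by (simp add: linear_map_iff vectorspace_free_space Ball_def)

lemma is_lin_linear_map: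
  assumes "is_lin f" "\<And>x. supp x \<subseteq> B \<Longrightarrow> supp (f x) \<subseteq> C"
  shows "linear_map class_ring (free_space B) (free_space C :: ('k::field, _) module) f"
  unfolding linear_map_free_iff using assms by (auto simp: is_lin_simps)

subsection \<open>Surjective morphisms\<close>

text \<open>The block of \<open>n\<close> inputs at \<open>i\<close> goes to the block at
  \<open>\<sigma> i\<close>; outside it the function is \<open>\<sigma>\<close> preceded by
  \<open>u\<close>, which closes the gap, and followed by \<open>sh\<close>, which opens
  one.\<close>

lemma perm_comp_permutes:
  assumes i: "1 \<le> i" "i \<le> m" and n: "n \<ge> 1" and s: "\<sigma> permutes {1..m}" and t: "\<tau> permutes {1..n}"
  shows "perm_comp n i \<sigma> \<tau> permutes {1..m + n - 1}"
proof -
  have sj: "\<sigma> j \<in> {1..m} \<longleftrightarrow> j \<in> {1..m}" for j using permutes_in_image[OF s] by blast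
  have tj: "\<tau> j \<in> {1..n} \<longleftrightarrow> j \<in> {1..n}" for j using permutes_in_image[OF t] by blast
  have sinj: "\<sigma> j = \<sigma> k \<longleftrightarrow> j = k" for j k using permutes_inj[OF s] by (auto simp: inj_def)
  have tinj: "\<tau> j = \<tau> k \<longleftrightarrow> j = k" for j k using permutes_inj[OF t] by (auto simp: inj_def)
  have sn: "\<sigma> j = j" if "j \<notin> {1..m}" for j using s that by (simp add: permutes_not_in)
  have si: "1 \<le> \<sigma> i" "\<sigma> i \<le> m" using sj[of i] i by auto
  define sh where "sh = (\<lambda>j. if j < \<sigma> i then j else j + n - 1)"
  define u where "u = (\<lambda>p. if p < i then p else p - n + 1)"
  have pc: "perm_comp n i \<sigma> \<tau> p = (if i \<le> p \<and> p < i + n then \<tau> (p - i + 1) + \<sigma> i - 1 else sh (\<sigma> (u p)))" for p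
    by (auto simp: perm_comp_def Let_def sh_def u_def)
  have shinj: "sh j = sh k \<longleftrightarrow> j = k" if "j \<noteq> \<sigma> i" "k \<noteq> \<sigma> i" for j k
    using that n by (auto simp: sh_def)
  have uinj: "u p = u q \<longleftrightarrow> p = q" if "\<not> (i \<le> p \<and> p < i + n)" "\<not> (i \<le> q \<and> q < i + n)" for p q
    using that n by (auto simp: u_def)
  have ui: "u p \<noteq> i" if "\<not> (i \<le> p \<and> p < i + n)" for p using that n by (auto simp: u_def)
  have block: "\<sigma> i \<le> \<tau> (p - i + 1) + \<sigma> i - 1 \<and> \<tau> (p - i + 1) + \<sigma> i - 1 < \<sigma> i + n"
    if "i \<le> p \<and> p < i + n" for p
    using tj[of "p - i + 1"] that by auto
  have shb: "\<not> (\<sigma> i \<le> sh j \<and> sh j < \<sigma> i + n)" if "j \<noteq> \<sigma> i" for j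
    using that n by (auto simp: sh_def)
  have inj: "inj (perm_comp n i \<sigma> \<tau>)"
  proof (rule injI)
    fix p q assume e: "perm_comp n i \<sigma> \<tau> p = perm_comp n i \<sigma> \<tau> q"
    show "p = q"
    proof (cases "i \<le> p \<and> p < i + n"; cases "i \<le> q \<and> q < i + n")
      assume pq: "i \<le> p \<and> p < i + n" "i \<le> q \<and> q < i + n"
      then have "\<tau> (p - i + 1) = \<tau> (q - i + 1)" using e block[of p] block[of q] si unfolding pc by auto
      then show ?thesis using pq by (auto simp: tinj)
    next
      assume "i \<le> p \<and> p < i + n" "\<not> (i \<le> q \<and> q < i + n)"
      then show ?thesis using e block[of p] shb[of "\<sigma> (u q)"] ui[of q] unfolding pc by (auto simp: sinj)
    next
      assume "\<not> (i \<le> p \<and> p < i + n)" "i \<le> q \<and> q < i + n"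
      then show ?thesis using e block[of q] shb[of "\<sigma> (u p)"] ui[of p] unfolding pc by (auto simp: sinj)
    next
      assume p: "\<not> (i \<le> p \<and> p < i + n)" and q: "\<not> (i \<le> q \<and> q < i + n)"
      have "sh (\<sigma> (u p)) = sh (\<sigma> (u q))" using e unfolding pc if_not_P[OF p] if_not_P[OF q] .
      then show ?thesis using shinj[of "\<sigma> (u p)" "\<sigma> (u q)"] ui[OF p] ui[OF q] uinj[OF p q]
        by (simp add: sinj)
    qed
  qed
  have out: "perm_comp n i \<sigma> \<tau> p = p" if "p \<notin> {1..m + n - 1}" for p
  proof -
    have u: "u p \<notin> {1..m}" and b: "\<not> (i \<le> p \<and> p < i + n)" using that i n by (auto simp: u_def)
    have "sh (u p) = p" using that i n si by (auto simp: u_def sh_def)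
    then show ?thesis unfolding pc if_not_P[OF b] sn[OF u] .
  qed
  \<comment> \<open>An injective function that fixes every point outside the interval cannot send a
    point of the interval outside.\<close>
  have maps: "perm_comp n i \<sigma> \<tau> p \<in> {1..m + n - 1}" if "p \<in> {1..m + n - 1}" for p
  proof (rule ccontr)
    assume "perm_comp n i \<sigma> \<tau> p \<notin> {1..m + n - 1}"
    then have "perm_comp n i \<sigma> \<tau> (perm_comp n i \<sigma> \<tau> p) = perm_comp n i \<sigma> \<tau> p" by (rule out)
    then show False using injD[OF inj] that \<open>perm_comp n i \<sigma> \<tau> p \<notin> {1..m + n - 1}\<close> by metis
  qed
  have "perm_comp n i \<sigma> \<tau> ` {1..m + n - 1} = {1..m + n - 1}"
    using maps inj by (intro endo_inj_surj) (auto intro: inj_on_subset)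
  then have "bij_betw (perm_comp n i \<sigma> \<tau>) {1..m + n - 1} {1..m + n - 1}"
    using inj by (auto simp: bij_betw_def intro: inj_on_subset)
  then show ?thesis using out by (intro bij_imp_permutes) auto
qed

locale operad_epi =
  fixes P :: "('k::field, 'v) operad" and Q :: "('k, 'w) operad" and f :: "nat \<Rightarrow> 'v \<Rightarrow> 'w"
  assumes operad: "symmetric_operad P"
    and lin: "\<And>n. n \<ge> 1 \<Longrightarrow> linear_map class_ring (opspace P n) (opspace Q n) (f n)"
    and surj: "\<And>n. n \<ge> 1 \<Longrightarrow> f n ` opcarrier P n = opcarrier Q n"
    and unit: "f 1 (opunit P) = opunit Q"
    and comp: "\<And>m n i a b. \<lbrakk>1 \<le> i; i \<le> m; n \<ge> 1; a \<in> opcarrier P m; b \<in> opcarrier P n\<rbrakk> \<Longrightarrow>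
      f (m + n - 1) (opcomp P m n i a b) = opcomp Q m n i (f m a) (f n b)"
    and act: "\<And>n \<sigma> a. \<lbrakk>n \<ge> 1; \<sigma> permutes {1..n}; a \<in> opcarrier P n\<rbrakk> \<Longrightarrow>
      f n (opact P n \<sigma> a) = opact Q n \<sigma> (f n a)"
begin

interpretation P: symmetric_operad P by (rule operad)

lemma closed:
  "\<lbrakk>1 \<le> i; i \<le> m; n \<ge> 1; a \<in> opcarrier P m; b \<in> opcarrier P n\<rbrakk> \<Longrightarrow> opcomp P m n i a b \<in> opcarrier P (m + n - 1)"
  "\<lbrakk>n \<ge> 1; \<sigma> permutes {1..n}; a \<in> opcarrier P n\<rbrakk> \<Longrightarrow> opact P n \<sigma> a \<in> opcarrier P n"
  using P.comp_linear_right[of i m n a] P.act_linear[of n \<sigma>] by (auto simp: linear_map_iff)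

lemma f_lin:
  "n \<ge> 1 \<Longrightarrow> a \<in> opcarrier P n \<Longrightarrow> f n a \<in> opcarrier Q n"
  "n \<ge> 1 \<Longrightarrow> a \<in> opcarrier P n \<Longrightarrow> b \<in> opcarrier P n \<Longrightarrow> f n (a \<oplus>\<^bsub>opspace P n\<^esub> b) = f n a \<oplus>\<^bsub>opspace Q n\<^esub> f n b"
  "n \<ge> 1 \<Longrightarrow> a \<in> opcarrier P n \<Longrightarrow> f n (c \<odot>\<^bsub>opspace P n\<^esub> a) = c \<odot>\<^bsub>opspace Q n\<^esub> f n a"
  using lin[of n] by (auto simp: linear_map_iff)

lemma P_lin:
  "\<lbrakk>1 \<le> i; i \<le> m; n \<ge> 1; a \<in> opcarrier P m; b \<in> opcarrier P n; b' \<in> opcarrier P n\<rbrakk> \<Longrightarrow>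
    opcomp P m n i a (b \<oplus>\<^bsub>opspace P n\<^esub> b') = opcomp P m n i a b \<oplus>\<^bsub>opspace P (m + n - 1)\<^esub> opcomp P m n i a b'"
  "\<lbrakk>1 \<le> i; i \<le> m; n \<ge> 1; a \<in> opcarrier P m; b \<in> opcarrier P n\<rbrakk> \<Longrightarrow>
    opcomp P m n i a (c \<odot>\<^bsub>opspace P n\<^esub> b) = c \<odot>\<^bsub>opspace P (m + n - 1)\<^esub> opcomp P m n i a b"
  "\<lbrakk>1 \<le> i; i \<le> m; n \<ge> 1; b \<in> opcarrier P n; a \<in> opcarrier P m; a' \<in> opcarrier P m\<rbrakk> \<Longrightarrow>
    opcomp P m n i (a \<oplus>\<^bsub>opspace P m\<^esub> a') b = opcomp P m n i a b \<oplus>\<^bsub>opspace P (m + n - 1)\<^esub> opcomp P m n i a' b"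
  "\<lbrakk>1 \<le> i; i \<le> m; n \<ge> 1; b \<in> opcarrier P n; a \<in> opcarrier P m\<rbrakk> \<Longrightarrow>
    opcomp P m n i (c \<odot>\<^bsub>opspace P m\<^esub> a) b = c \<odot>\<^bsub>opspace P (m + n - 1)\<^esub> opcomp P m n i a b"
  "\<lbrakk>n \<ge> 1; \<sigma> permutes {1..n}; b \<in> opcarrier P n; b' \<in> opcarrier P n\<rbrakk> \<Longrightarrow>
    opact P n \<sigma> (b \<oplus>\<^bsub>opspace P n\<^esub> b') = opact P n \<sigma> b \<oplus>\<^bsub>opspace P n\<^esub> opact P n \<sigma> b'"
  "\<lbrakk>n \<ge> 1; \<sigma> permutes {1..n}; b \<in> opcarrier P n\<rbrakk> \<Longrightarrow>
    opact P n \<sigma> (c \<odot>\<^bsub>opspace P n\<^esub> b) = c \<odot>\<^bsub>opspace P n\<^esub> opact P n \<sigma> b"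
  using P.comp_linear_right[of i m n a] P.comp_linear_left[of i m n b] P.act_linear[of n \<sigma>]
  by (auto simp: linear_map_iff)

lemma P_vs: "n \<ge> 1 \<Longrightarrow> a \<in> opcarrier P n \<Longrightarrow> b \<in> opcarrier P n \<Longrightarrow> a \<oplus>\<^bsub>opspace P n\<^esub> b \<in> opcarrier P n"
  "n \<ge> 1 \<Longrightarrow> a \<in> opcarrier P n \<Longrightarrow> c \<odot>\<^bsub>opspace P n\<^esub> a \<in> opcarrier P n"
proof -
  assume "n \<ge> 1"
  then interpret vectorspace class_ring "opspace P n" by (rule P.space)
  show "a \<in> opcarrier P n \<Longrightarrow> b \<in> opcarrier P n \<Longrightarrow> a \<oplus>\<^bsub>opspace P n\<^esub> b \<in> opcarrier P n" by simp
  show "a \<in> opcarrier P n \<Longrightarrow> c \<odot>\<^bsub>opspace P n\<^esub> a \<in> opcarrier P n" using smult_closed by simp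
qed

lemma pre: "n \<ge> 1 \<Longrightarrow> b \<in> opcarrier Q n \<Longrightarrow> \<exists>a\<in>opcarrier P n. b = f n a"
  using surj[of n] by auto

lemma Q_closed:
  assumes "1 \<le> i" "i \<le> m" "n \<ge> 1" "a \<in> opcarrier Q m" "b \<in> opcarrier Q n"
  shows "opcomp Q m n i a b \<in> opcarrier Q (m + n - 1)"
proof -
  obtain x y where "x \<in> opcarrier P m" "y \<in> opcarrier P n" "a = f m x" "b = f n y"
    using pre assms by (metis le_trans)
  then show ?thesis using assms comp[of i m n x y] f_lin(1)[OF _ closed(1)[of i m n x y]] by simp
qed

text \<open>Surjectivity lifts the elements in each axiom to \<open>P\<close>, where the axiom
  holds. This is how \<open>LW\<close> and the two quotients become operads.\<close>

theorem image_operad: "symmetric_operad Q"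
  supply One_nat_def [simp del]
proof (rule symmetric_operad.intro)
  fix n :: nat assume "n \<ge> 1"
  then show "vectorspace class_ring (opspace Q n)" using lin by (simp add: linear_map_iff)
next
  show "opunit Q \<in> opcarrier Q 1" using f_lin(1)[OF _ P.unit_closed] unit by simp
next
  fix i m n :: nat and a assume i: "1 \<le> i" "i \<le> m" and n: "1 \<le> n" and "a \<in> opcarrier Q m"
  then obtain x where x: "x \<in> opcarrier P m" "a = f m x" using pre by (metis le_trans)
  have mn: "m + n - 1 \<ge> 1" "m \<ge> 1" using i n by auto
  show "linear_map class_ring (opspace Q n) (opspace Q (m + n - 1)) (opcomp Q m n i a)"
    unfolding linear_map_iff
  proof (intro conjI ballI allI)
    show "vectorspace class_ring (opspace Q n)" "vectorspace class_ring (opspace Q (m + n - 1))"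
      using lin mn n by (auto simp: linear_map_iff)
    fix b assume b: "b \<in> opcarrier Q n"
    then show "opcomp Q m n i a b \<in> opcarrier Q (m + n - 1)"
      using i n \<open>a \<in> opcarrier Q m\<close> by (intro Q_closed)
    obtain y where y: "y \<in> opcarrier P n" "b = f n y" using pre n b by metis
    show "opcomp Q m n i a (c \<odot>\<^bsub>opspace Q n\<^esub> b) = c \<odot>\<^bsub>opspace Q (m + n - 1)\<^esub> opcomp Q m n i a b" for c
      using i n x y mn by (simp add: f_lin(3)[symmetric] comp[symmetric] P_vs P_lin closed)
    fix b' assume "b' \<in> opcarrier Q n"
    then obtain y' where y': "y' \<in> opcarrier P n" "b' = f n y'" using pre n by metis
    show "opcomp Q m n i a (b \<oplus>\<^bsub>opspace Q n\<^esub> b') =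
        opcomp Q m n i a b \<oplus>\<^bsub>opspace Q (m + n - 1)\<^esub> opcomp Q m n i a b'"
      using i n x y y' mn by (simp add: f_lin(2)[symmetric] comp[symmetric] P_vs P_lin closed)
  qed
next
  fix i m n :: nat and b assume i: "1 \<le> i" "i \<le> m" and n: "1 \<le> n" and bQ: "b \<in> opcarrier Q n"
  then obtain y where y: "y \<in> opcarrier P n" "b = f n y" using pre by metis
  have mn: "m + n - 1 \<ge> 1" "m \<ge> 1" using i n by auto
  show "linear_map class_ring (opspace Q m) (opspace Q (m + n - 1)) (\<lambda>a. opcomp Q m n i a b)"
    unfolding linear_map_iff
  proof (intro conjI ballI allI)
    show "vectorspace class_ring (opspace Q m)" "vectorspace class_ring (opspace Q (m + n - 1))"
      using lin mn n by (auto simp: linear_map_iff)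
    fix a assume a: "a \<in> opcarrier Q m"
    then show "opcomp Q m n i a b \<in> opcarrier Q (m + n - 1)"
      using i n bQ by (intro Q_closed)
    obtain x where x: "x \<in> opcarrier P m" "a = f m x" using pre mn a by metis
    show "opcomp Q m n i (c \<odot>\<^bsub>opspace Q m\<^esub> a) b = c \<odot>\<^bsub>opspace Q (m + n - 1)\<^esub> opcomp Q m n i a b" for c
      using i n x y mn by (simp add: f_lin(3)[symmetric] comp[symmetric] P_vs P_lin closed)
    fix a' assume "a' \<in> opcarrier Q m"
    then obtain x' where x': "x' \<in> opcarrier P m" "a' = f m x'" using pre mn by metis
    show "opcomp Q m n i (a \<oplus>\<^bsub>opspace Q m\<^esub> a') b =
        opcomp Q m n i a b \<oplus>\<^bsub>opspace Q (m + n - 1)\<^esub> opcomp Q m n i a' b"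
      using i n x y x' mn by (simp add: f_lin(2)[symmetric] comp[symmetric] P_vs P_lin closed)
  qed
next
  fix n :: nat and \<sigma> assume n: "1 \<le> (n::nat)" and s: "\<sigma> permutes {1..n}"
  show "linear_map class_ring (opspace Q n) (opspace Q n) (opact Q n \<sigma>)"
    unfolding linear_map_iff
  proof (intro conjI ballI allI)
    show "vectorspace class_ring (opspace Q n)"
      using lin n by (auto simp: linear_map_iff)
    fix a assume a: "a \<in> opcarrier Q n"
    then obtain x where x: "x \<in> opcarrier P n" "a = f n x" using pre n by metis
    show "opact Q n \<sigma> a \<in> opcarrier Q n"
      using x n s by (simp add: act[symmetric] f_lin closed)
    show "opact Q n \<sigma> (c \<odot>\<^bsub>opspace Q n\<^esub> a) = c \<odot>\<^bsub>opspace Q n\<^esub> opact Q n \<sigma> a" for c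
      using n s x by (simp add: f_lin(3)[symmetric] act[symmetric] P_vs P_lin closed)
    fix a' assume "a' \<in> opcarrier Q n"
    then obtain x' where x': "x' \<in> opcarrier P n" "a' = f n x'" using pre n by metis
    show "opact Q n \<sigma> (a \<oplus>\<^bsub>opspace Q n\<^esub> a') = opact Q n \<sigma> a \<oplus>\<^bsub>opspace Q n\<^esub> opact Q n \<sigma> a'"
      using n s x x' by (simp add: f_lin(2)[symmetric] act[symmetric] P_vs P_lin closed)
  qed (use lin n in \<open>simp add: linear_map_iff\<close>)
next
  fix n :: nat and a assume n: "1 \<le> (n::nat)" and "a \<in> opcarrier Q n"
  then obtain x where x: "x \<in> opcarrier P n" "a = f n x" using pre by metis
  show "opact Q n id a = a" using n x act[of n id x] by (simp add: P.act_id permutes_id)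
  show "opcomp Q 1 n 1 (opunit Q) a = a"
    using n x comp[of 1 1 n "opunit P" x] by (simp add: P.unit_closed P.unit_left unit)
next
  fix n :: nat and \<sigma> \<tau> a assume n: "1 \<le> (n::nat)" and p: "\<sigma> permutes {1..n}" "\<tau> permutes {1..n}" and "a \<in> opcarrier Q n"
  then obtain x where x: "x \<in> opcarrier P n" "a = f n x" using pre by metis
  have "\<sigma> \<circ> \<tau> permutes {1..n}" using p by (simp add: permutes_compose)
  then show "opact Q n (\<sigma> \<circ> \<tau>) a = opact Q n \<sigma> (opact Q n \<tau> a)"
    using n p x by (simp add: act[symmetric] closed P.act_comp)
next
  fix i n :: nat and a assume i: "1 \<le> (i::nat)" "i \<le> n" and "a \<in> opcarrier Q n"
  then obtain x where x: "x \<in> opcarrier P n" "a = f n x" using pre by (metis le_trans)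
  show "opcomp Q n 1 i a (opunit Q) = a"
    using i x comp[of i n 1 x "opunit P"]
    by (simp add: P.unit_closed P.unit_right unit)
next
  fix i m j n q :: nat and a b c
  assume i: "1 \<le> i" "i \<le> m" and j: "1 \<le> j" "j \<le> n" and q: "1 \<le> q"
    and "a \<in> opcarrier Q m" "b \<in> opcarrier Q n" "c \<in> opcarrier Q q"
  then obtain x y z where x: "x \<in> opcarrier P m" "a = f m x" and y: "y \<in> opcarrier P n" "b = f n y"
    and z: "z \<in> opcarrier P q" "c = f q z"
    using pre[of m a] pre[of n b] pre[of q c] by force
  have 1: "f (m + n - 1 + q - 1) (opcomp P (m + n - 1) q (i + j - 1) (opcomp P m n i x y) z) =
      opcomp Q (m + n - 1) q (i + j - 1) (f (m + n - 1) (opcomp P m n i x y)) (f q z)"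
    using i j q x y z by (intro comp closed) auto
  have 2: "f (m + n - 1) (opcomp P m n i x y) = opcomp Q m n i (f m x) (f n y)"
    using i j x y by (intro comp) auto
  have 3: "f (m + (n + q - 1) - 1) (opcomp P m (n + q - 1) i x (opcomp P n q j y z)) =
      opcomp Q m (n + q - 1) i (f m x) (f (n + q - 1) (opcomp P n q j y z))"
    using i j q x y z by (intro comp closed) auto
  have 4: "f (n + q - 1) (opcomp P n q j y z) = opcomp Q n q j (f n y) (f q z)"
    using j q y z by (intro comp) auto
  have 5: "m + n - 1 + q - 1 = m + (n + q - 1) - 1" using i j q by linarith
  show "opcomp Q (m + n - 1) q (i + j - 1) (opcomp Q m n i a b) c =
      opcomp Q m (n + q - 1) i a (opcomp Q n q j b c)"
    using P.assoc_sequential[OF i j q x(1) y(1) z(1)] 1 3 unfolding 2 4 5 x(2) y(2) z(2) by simp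
next
  fix i k m n q :: nat and a b c
  assume i: "1 \<le> i" "i < k" "k \<le> m" and n: "1 \<le> n" and q: "1 \<le> q"
    and "a \<in> opcarrier Q m" "b \<in> opcarrier Q n" "c \<in> opcarrier Q q"
  then obtain x y z where x: "x \<in> opcarrier P m" "a = f m x" and y: "y \<in> opcarrier P n" "b = f n y"
    and z: "z \<in> opcarrier P q" "c = f q z"
    using pre[of m a] pre[of n b] pre[of q c] by force
  have 1: "f (m + n - 1 + q - 1) (opcomp P (m + n - 1) q (k + n - 1) (opcomp P m n i x y) z) =
      opcomp Q (m + n - 1) q (k + n - 1) (f (m + n - 1) (opcomp P m n i x y)) (f q z)"
    using i n q x y z by (intro comp closed) auto
  have 2: "f (m + n - 1) (opcomp P m n i x y) = opcomp Q m n i (f m x) (f n y)"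
    using i n x y by (intro comp) auto
  have 3: "f (m + q - 1 + n - 1) (opcomp P (m + q - 1) n i (opcomp P m q k x z) y) =
      opcomp Q (m + q - 1) n i (f (m + q - 1) (opcomp P m q k x z)) (f n y)"
    using i n q x y z by (intro comp closed) auto
  have 4: "f (m + q - 1) (opcomp P m q k x z) = opcomp Q m q k (f m x) (f q z)"
    using i q x z by (intro comp) auto
  have 5: "m + n - 1 + q - 1 = m + q - 1 + n - 1" using i n q by linarith
  show "opcomp Q (m + n - 1) q (k + n - 1) (opcomp Q m n i a b) c =
      opcomp Q (m + q - 1) n i (opcomp Q m q k a c) b"
    using P.assoc_parallel[OF i n q x(1) y(1) z(1)] 1 3 unfolding 2 4 5 x(2) y(2) z(2) by simp
next
  fix i m n :: nat and \<sigma> \<tau> a b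
  assume i: "1 \<le> i" "i \<le> m" and n: "1 \<le> n" and s: "\<sigma> permutes {1..m}" and t: "\<tau> permutes {1..n}"
    and "a \<in> opcarrier Q m" "b \<in> opcarrier Q n"
  then obtain x y where x: "x \<in> opcarrier P m" "a = f m x" and y: "y \<in> opcarrier P n" "b = f n y"
    using pre by (metis le_trans)
  have m: "1 \<le> m" and mn: "1 \<le> m + n - 1" using i n by auto
  have si: "1 \<le> \<sigma> i" "\<sigma> i \<le> m" using permutes_in_image[OF s, of i] i by auto
  have "opcomp Q m n (\<sigma> i) (opact Q m \<sigma> a) (opact Q n \<tau> b) =
      f (m + n - 1) (opcomp P m n (\<sigma> i) (opact P m \<sigma> x) (opact P n \<tau> y))"
    using si m n x y s t by (simp add: comp closed act)
  also have "\<dots> = f (m + n - 1) (opact P (m + n - 1) (perm_comp n i \<sigma> \<tau>) (opcomp P m n i x y))"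
    using P.equivariant[OF i n s t x(1) y(1)] by simp
  also have "\<dots> = opact Q (m + n - 1) (perm_comp n i \<sigma> \<tau>) (opcomp Q m n i a b)"
    using i n x y perm_comp_permutes[OF i n s t] mn by (simp add: comp closed act)
  finally show "opcomp Q m n (\<sigma> i) (opact Q m \<sigma> a) (opact Q n \<tau> b) =
      opact Q (m + n - 1) (perm_comp n i \<sigma> \<tau>) (opcomp Q m n i a b)" .
qed

end

text \<open>The map sends \<open>g n x\<close> to \<open>h n x\<close>; equality of the fibres makes
  it well defined and injective, and it inherits all compatibilities from \<open>g\<close> and
  \<open>h\<close>.\<close>

lemma operad_epi_isomorphic:
  assumes g: "operad_epi P A g" and h: "operad_epi P B h"
    and ker: "\<And>n x y. n \<ge> 1 \<Longrightarrow> x \<in> opcarrier P n \<Longrightarrow> y \<in> opcarrier P n \<Longrightarrow> g n x = g n y \<longleftrightarrow> h n x = h n y"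
  shows "operad_isomorphic A B"
proof -
  interpret g: operad_epi P A g by (rule g)
  interpret h: operad_epi P B h by (rule h)
  define f where "f n c = h n (SOME x. x \<in> opcarrier P n \<and> g n x = c)" for n c
  have f: "f n (g n x) = h n x" if "n \<ge> 1" "x \<in> opcarrier P n" for n x
  proof -
    have "\<exists>y. y \<in> opcarrier P n \<and> g n y = g n x" using that by blast
    from someI_ex[OF this] show ?thesis unfolding f_def using ker[OF that(1) _ that(2)] by blast
  qed
  have lin: "linear_map class_ring (opspace A n) (opspace B n) (f n)" if n: "n \<ge> 1" for n
    unfolding linear_map_iff
  proof (intro conjI ballI allI)
    show "vectorspace class_ring (opspace A n)" "vectorspace class_ring (opspace B n)"
      using g.lin[OF n] h.lin[OF n] by (simp_all add: linear_map_iff)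
    fix a assume "a \<in> opcarrier A n"
    then obtain x where x: "x \<in> opcarrier P n" "a = g n x" using g.pre[OF n] by blast
    show "f n a \<in> opcarrier B n" using x n by (simp add: f h.f_lin)
    show "f n (c \<odot>\<^bsub>opspace A n\<^esub> a) = c \<odot>\<^bsub>opspace B n\<^esub> f n a" for c
      using x n by (simp add: f g.f_lin(3)[symmetric] h.f_lin(3)[symmetric] g.P_vs)
    fix b assume "b \<in> opcarrier A n"
    then obtain y where y: "y \<in> opcarrier P n" "b = g n y" using g.pre[OF n] by blast
    show "f n (a \<oplus>\<^bsub>opspace A n\<^esub> b) = f n a \<oplus>\<^bsub>opspace B n\<^esub> f n b"
      using x y n by (simp add: f g.f_lin(2)[symmetric] h.f_lin(2)[symmetric] g.P_vs)
  qed
  have bij: "bij_betw (f n) (opcarrier A n) (opcarrier B n)" if n: "n \<ge> 1" for n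
  proof (rule bij_betw_imageI)
    show "inj_on (f n) (opcarrier A n)"
    proof (rule inj_onI)
      fix a b assume "a \<in> opcarrier A n" "b \<in> opcarrier A n" "f n a = f n b"
      then obtain x y where "x \<in> opcarrier P n" "a = g n x" "y \<in> opcarrier P n" "b = g n y"
        using g.pre[OF n] by metis
      then show "a = b" using \<open>f n a = f n b\<close> f[OF n] ker[OF n] by metis
    qed
    have "f n ` g n ` opcarrier P n = h n ` opcarrier P n"
      unfolding image_image using f[OF n] by (intro image_cong) auto
    then show "f n ` opcarrier A n = opcarrier B n" using g.surj[OF n] h.surj[OF n] by simp
  qed
  have "operad_iso A B f"
    unfolding operad_iso_def
  proof (intro conjI allI ballI impI)
    show "f 1 (opunit A) = opunit B"
      using f[of 1 "opunit P"] symmetric_operad.unit_closed[OF g.operad] g.unit h.unit by simp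
  next
    fix m n i a b assume a: "a \<in> opcarrier A m" and b: "b \<in> opcarrier A n" and i: "1 \<le> i \<and> i \<le> m \<and> n \<ge> 1"
    then obtain x y where x: "x \<in> opcarrier P m" "a = g m x" and y: "y \<in> opcarrier P n" "b = g n y"
      using g.pre[of m a] g.pre[of n b] by force
    have "f (m + n - 1) (opcomp A m n i a b) = f (m + n - 1) (g (m + n - 1) (opcomp P m n i x y))"
      using i x y g.comp by simp
    also have "\<dots> = h (m + n - 1) (opcomp P m n i x y)"
      using i x y g.closed(1) by (intro f) auto
    also have "\<dots> = opcomp B m n i (h m x) (h n y)"
      using i x y by (intro h.comp) auto
    also have "\<dots> = opcomp B m n i (f m a) (f n b)"
      using i x y by (simp add: f)
    finally show "f (m + n - 1) (opcomp A m n i a b) = opcomp B m n i (f m a) (f n b)" .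
  next
    fix n \<sigma> a assume a: "a \<in> opcarrier A n" and n: "n \<ge> 1 \<and> \<sigma> permutes {1..n}"
    then obtain x where x: "x \<in> opcarrier P n" "a = g n x" using g.pre[of n a] by blast
    then show "f n (opact A n \<sigma> a) = opact B n \<sigma> (f n a)"
      using n f[of n "opact P n \<sigma> x"] g.closed(2)[of n \<sigma> x] by (simp add: f g.act[symmetric] h.act[symmetric])
  qed (use lin bij in auto)
  then show ?thesis
    unfolding operad_isomorphic_def using g.image_operad h.image_operad by blast
qed

lemma operad_epi_comp:
  assumes g: "operad_epi P A g" and h: "operad_epi A B h"
  shows "operad_epi P B (\<lambda>n x. h n (g n x))"
proof -
  interpret g: operad_epi P A g by (rule g)
  interpret h: operad_epi A B h by (rule h)
  show ?thesis
  proof (rule operad_epi.intro)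
    show "symmetric_operad P" by (rule g.operad)
  next
    fix n :: nat assume n: "n \<ge> 1"
    show "linear_map class_ring (opspace P n) (opspace B n) (\<lambda>x. h n (g n x))"
      using g.lin[OF n] h.lin[OF n] by (simp add: linear_map_iff)
    have "(\<lambda>x. h n (g n x)) ` opcarrier P n = h n ` g n ` opcarrier P n" by (simp add: image_image)
    then show "(\<lambda>x. h n (g n x)) ` opcarrier P n = opcarrier B n" using g.surj[OF n] h.surj[OF n] by simp
  qed (simp_all add: g.unit h.unit g.comp h.comp g.act h.act g.f_lin
      del: One_nat_def)
qed

subsection \<open>Quotients\<close>

lemma coset_free: "U +>\<^bsub>free_space B\<^esub> a = (\<lambda>u. u + a) ` U"
  by (auto simp: a_r_coset_def')

lemma coset_eq_iff:
  assumes "VectorSpace.subspace class_ring U (free_space B :: ('k::field, 'b \<Rightarrow>\<^sub>0 'k) module)"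
  shows "U +>\<^bsub>free_space B\<^esub> a = U +>\<^bsub>free_space B\<^esub> b \<longleftrightarrow> a - b \<in> U"
proof
  note U = subspaceD[OF assms]
  {
    assume "U +>\<^bsub>free_space B\<^esub> a = U +>\<^bsub>free_space B\<^esub> b"
    moreover have "a \<in> U +>\<^bsub>free_space B\<^esub> a"
      unfolding coset_free using U(2) by (intro image_eqI[of _ _ 0]) auto
    ultimately obtain u where "u \<in> U" "a = u + b" by (auto simp: coset_free)
    then show "a - b \<in> U" by simp
  }
  assume ab: "a - b \<in> U"
  have "u + a \<in> (\<lambda>u. u + b) ` U" if "u \<in> U" for u
    using U(3)[OF that ab] by (intro image_eqI[of _ _ "u + (a - b)"]) auto
  moreover have "u + b \<in> (\<lambda>u. u + a) ` U" if "u \<in> U" for u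
    using U(6)[OF that ab] by (intro image_eqI[of _ _ "u - (a - b)"]) auto
  ultimately show "U +>\<^bsub>free_space B\<^esub> a = U +>\<^bsub>free_space B\<^esub> b"
    unfolding coset_free by blast
qed

text \<open>The operations of \<open>quotient_operad\<close> are unions over all representatives. If
  changing the representative moves the value by an element of \<open>W\<close>, all the cosets
  united are equal.\<close>

lemma UN_coset:
  assumes U: "VectorSpace.subspace class_ring U (free_space B :: ('k::field, 'b \<Rightarrow>\<^sub>0 'k) module)"
    and W: "VectorSpace.subspace class_ring W (free_space C :: ('k, 'c \<Rightarrow>\<^sub>0 'k) module)"
    and f: "\<And>u. u \<in> U \<Longrightarrow> f (u + a) - f a \<in> W"
  shows "(\<Union>x\<in>U +>\<^bsub>free_space B\<^esub> a. W +>\<^bsub>free_space C\<^esub> f x) = W +>\<^bsub>free_space C\<^esub> f a"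
proof -
  have "W +>\<^bsub>free_space C\<^esub> f (u + a) = W +>\<^bsub>free_space C\<^esub> f a" if "u \<in> U" for u
    using f[OF that] by (simp add: coset_eq_iff[OF W])
  moreover have "U \<noteq> {}" using subspaceD(2)[OF U] by blast
  moreover have "U +>\<^bsub>free_space B\<^esub> a = (\<lambda>u. u + a) ` U" by (rule coset_free)
  ultimately show ?thesis by auto
qed

lemma quotient_space_linear:
  assumes U: "VectorSpace.subspace class_ring U (free_space B :: ('k::field, 'b \<Rightarrow>\<^sub>0 'k) module)"
  shows "linear_map class_ring (free_space B) (quotient_space (free_space B) U) (\<lambda>a. U +>\<^bsub>free_space B\<^esub> a)"
    and "(\<lambda>a. U +>\<^bsub>free_space B\<^esub> a) ` carrier (free_space B) = carrier (quotient_space (free_space B) U)"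
proof -
  let ?Q = "quotient_space (free_space B) U" and ?f = "\<lambda>a. U +>\<^bsub>free_space B\<^esub> a"
  note U' = subspaceD[OF U]
  show surj: "?f ` carrier (free_space B) = carrier ?Q"
    by (auto simp: quotient_space_def A_RCOSETS_def')
  have add: "?f (x + y) = ?f x \<oplus>\<^bsub>?Q\<^esub> ?f y" for x y
  proof -
    have "?f x \<oplus>\<^bsub>?Q\<^esub> ?f y = (\<Union>u\<in>U. \<Union>v\<in>U. {(u + x) + (v + y)})"
      by (simp add: quotient_space_def set_add_def' coset_free)
    also have "\<dots> = (\<lambda>u. u + (x + y)) ` U"
    proof (intro equalityI subsetI)
      fix z assume "z \<in> (\<Union>u\<in>U. \<Union>v\<in>U. {(u + x) + (v + y)})"
      then obtain u v where "u \<in> U" "v \<in> U" "z = (u + v) + (x + y)" by (auto simp: algebra_simps)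
      then show "z \<in> (\<lambda>u. u + (x + y)) ` U" using U'(3) by blast
    next
      fix z assume "z \<in> (\<lambda>u. u + (x + y)) ` U"
      then obtain u where "u \<in> U" "z = (u + x) + (0 + y)" by (auto simp: algebra_simps)
      then show "z \<in> (\<Union>u\<in>U. \<Union>v\<in>U. {(u + x) + (v + y)})" using U'(2) by blast
    qed
    finally show ?thesis by (simp add: coset_free)
  qed
  have smult: "?f (scal c x) = c \<odot>\<^bsub>?Q\<^esub> ?f x" for c x
    using UN_coset[OF U U, of "scal c" x] U'(4) by (simp add: quotient_space_def)
  have zero: "?f 0 = \<zero>\<^bsub>?Q\<^esub>" by (simp add: quotient_space_def coset_free)
  have "vectorspace class_ring ?Q"
    by (rule vectorspace_surj_image[OF vectorspace_free_space surj]) (simp_all add: add smult zero)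
  then show "linear_map class_ring (free_space B) ?Q ?f"
    unfolding linear_map_iff using surj by (auto simp: vectorspace_free_space add smult)
qed

lemma is_lin_on_free:
  assumes "linear_map class_ring (free_space B) (free_space C :: ('k::field, 'c \<Rightarrow>\<^sub>0 'k) module) f"
    "supp x \<subseteq> B" "supp y \<subseteq> B"
  shows "f (x + y) = f x + f y" "f (x - y) = f x - f y"
proof -
  have "supp (x - y) \<subseteq> B" by (rule keys_subset_closed(2)[OF assms(2,3)])
  then have "f ((x - y) + y) = f (x - y) + f y" using assms by (simp only: linear_map_free_iff)
  then show "f (x - y) = f x - f y" by simp
  show "f (x + y) = f x + f y" using assms by (simp add: linear_map_free_iff)
qed

lemma quotient_epi:
  fixes P :: "('k::field, 'b \<Rightarrow>\<^sub>0 'k) operad"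
  assumes P: "symmetric_operad P" and sp: "\<And>n. opspace P n = free_space (B n)" and I: "operad_ideal P I"
  shows "operad_epi P (quotient_operad P I) (\<lambda>n a. I n +>\<^bsub>opspace P n\<^esub> a)"
proof -
  interpret P: symmetric_operad P by (rule P)
  have sub: "VectorSpace.subspace class_ring (I n) (free_space (B n))" if "n \<ge> 1" for n
    using I that by (simp add: operad_ideal_def sp[symmetric])
  show ?thesis
  proof (rule operad_epi.intro)
    show "symmetric_operad P" by (rule P)
  next
    fix n :: nat assume n: "n \<ge> 1"
    show "linear_map class_ring (opspace P n) (opspace (quotient_operad P I) n) ((+>\<^bsub>opspace P n\<^esub>) (I n))"
      using quotient_space_linear(1)[OF sub[OF n]] by (simp add: quotient_operad_def sp)
    show "(+>\<^bsub>opspace P n\<^esub>) (I n) ` opcarrier P n = opcarrier (quotient_operad P I) n"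
      using quotient_space_linear(2)[OF sub[OF n]] by (simp add: quotient_operad_def sp)
  next
    show "I 1 +>\<^bsub>opspace P 1\<^esub> opunit P = opunit (quotient_operad P I)"
      by (simp add: quotient_operad_def)
  next
    fix m n i a b
    assume i: "1 \<le> i" "i \<le> m" and n: "(n::nat) \<ge> 1" and a: "a \<in> opcarrier P m" and b: "b \<in> opcarrier P n"
    have m: "m \<ge> 1" and mn: "m + n - 1 \<ge> 1" using i n by auto
    let ?W = "\<lambda>x. I (m + n - 1) +>\<^bsub>free_space (B (m + n - 1))\<^esub> x"
    note Im = sub[OF m] and In = sub[OF n] and Imn = sub[OF mn]
    have left: "opcomp P m n i (u + a) y - opcomp P m n i a y \<in> I (m + n - 1)"
      if "u \<in> I m" "y \<in> opcarrier P n" for u y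
    proof -
      have "opcomp P m n i (u + a) y = opcomp P m n i u y + opcomp P m n i a y"
        using P.comp_linear_left[OF i n that(2)] subspaceD(1)[OF Im that(1)] a
        by (intro is_lin_on_free(1)[where f = "\<lambda>a. opcomp P m n i a y"]) (simp_all add: sp)
      then show ?thesis using I that i n by (simp add: operad_ideal_def)
    qed
    have right: "opcomp P m n i a (u + b) - opcomp P m n i a b \<in> I (m + n - 1)" if "u \<in> I n" for u
    proof -
      have "opcomp P m n i a (u + b) = opcomp P m n i a u + opcomp P m n i a b"
        using P.comp_linear_right[OF i n a] subspaceD(1)[OF In that(1)] b
        by (intro is_lin_on_free(1)[where f = "opcomp P m n i a"]) (simp_all add: sp)
      then show ?thesis using I that i n a by (simp add: operad_ideal_def)
    qed
    have "opcomp (quotient_operad P I) m n i (I m +>\<^bsub>opspace P m\<^esub> a) (I n +>\<^bsub>opspace P n\<^esub> b) =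
        (\<Union>x\<in>I m +>\<^bsub>free_space (B m)\<^esub> a. \<Union>y\<in>I n +>\<^bsub>free_space (B n)\<^esub> b. ?W (opcomp P m n i x y))"
      by (simp add: quotient_operad_def sp)
    \<comment> \<open>The union over \<open>x\<close> is moved inside so that it collapses for each
      fixed representative \<open>y\<close>; then the one over \<open>y\<close> collapses.\<close>
    also have "\<dots> = (\<Union>y\<in>I n +>\<^bsub>free_space (B n)\<^esub> b. \<Union>x\<in>I m +>\<^bsub>free_space (B m)\<^esub> a. ?W (opcomp P m n i x y))"
      by blast
    also have "\<dots> = (\<Union>y\<in>I n +>\<^bsub>free_space (B n)\<^esub> b. ?W (opcomp P m n i a y))"
    proof (intro SUP_cong refl)
      fix y assume "y \<in> I n +>\<^bsub>free_space (B n)\<^esub> b"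
      then obtain u where u: "u \<in> I n" "y = u + b" by (auto simp: coset_free)
      then have "y \<in> opcarrier P n"
        using subspaceD(1)[OF In u(1)] b keys_subset_closed(1)[of u "B n" b] by (simp add: sp)
      then show "(\<Union>x\<in>I m +>\<^bsub>free_space (B m)\<^esub> a. ?W (opcomp P m n i x y)) = ?W (opcomp P m n i a y)"
        using left by (intro UN_coset[OF Im Imn]) auto
    qed
    also have "\<dots> = ?W (opcomp P m n i a b)"
      using right by (intro UN_coset[OF In Imn])
    finally show "I (m + n - 1) +>\<^bsub>opspace P (m + n - 1)\<^esub> opcomp P m n i a b =
      opcomp (quotient_operad P I) m n i (I m +>\<^bsub>opspace P m\<^esub> a) (I n +>\<^bsub>opspace P n\<^esub> b)"
      by (simp add: sp)
  next
    fix n \<sigma> a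
    assume n: "(n::nat) \<ge> 1" and s: "\<sigma> permutes {1..n}" and a: "a \<in> opcarrier P n"
    note In = sub[OF n]
    have "opact P n \<sigma> (u + a) - opact P n \<sigma> a \<in> I n" if "u \<in> I n" for u
    proof -
      have "opact P n \<sigma> (u + a) = opact P n \<sigma> u + opact P n \<sigma> a"
        using P.act_linear[OF n s] subspaceD(1)[OF In that] a
        by (intro is_lin_on_free(1)[where f = "opact P n \<sigma>"]) (simp_all add: sp)
      then show ?thesis using I that n s by (simp add: operad_ideal_def)
    qed
    then show "I n +>\<^bsub>opspace P n\<^esub> opact P n \<sigma> a = opact (quotient_operad P I) n \<sigma> (I n +>\<^bsub>opspace P n\<^esub> a)"
      using UN_coset[OF In In, of "opact P n \<sigma>" a] by (simp add: quotient_operad_def sp)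
  qed
qed

section \<open>Generated ideals\<close>

lemma generated_ideal_superset: "r \<ge> 1 \<Longrightarrow> G r \<subseteq> generated_ideal P G r"
  unfolding generated_ideal_def by blast

lemma generated_ideal_least:
  "operad_ideal P I \<Longrightarrow> (\<And>r. r \<ge> 1 \<Longrightarrow> G r \<subseteq> I r) \<Longrightarrow> generated_ideal P G n \<subseteq> I n"
  unfolding generated_ideal_def by blast

lemma generated_ideal_ideal:
  fixes P :: "('k::field, 'b \<Rightarrow>\<^sub>0 'k) operad"
  assumes P: "symmetric_operad P" and sp: "\<And>n. opspace P n = free_space (B n)"
    and G: "\<And>r. r \<ge> 1 \<Longrightarrow> G r \<subseteq> opcarrier P r"
  shows "operad_ideal P (generated_ideal P G)"
proof -
  interpret P: symmetric_operad P by (rule P)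
  \<comment> \<open>The full components form an ideal containing \<open>G\<close>, so the
    intersection is over a nonempty family and stays inside the carriers.\<close>
  have top: "operad_ideal P (opcarrier P)"
    unfolding operad_ideal_def
  proof (intro conjI allI ballI impI)
    fix n :: nat
    show "VectorSpace.subspace class_ring (opcarrier P n) (opspace P n)"
      unfolding sp subspace_free_iff by (simp add: keys_subset_closed)
  next
    fix n \<sigma> x assume "x \<in> opcarrier P n" "n \<ge> 1 \<and> \<sigma> permutes {1..n}"
    then show "opact P n \<sigma> x \<in> opcarrier P n"
      using P.act_linear[of n \<sigma>] unfolding linear_map_iff by blast
  next
    fix m n i a b assume "a \<in> opcarrier P m" "b \<in> opcarrier P n" "1 \<le> i \<and> i \<le> m \<and> n \<ge> 1"
    then show "opcomp P m n i a b \<in> opcarrier P (m + n - 1)"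
      using P.comp_linear_right[of i m n a] unfolding linear_map_iff by blast
    then show "opcomp P m n i a b \<in> opcarrier P (m + n - 1)" .
  qed
  have mem: "x \<in> generated_ideal P G n \<longleftrightarrow> (\<forall>I. operad_ideal P I \<and> (\<forall>r\<ge>1. G r \<subseteq> I r) \<longrightarrow> x \<in> I n)" for x n
    unfolding generated_ideal_def by blast
  have carr: "x \<in> opcarrier P n" if "x \<in> generated_ideal P G n" for x n
    using that[unfolded mem, rule_format, of "opcarrier P"] top G by blast
  show ?thesis
    unfolding operad_ideal_def
  proof (intro conjI allI ballI impI)
    fix n :: nat assume n: "n \<ge> 1"
    have *: "VectorSpace.subspace class_ring (I n) (free_space (B n))" if "operad_ideal P I" for I
      using that n by (simp add: operad_ideal_def sp[symmetric])
    show "VectorSpace.subspace class_ring (generated_ideal P G n) (opspace P n)"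
      unfolding sp subspace_free_iff
    proof (intro conjI ballI allI)
      show "supp x \<subseteq> B n" if "x \<in> generated_ideal P G n" for x
        using carr[OF that] by (simp add: sp)
    qed (use subspaceD[OF *] in \<open>auto simp: mem\<close>)
  next
    fix n \<sigma> x assume "x \<in> generated_ideal P G n" "n \<ge> 1 \<and> \<sigma> permutes {1..n}"
    then show "opact P n \<sigma> x \<in> generated_ideal P G n"
      unfolding mem by (simp add: operad_ideal_def)
  next
    fix m n i x b
    assume "x \<in> generated_ideal P G m" "b \<in> opcarrier P n" "1 \<le> i \<and> i \<le> m \<and> n \<ge> 1"
    then show "opcomp P m n i x b \<in> generated_ideal P G (m + n - 1)"
      unfolding mem by (simp add: operad_ideal_def)
  next
    fix m n i a x
    assume "a \<in> opcarrier P m" "x \<in> generated_ideal P G n" "1 \<le> i \<and> i \<le> m \<and> n \<ge> 1"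
    then show "opcomp P m n i a x \<in> generated_ideal P G (m + n - 1)"
      unfolding mem by (simp add: operad_ideal_def)
  qed
qed

section \<open>The free operad\<close>

text \<open>A list whose entries form a set of \<open>n\<close> elements is distinct exactly when
  its length is \<open>n\<close>; lengths are easier to add up after substitution.\<close>

lemma op_trees_iff: "t \<in> op_trees n \<longleftrightarrow> set (inputs t) = {1..n} \<and> length (inputs t) = n"
  unfolding op_trees_def using distinct_card[of "inputs t"] card_distinct[of "inputs t"] by auto

lemma inputs_op_subst: "inputs (op_subst h t) = concat (map (\<lambda>j. inputs (h j)) (inputs t))"
  by (induct t) simp_all

lemma inputs_map: "inputs (map_op_tree id s t) = map s (inputs t)"
  by (induct t) simp_all

lemma op_subst_cong: "(\<And>j. j \<in> set (inputs t) \<Longrightarrow> f j = g j) \<Longrightarrow> op_subst f t = op_subst g t"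
  by (induct t) auto

lemma op_subst_subst: "op_subst f (op_subst g t) = op_subst (\<lambda>j. op_subst f (g j)) t"
  by (induct t) simp_all

lemma op_subst_map: "op_subst f (map_op_tree id s t) = op_subst (\<lambda>j. f (s j)) t"
  by (induct t) simp_all

lemma map_op_subst: "map_op_tree id s (op_subst f t) = op_subst (\<lambda>j. map_op_tree id s (f j)) t"
  by (induct t) simp_all

lemma op_subst_id: "(\<And>j. j \<in> set (inputs t) \<Longrightarrow> f j = Input j) \<Longrightarrow> op_subst f t = t"
  by (induct t) auto

lemma map_op_tree_cong_inputs:
  "(\<And>j. j \<in> set (inputs t) \<Longrightarrow> f j = g j) \<Longrightarrow> map_op_tree id f t = map_op_tree id g t"
  by (induct t) auto

definition plug :: "nat \<Rightarrow> nat \<Rightarrow> ('g, nat) op_tree \<Rightarrow> nat \<Rightarrow> ('g, nat) op_tree" where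
  "plug n i R j = (if j < i then Input j else if j = i then map_op_tree id (\<lambda>k. k + i - 1) R
    else Input (j + n - 1))"

lemma op_tree_comp_plug: "op_tree_comp n i T R = op_subst (plug n i R) T"
  by (simp add: op_tree_comp_def plug_def[abs_def])

lemma op_tree_comp_in:
  assumes T: "T \<in> op_trees m" and R: "R \<in> op_trees n" and i: "1 \<le> i" "i \<le> m" and n: "n \<ge> 1"
  shows "op_tree_comp n i T R \<in> op_trees (m + n - 1)"
proof -
  let ?h = "\<lambda>j. inputs (plug n i R j)"
  have h: "?h j = (if j < i then [j] else if j = i then map (\<lambda>k. k + i - 1) (inputs R) else [j + n - 1])" for j
    by (simp add: plug_def inputs_map)
  have inp: "inputs (op_tree_comp n i T R) = concat (map ?h (inputs T))"
    by (simp add: op_tree_comp_plug inputs_op_subst)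
  have sT: "set (inputs T) = {1..m}" "distinct (inputs T)" and sR: "set (inputs R) = {1..n}" "length (inputs R) = n"
    using T R op_trees_iff by (auto simp: op_trees_def)
  have "set (inputs (op_tree_comp n i T R)) = (\<Union>j\<in>{1..m}. set (?h j))" by (simp add: inp sT)
  also have "\<dots> = {1..m + n - 1}"
  proof (intro equalityI subsetI)
    fix p assume "p \<in> (\<Union>j\<in>{1..m}. set (?h j))"
    then show "p \<in> {1..m + n - 1}" using i n by (auto simp: h sR split: if_splits)
  next
    fix p assume p: "p \<in> {1..m + n - 1}"
    consider "p < i" | "i \<le> p" "p < i + n" | "i + n \<le> p" by linarith
    then show "p \<in> (\<Union>j\<in>{1..m}. set (?h j))"
    proof cases
      case 1
      then show ?thesis using p i by (intro UN_I[of p]) (auto simp: h)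
    next
      case 2
      then have "p \<in> set (?h i)"
        unfolding h by (auto simp: sR intro!: image_eqI[of _ _ "p - i + 1"])
      then show ?thesis using i by (intro UN_I[of i]) auto
    next
      case 3
      then show ?thesis using p i n by (intro UN_I[of "p - n + 1"]) (auto simp: h)
    qed
  qed
  finally have 1: "set (inputs (op_tree_comp n i T R)) = {1..m + n - 1}" .
  have "length (inputs (op_tree_comp n i T R)) = (\<Sum>j\<in>{1..m}. length (?h j))"
    using sT by (simp add: inp length_concat o_def sum_list_distinct_conv_sum_set)
  also have "\<dots> = (\<Sum>j\<in>{1..m}. if j = i then n else 1)"
    by (intro sum.cong refl) (simp add: h sR)
  also have "\<dots> = n + (\<Sum>j\<in>{1..m} - {i}. 1)"
    using i by (subst sum.remove[of _ i]) (auto intro!: sum.cong)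
  also have "\<dots> = m + n - 1" using i by simp
  finally show ?thesis using 1 by (simp add: op_trees_iff)
qed

lemma bilin_eqI:
  assumes "\<And>y. is_lin (\<lambda>x. F x y)" "\<And>x. is_lin (F x)" "\<And>y. is_lin (\<lambda>x. G x y)" "\<And>x. is_lin (G x)"
    and "\<And>r s. r \<in> supp x \<Longrightarrow> s \<in> supp y \<Longrightarrow>
      F (basis_vec r) (basis_vec s) = G (basis_vec r) (basis_vec s)"
  shows "F x y = G x y"
proof -
  have "F (basis_vec r) y = G (basis_vec r) y" if "r \<in> supp x" for r
    by (rule lin_eqI[OF assms(2,4)]) (rule assms(5)[OF that])
  then show ?thesis by (rule lin_eqI[OF assms(1,3)])
qed

lemma keys_lin_ext_subset:
  "(\<And>t. t \<in> supp x \<Longrightarrow> supp (f t) \<subseteq> C) \<Longrightarrow> supp (lin_ext f x) \<subseteq> C"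
  by (rule subset_trans[OF keys_lin_ext]) (rule UN_least)

lemma keys_bilin_ext_subset:
  "(\<And>s t. s \<in> supp x \<Longrightarrow> t \<in> supp y \<Longrightarrow> supp (f s t) \<subseteq> C) \<Longrightarrow>
    supp (bilin_ext f x y) \<subseteq> C"
  unfolding bilin_ext_def by (intro keys_lin_ext_subset)

text \<open>Partial composition is substitution by \<open>plug\<close>, so both associativity laws
  and equivariance reduce to comparing two substitutions at each input.\<close>

lemma free_operad: "symmetric_operad (free_binary_operad :: ('k::field, ('g, nat) op_tree \<Rightarrow>\<^sub>0 'k) operad)"
proof -
  let ?P = "free_binary_operad :: ('k::field, ('g, nat) op_tree \<Rightarrow>\<^sub>0 'k) operad"
  have sp [simp]: "opspace ?P n = free_space (op_trees n)" for n by (simp add: free_binary_operad_def)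
  have cp [simp]: "opcomp ?P m n i = bilin_ext (\<lambda>T R. basis_vec (op_tree_comp n i T R))" for m n i
    by (simp add: free_binary_operad_def)
  have ac [simp]: "opact ?P n s = lin_ext (\<lambda>T. basis_vec (map_op_tree id s T))" for n s
    by (simp add: free_binary_operad_def)
  have un [simp]: "opunit ?P = basis_vec (Input 1)" by (simp add: free_binary_operad_def)
  have cc: "supp (bilin_ext (\<lambda>T R. basis_vec (op_tree_comp n i T R)) a b :: _ \<Rightarrow>\<^sub>0 'k) \<subseteq> op_trees (m + n - 1)"
    if "1 \<le> i" "i \<le> m" "n \<ge> 1" "supp a \<subseteq> op_trees m" "supp b \<subseteq> op_trees n"
    for m n i and a b :: "('g, nat) op_tree \<Rightarrow>\<^sub>0 'k"
    using that by (intro keys_bilin_ext_subset) (simp add: subset_iff op_tree_comp_in del: One_nat_def)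
  show ?thesis
    supply One_nat_def [simp del]
  proof (rule symmetric_operad.intro)
    fix n :: nat
    show "vectorspace class_ring (opspace ?P n)" by (simp add: vectorspace_free_space)
  next
    show "opunit ?P \<in> opcarrier ?P 1" by (simp add: op_trees_def)
  next
    fix i m n :: nat and a assume "1 \<le> i" "i \<le> m" "1 \<le> n" "a \<in> opcarrier ?P m"
    then show "linear_map class_ring (opspace ?P n) (opspace ?P (m + n - 1)) (opcomp ?P m n i a)"
      unfolding sp cp by (intro is_lin_linear_map cc) auto
  next
    fix i m n :: nat and b assume "1 \<le> i" "i \<le> m" "1 \<le> n" "b \<in> opcarrier ?P n"
    then show "linear_map class_ring (opspace ?P m) (opspace ?P (m + n - 1)) (\<lambda>a. opcomp ?P m n i a b)"
      unfolding sp cp by (intro is_lin_linear_map cc) auto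
  next
    fix n :: nat and \<sigma> assume s: "\<sigma> permutes {1..n}"
    have "map_op_tree id \<sigma> t \<in> op_trees n" if "t \<in> op_trees n" for t :: "('g, nat) op_tree"
      using that permutes_image[OF s] by (simp add: op_trees_iff inputs_map)
    then show "linear_map class_ring (opspace ?P n) (opspace ?P n) (opact ?P n \<sigma>)"
      unfolding sp ac by (intro is_lin_linear_map keys_lin_ext_subset) auto
  next
    fix n :: nat and a
    show "opact ?P n id a = a" by (simp add: op_tree.map_id)
  next
    fix n :: nat and \<sigma> \<tau> a
    show "opact ?P n (\<sigma> \<circ> \<tau>) a = opact ?P n \<sigma> (opact ?P n \<tau> a)"
      by (simp add: lin_ext_lin_ext op_tree.map_comp)
  next
    fix n :: nat and a assume a: "a \<in> opcarrier ?P n"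
    have "op_tree_comp n 1 (Input 1) t = t" for t :: "('g, nat) op_tree"
      by (simp add: op_tree_comp_def op_tree.map_ident op_tree.map_id[unfolded id_def] id_def)
    then show "opcomp ?P 1 n 1 (opunit ?P) a = a" by (simp add: bilin_ext_basis)
  next
    fix i n :: nat and a assume "1 \<le> i" "i \<le> n" and a: "a \<in> opcarrier ?P n"
    then have "op_tree_comp 1 i t (Input 1) = t" for t :: "('g, nat) op_tree"
      unfolding op_tree_comp_def by (intro op_subst_id) auto
    then show "opcomp ?P n 1 i a (opunit ?P) = a" by (simp add: bilin_ext_basis)
  next
    fix i m j n q :: nat and a b c
    assume i: "1 \<le> i" "i \<le> m" and j: "1 \<le> j" "j \<le> n" and q: "1 \<le> q"
      and a: "a \<in> opcarrier ?P m" and b: "b \<in> opcarrier ?P n" and c: "c \<in> opcarrier ?P q"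
    have *: "op_tree_comp q (i + j - 1) (op_tree_comp n i r s) t = op_tree_comp (n + q - 1) i r (op_tree_comp q j s t)"
      if "r \<in> op_trees m" "s \<in> op_trees n" "t \<in> op_trees q" for r s t :: "('g, nat) op_tree"
      unfolding op_tree_comp_plug op_subst_subst
    proof (rule op_subst_cong)
      fix l assume "l \<in> set (inputs r)"
      consider "l < i" | "l = i" | "l > i" by linarith
      then show "op_subst (plug q (i + j - 1) t) (plug n i s l) = plug (n + q - 1) i (op_subst (plug q j t) s) l"
      proof cases
        case 2
        have "op_subst (\<lambda>p. plug q (i + j - 1) t (p + i - 1)) s = op_subst (\<lambda>p. map_op_tree id (\<lambda>k. k + i - 1) (plug q j t p)) s"
        proof (rule op_subst_cong)
          fix p assume "p \<in> set (inputs s)"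
          then have p: "1 \<le> p" using that by (auto simp: op_trees_def)
          have "(\<lambda>k. k + (i + j - 1) - 1) = (\<lambda>k. k + i - 1) \<circ> (\<lambda>k. k + j - 1)"
            using i j by (auto simp: fun_eq_iff)
          then have "map_op_tree id (\<lambda>k. k + (i + j - 1) - 1) t =
              map_op_tree id (\<lambda>k. k + i - 1) (map_op_tree id (\<lambda>k. k + j - 1) t)"
            by (simp add: op_tree.map_comp)
          then show "plug q (i + j - 1) t (p + i - 1) = map_op_tree id (\<lambda>k. k + i - 1) (plug q j t p)"
            using i j q p by (auto simp: plug_def)
        qed
        then show ?thesis using 2 by (simp add: plug_def[of _ i] op_subst_map map_op_subst)
      qed (use i j q in \<open>auto simp: plug_def\<close>)
    qed
    show "opcomp ?P (m + n - 1) q (i + j - 1) (opcomp ?P m n i a b) c =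
        opcomp ?P m (n + q - 1) i a (opcomp ?P n q j b c)"
      unfolding cp
      by (rule trilin_eqI[where F = "\<lambda>a b c. bilin_ext _ (bilin_ext _ a b) c" and G = "\<lambda>a b c. bilin_ext _ a (bilin_ext _ b c)"])
        (use a b c in \<open>auto intro: is_lin_compose[OF is_lin_bilin_ext(1)] is_lin_compose[OF is_lin_bilin_ext(2)] simp: bilin_ext_basis * subset_iff\<close>)
  next
    fix i k m n q :: nat and a b c
    assume i: "1 \<le> i" "i < k" "k \<le> m" and n: "1 \<le> n" and q: "1 \<le> q"
      and a: "a \<in> opcarrier ?P m" and b: "b \<in> opcarrier ?P n" and c: "c \<in> opcarrier ?P q"
    have *: "op_tree_comp q (k + n - 1) (op_tree_comp n i r s) t = op_tree_comp n i (op_tree_comp q k r t) s"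
      if "r \<in> op_trees m" "s \<in> op_trees n" "t \<in> op_trees q" for r s t :: "('g, nat) op_tree"
      unfolding op_tree_comp_plug op_subst_subst
    proof (rule op_subst_cong)
      fix l assume "l \<in> set (inputs r)"
      have s: "op_subst (plug q (k + n - 1) t) (map_op_tree id (\<lambda>j. j + i - 1) s) = map_op_tree id (\<lambda>j. j + i - 1) s"
        unfolding op_subst_map unfolding op_subst_Input[symmetric]
        using that i by (intro op_subst_cong) (auto simp: op_trees_def plug_def)
      have t: "op_subst (plug n i s) (map_op_tree id (\<lambda>j. j + k - 1) t) = map_op_tree id (\<lambda>j. j + (k + n - 1) - 1) t"
        unfolding op_subst_map unfolding op_subst_Input[symmetric]
        using that i n by (intro op_subst_cong) (auto simp: op_trees_def plug_def)
      consider "l < i" | "l = i" | "i < l" "l < k" | "l = k" | "l > k" by linarith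
      then show "op_subst (plug q (k + n - 1) t) (plug n i s l) = op_subst (plug n i s) (plug q k t l)"
        using i n q s t by cases (auto simp: plug_def)
    qed
    show "opcomp ?P (m + n - 1) q (k + n - 1) (opcomp ?P m n i a b) c =
        opcomp ?P (m + q - 1) n i (opcomp ?P m q k a c) b"
      unfolding cp
      by (rule trilin_eqI[where F = "\<lambda>a b c. bilin_ext _ (bilin_ext _ a b) c" and G = "\<lambda>a b c. bilin_ext _ (bilin_ext _ a c) b"])
        (use a b c in \<open>auto intro: is_lin_compose[OF is_lin_bilin_ext(1)] is_lin_compose[OF is_lin_bilin_ext(2)] simp: bilin_ext_basis * subset_iff\<close>)
  next
    fix i m n :: nat and \<sigma> \<tau> a b
    assume i: "1 \<le> i" "i \<le> m" and n: "1 \<le> n" and s: "\<sigma> permutes {1..m}" and t: "\<tau> permutes {1..n}"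
      and a: "a \<in> opcarrier ?P m" and b: "b \<in> opcarrier ?P n"
    have tj: "\<tau> j \<in> {1..n} \<longleftrightarrow> j \<in> {1..n}" for j using permutes_in_image[OF t] by blast
    have sinj: "\<sigma> j = \<sigma> k \<longleftrightarrow> j = k" for j k using permutes_inj[OF s] by (auto simp: inj_def)
    have "\<sigma> i \<in> {1..m}" using permutes_in_image[OF s, of i] i by auto
    then have si: "1 \<le> \<sigma> i" by simp
    have *: "op_tree_comp n (\<sigma> i) (map_op_tree id \<sigma> r) (map_op_tree id \<tau> u) =
        map_op_tree id (perm_comp n i \<sigma> \<tau>) (op_tree_comp n i r u)"
      if "r \<in> op_trees m" "u \<in> op_trees n" for r u :: "('g, nat) op_tree"
      unfolding op_tree_comp_plug op_subst_map map_op_subst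
    proof (rule op_subst_cong)
      fix l assume "l \<in> set (inputs r)"
      have "map_op_tree id (\<lambda>k. \<tau> k + \<sigma> i - 1) u = map_op_tree id (\<lambda>k. perm_comp n i \<sigma> \<tau> (k + i - 1)) u"
        using that i by (intro map_op_tree_cong_inputs) (auto simp: op_trees_def perm_comp_def Let_def)
      then have u: "map_op_tree id (\<lambda>k. k + \<sigma> i - 1) (map_op_tree id \<tau> u) =
          map_op_tree id (perm_comp n i \<sigma> \<tau>) (map_op_tree id (\<lambda>k. k + i - 1) u)"
        by (simp add: op_tree.map_comp o_def id_def)
      consider "l < i" | "l = i" | "l > i" by linarith
      then show "plug n (\<sigma> i) (map_op_tree id \<tau> u) (\<sigma> l) = map_op_tree id (perm_comp n i \<sigma> \<tau>) (plug n i u l)"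
      proof cases
        case 1
        then show ?thesis by (simp add: plug_def sinj perm_comp_def Let_def)
      next
        case 2
        then show ?thesis using u by (simp add: plug_def)
      next
        case 3
        then have "l + n - 1 - n + 1 = l" "\<not> l + n - 1 < i" "\<not> l + n - 1 < i + n" using n by auto
        then show ?thesis using 3 by (simp add: plug_def sinj perm_comp_def Let_def)
      qed
    qed
    show "opcomp ?P m n (\<sigma> i) (opact ?P m \<sigma> a) (opact ?P n \<tau> b) =
        opact ?P (m + n - 1) (perm_comp n i \<sigma> \<tau>) (opcomp ?P m n i a b)"
      unfolding cp ac
      by (rule bilin_eqI[where F = "\<lambda>a b. bilin_ext _ (lin_ext _ a) (lin_ext _ b)" and G = "\<lambda>a b. lin_ext _ (bilin_ext _ a b)"])
        (use a b in \<open>auto intro: is_lin_compose[OF is_lin_bilin_ext(1)] is_lin_compose[OF is_lin_bilin_ext(2)] simp: bilin_ext_basis * subset_iff\<close>)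
  qed
qed

section \<open>The operad \<open>LW\<close> as an image of the free operad\<close>

definition homg :: "('b \<Rightarrow> 'c) \<Rightarrow> 'c \<Rightarrow> ('b \<Rightarrow>\<^sub>0 'k::field) \<Rightarrow> bool" where
  "homg f M x \<longleftrightarrow> (\<forall>t\<in>supp x. f t = M)"

lemma homg_simps [simp]: "homg f M 0" "homg f M (basis_vec t) \<longleftrightarrow> f t = M"
  by (simp_all add: homg_def)

lemma homg_add: "homg f M x \<Longrightarrow> homg f M y \<Longrightarrow> homg f M (x + y)"
  using Poly_Mapping.keys_add[of x y] by (auto simp: homg_def)

lemma homg_diff: "homg f M x \<Longrightarrow> homg f M y \<Longrightarrow> homg f M (x - y)"
  using keys_minus_subset[of x y] by (auto simp: homg_def)

lemma homg_lin_ext: "homg f M x \<Longrightarrow> (\<And>t. f t = M \<Longrightarrow> homg g N (h t)) \<Longrightarrow> homg g N (lin_ext h x)"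
  using keys_lin_ext[of h x] by (fastforce simp: homg_def)

abbreviation labPW :: "'a pl list \<Rightarrow> 'a multiset" where
  "labPW w \<equiv> mset (concat (map labP w))"

lemma
  shows homg_ins: "homg (\<lambda>t. mset (labP t)) (labPW w + mset (labP t)) (ins w t :: _ \<Rightarrow>\<^sub>0 'k::field)"
    and homg_insF: "homg labPW (labPW w + labPW ts) (insF w ts :: _ \<Rightarrow>\<^sub>0 'k)"
proof (induct w t and w ts rule: ins_insF.induct)
  case (1 w a ts)
  then show ?case by (auto intro!: homg_add homg_lin_ext)
next
  case (3 w t ts)
  show ?case unfolding insF.simps
    by (intro homg_add homg_lin_ext[OF 3(1)] homg_lin_ext[OF 3(2)]) auto
qed simp

lemma homg_cat: "homg labPW M x \<Longrightarrow> homg labPW N y \<Longrightarrow> homg labPW (M + N) (cat x y)"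
  unfolding cat_def bilin_ext_def by (elim homg_lin_ext) auto

lemma homg_expand: "homg labPW (mset (labW t)) (expand t)"
proof (induct t)
  case (Br a b)
  show ?case
    using homg_cat[OF Br] homg_cat[OF Br(2,1)] by (auto intro: homg_diff simp: add.commute)
qed simp

lemma homg_insW: "homg (\<lambda>t. mset (labW t)) (labPW w + mset (labW t)) (insW w t)"
proof (induct t)
  case (Leaf t)
  then show ?case by (auto intro: homg_lin_ext[OF homg_ins])
next
  case (Br a b)
  show ?case unfolding insW.simps
    by (intro homg_add homg_lin_ext[OF Br(1)] homg_lin_ext[OF Br(2)]) auto
qed

lemma homg_gr: "homg (\<lambda>t. mset (labW t)) (mset (labW a) + mset (labW b)) (gr a b)"
  unfolding gr_def by (rule homg_lin_ext[OF homg_expand]) (metis homg_insW)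

lemma homg_grL:
  "homg (\<lambda>t. mset (labW t)) M x \<Longrightarrow> homg (\<lambda>t. mset (labW t)) N y \<Longrightarrow> homg (\<lambda>t. mset (labW t)) (M + N) (grL x y)"
  unfolding grL_def bilin_ext_def by (elim homg_lin_ext) (metis homg_gr)

lemma homg_brL:
  "homg (\<lambda>t. mset (labW t)) M x \<Longrightarrow> homg (\<lambda>t. mset (labW t)) N y \<Longrightarrow> homg (\<lambda>t. mset (labW t)) (M + N) (brL x y)"
  unfolding brL_def bilin_ext_def by (elim homg_lin_ext) auto

lemma homg_toA: "homg (\<lambda>t. mset (labW t)) (mset (inputs u)) (toA u)"
  by (induct u) (auto intro: homg_grL homg_brL split: post_lie_gen.split)

lemma mset_eq_upt_iff: "mset xs = mset [1..<Suc n] \<longleftrightarrow> distinct xs \<and> set xs = {1..n}"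
proof -
  have u: "set [1..<Suc n] = {1..n}" by (simp only: set_upt atLeastLessThanSuc_atLeastAtMost)
  have d: "distinct [1..<Suc n]" by (rule distinct_upt)
  show ?thesis
    using set_eq_iff_mset_eq_distinct[OF _ d, of xs] mset_eq_imp_distinct_iff[of xs "[1..<Suc n]"]
      mset_eq_setD[of xs "[1..<Suc n]"] u d by metis
qed

lemma valid_iff: "valid n t \<longleftrightarrow> mset (labW t) = mset [1..<Suc n]"
  unfolding mset_eq_upt_iff valid_def set_labW ..

lemma op_trees_mset: "u \<in> op_trees n \<longleftrightarrow> mset (inputs u) = mset [1..<Suc n]"
  unfolding mset_eq_upt_iff op_trees_def by simp

text \<open>Both products add multisets of labels, so all terms of \<open>toA u\<close> carry
  exactly the inputs of \<open>u\<close>, with multiplicity. Hence arity components correspond in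
  both directions.\<close>

lemma valid_toA: "t \<in> supp (toA u :: _ \<Rightarrow>\<^sub>0 'k::field) \<Longrightarrow> valid n t \<longleftrightarrow> u \<in> op_trees n"
  using homg_toA[of u, where 'b = 'k] by (simp add: homg_def valid_iff op_trees_mset del: upt_Suc)

subsection \<open>The basis of \<open>LW\<close>\<close>

lemma unlabeled_Node_cases:
  "p \<in> unlabeled (Node a ts) \<longleftrightarrow> (p = [] \<and> a = None) \<or> (\<exists>k q. p = k # q \<and> k < length ts \<and> q \<in> unlabeled (ts ! k))"
  by (auto simp: unlabeled_def verts_Node)

lemma fully_labeled: "unlabeled t = {} \<Longrightarrow> \<exists>s. t = eP s"
proof (induct t)
  case (Node a ts)
  have "unlabeled (ts ! k) = {}" if "k < length ts" for k
    using Node(2) that by (auto simp: unlabeled_Node_cases set_eq_iff)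
  then have "\<forall>t\<in>set ts. \<exists>s. t = eP s" using Node(1) by (metis in_set_conv_nth)
  then obtain f where "\<forall>t\<in>set ts. t = eP (f t)" by metis
  then have "map eP (map f ts) = ts" by (simp add: map_idI)
  moreover obtain b where "a = Some b" using Node(2) by (cases a) (auto simp: unlabeled_Node_cases set_eq_iff)
  ultimately show ?case by (intro exI[of _ "PN b (map f ts)"]) simp
qed

text \<open>Unlabeled vertices are closed under passing to successors, so descending from any of
  them reaches the root.\<close>

lemma unlabeled_root:
  assumes "\<forall>p\<in>unlabeled t. p \<noteq> [] \<longrightarrow> label_at t (butlast p) = None" "p \<in> unlabeled t"
  shows "label_at t [] = None"
  using assms(2)
proof (induct "length p" arbitrary: p rule: less_induct)
  case less
  show ?case
  proof (cases "p = []")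
    case True
    then show ?thesis using less by (simp add: unlabeled_def)
  next
    case False
    have v: "butlast p \<in> verts t" if "p \<in> verts t" for p and t :: "'a ptree"
      using that
    proof (induct p arbitrary: t)
      case (Cons k q)
      then show ?case by (cases t) (auto simp: verts_Node)
    qed simp
    have "butlast p \<in> unlabeled t" using less(2) assms(1) False v by (auto simp: unlabeled_def)
    then show ?thesis using less(1)[of "butlast p"] False by simp
  qed
qed

text \<open>A labeled root excludes unlabeled vertices above it; an unlabeled root has two branches
  with the same properties.\<close>

lemma binary_top:
  assumes "\<forall>p\<in>unlabeled t. p \<noteq> [] \<longrightarrow> label_at t (butlast p) = None"
    and "\<forall>p\<in>unlabeled t. length (incoming t p) = 2"
  shows "\<exists>s. t = eW s"
  using assms
proof (induct t)
  case (Node a ts)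
  show ?case
  proof (cases "a = None")
    case False
    then have "unlabeled (Node a ts) = {}"
      using unlabeled_root[OF Node(2)] by auto
    then obtain s where "Node a ts = eP s" using fully_labeled by blast
    then show ?thesis by (intro exI[of _ "Leaf s"]) simp
  next
    case True
    then have "[] \<in> unlabeled (Node a ts)" by (simp add: unlabeled_Node_cases)
    then have "length ts = 2" using Node(3) by (force simp: incoming_def)
    then obtain t1 t2 where ts: "ts = [t1, t2]" by (auto simp: length_Suc_conv numeral_2_eq_2)
    have "\<exists>s. t = eW s" if t: "t \<in> set ts" for t
    proof -
      obtain k where k: "k < length ts" "t = ts ! k" using t by (metis in_set_conv_nth)
      have u: "k # p \<in> unlabeled (Node a ts)" if "p \<in> unlabeled t" for p
        using that k by (auto simp: unlabeled_Node_cases)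
      show ?thesis
      proof (rule Node(1)[OF t])
        show "\<forall>p\<in>unlabeled t. p \<noteq> [] \<longrightarrow> label_at t (butlast p) = None"
          using Node(2) u k by force
        show "\<forall>p\<in>unlabeled t. length (incoming t p) = 2"
          using Node(3) u k by (force simp: incoming_def)
      qed
    qed
    from this[of t1] this[of t2] obtain s1 s2 where "t1 = eW s1" "t2 = eW s2" by (auto simp: ts)
    then show ?thesis using True ts by (intro exI[of _ "Br s1 s2"]) simp
  qed
qed

lemma LW_basis_iff: "t \<in> L_trees n \<union> W_trees n \<longleftrightarrow> (\<exists>u. t = eW u \<and> valid n u)"
proof
  assume t: "t \<in> L_trees n \<union> W_trees n"
  then have PT: "t \<in> PT n" by (auto simp: L_trees_def W_trees_def)
  have "\<exists>u. t = eW u"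
  proof (cases "t \<in> L_trees n")
    case True
    then show ?thesis using fully_labeled[of t] by (metis (mono_tags, lifting) L_trees_def eW.simps(1) mem_Collect_eq)
  next
    case False
    then show ?thesis using t by (intro binary_top) (auto simp: W_trees_def)
  qed
  then show "\<exists>u. t = eW u \<and> valid n u" using PT eW_in_PT by blast
next
  assume "\<exists>u. t = eW u \<and> valid n u"
  then obtain u where u: "t = eW u" "valid n u" by blast
  show "t \<in> L_trees n \<union> W_trees n"
  proof (cases u)
    case (Leaf s)
    then show ?thesis using u eW_in_PT[of u n] by (simp add: L_trees_def)
  next
    case (Br a b)
    then show ?thesis using u eW_in_W_trees by blast
  qed
qed

subsection \<open>The morphism\<close>

text \<open>By \<open>evW_single\<close> the evaluation depends on \<open>h\<close> at
  \<open>i\<close> linearly; \<open>\<Psi>\<close> is that dependence. The case of a single tree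
  \<open>R\<close> then extends to combinations.\<close>

lemma lw_comp_lin:
  fixes T :: "nat lw" and h :: "nat \<Rightarrow> nat lw \<Rightarrow>\<^sub>0 'k::field"
  assumes T: "valid m T" and i: "1 \<le> i" "i \<le> m" and n: "n \<ge> 1"
    and Y: "\<And>R. R \<in> supp Y \<Longrightarrow> valid n R"
    and hi: "h i = lmap (map_lw (\<lambda>j. j + i - 1)) Y"
    and h: "\<And>j. j \<noteq> i \<Longrightarrow> h j = basis_vec (Leaf (PN (if j \<le> i then j else j + n - 1) []))"
  shows "lmap eW (evW brL grL h T) = lin_ext (\<lambda>R. lw_comp n i (eW T) (eW R)) Y"
proof -
  have dT: "distinct (labW T)" using T by (simp add: valid_def)
  have "i \<in> set_lw T" using T i by (simp add: valid_def)
  then obtain p where p: "p \<in> verts (eW T)" and pi: "label_at (eW T) p = Some i" by (rule obtain_vertex)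
  obtain cs where cs: "subtree_at (eW T) p = Node (Some i) (map eP cs)"
    using subtree_at_eW[OF p pi] by blast
  let ?s = "\<lambda>j. if j \<le> i then j else j + n - 1"
  define \<Psi> :: "_ \<Rightarrow> _ \<Rightarrow>\<^sub>0 'k" where "\<Psi> y = (let X = act grL (map (\<lambda>c. basis_vec (Leaf (map_pl ?s c))) cs) y in
    if p = [] \<or> label_at (eW T) (butlast p) = None
    then lmap (\<lambda>u. replace_at (eW (map_lw ?s T)) p (eW u)) X
    else lmap (\<lambda>w. contract_edge p (replace_at (eW (map_lw ?s T)) p (Node None (map eP w)))) (lin_ext expand X))" for y
  have \<Psi>: "lmap eW (evW brL grL g T) = \<Psi> (g i)"
    if "\<And>j. j \<noteq> i \<Longrightarrow> g j = basis_vec (Leaf (PN (?s j) []))" for g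
    unfolding \<Psi>_def Let_def
    by (rule evW_single[where i = i and s = ?s and h = g, OF dT p cs _ refl]) (simp add: that)
  have "is_lin \<Psi>"
    by (auto simp: is_lin_def \<Psi>_def Let_def is_lin_simps[OF A.is_lin_act])
  then have "lmap eW (evW brL grL h T) = lin_ext (\<lambda>R. \<Psi> (basis_vec (map_lw (\<lambda>j. j + i - 1) R))) Y"
    by (simp add: \<Psi>[of h] h hi lin_lin_ext)
  also have "\<dots> = lin_ext (\<lambda>R. lw_comp n i (eW T) (eW R)) Y"
  proof (intro lin_ext_cong refl)
    fix R assume "R \<in> supp Y"
    let ?g = "h(i := basis_vec (map_lw (\<lambda>j. j + i - 1) R))"
    have "lw_comp n i (eW T) (eW R) = lmap eW (evW brL grL ?g T)"
      using Y[OF \<open>R \<in> supp Y\<close>] h by (intro lw_comp_eq[OF T _ i n]) auto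
    also have "\<dots> = \<Psi> (?g i)" using h by (intro \<Psi>) simp
    finally show "\<Psi> (basis_vec (map_lw (\<lambda>j. j + i - 1) R)) = lw_comp n i (eW T) (eW R)" by simp
  qed
  finally show ?thesis .
qed

definition toLW :: "'k::field post_lie_term \<Rightarrow> nat ptree \<Rightarrow>\<^sub>0 'k" where
  "toLW = lin_ext (\<lambda>u. lmap eW (toA u))"

lemma toLW_eq: "toLW x = lmap eW (lin_ext toA x)"
  by (simp add: toLW_def lin_ext_lin_ext)

lemma is_lin_toLW: "is_lin toLW"
  by (simp add: toLW_def)

interpretation F: bilinear_ops br tri
  by unfold_locales (simp_all add: br_def tri_def)

lemma toA_br: "lin_ext toA (br x y) = brL (lin_ext toA x) (lin_ext toA y)"
  by (simp add: br_def bilin_ext_def lin_ext_lin_ext bilinear_lin_ext[of brL])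

lemma toA_tri: "lin_ext toA (tri x y) = grL (lin_ext toA x) (lin_ext toA y)"
  by (simp add: tri_def bilin_ext_def lin_ext_lin_ext bilinear_lin_ext[of grL])

text \<open>Evaluation at the variables is a section of \<open>toA\<close>: followed by the
  homomorphism \<open>toA\<close>, it becomes evaluation at single vertices, which is the
  identity.\<close>

lemma toA_evW: "lin_ext toA (evW br tri var t) = basis_vec t"
proof -
  have "lin_ext toA (evW br tri var t) = evW brL grL (\<lambda>a. lin_ext toA (var a)) t"
    by (rule F.evW_hom[where F = "lin_ext toA"]) (simp_all add: toA_br toA_tri)
  also have "\<dots> = basis_vec t" by (simp add: var_def evW_leaf)
  finally show ?thesis .
qed

section \<open>Surjectivity onto LW\<close>

definition res :: "'b set \<Rightarrow> ('b \<Rightarrow>\<^sub>0 'k::field) \<Rightarrow> 'b \<Rightarrow>\<^sub>0 'k" where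
  "res S = lin_ext (\<lambda>t. if t \<in> S then basis_vec t else 0)"

lemma is_lin_res [simp, intro]: "is_lin (res S)"
  by (simp add: res_def)

lemmas res_simps [simp] = is_lin_simps[OF is_lin_res]

lemma res_basis [simp]: "res S (basis_vec t) = (if t \<in> S then basis_vec t else 0)"
  by (simp add: res_def)

lemma keys_res: "supp (res S x) \<subseteq> S"
  unfolding res_def by (intro keys_lin_ext_subset) simp

lemma res_id: "supp x \<subseteq> S \<Longrightarrow> res S x = x"
  by (rule lin_eqI[of "res S" "\<lambda>x. x"]) auto

lemma res_0: "supp x \<inter> S = {} \<Longrightarrow> res S x = 0"
  by (rule lin_eqI[of "res S" "\<lambda>x. 0"]) auto

text \<open>The section may be truncated to \<open>op_trees n\<close>: by \<open>valid_toA\<close>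
  this corresponds to truncation to valid trees, which fixes \<open>t\<close>. A separate proof that
  the evaluation is homogeneous is thereby avoided.\<close>

lemma toLW_surj_basis:
  assumes "valid n t"
  shows "\<exists>x. supp x \<subseteq> op_trees n \<and> toLW x = (basis_vec (eW t) :: _ \<Rightarrow>\<^sub>0 'k::field)"
proof -
  let ?x = "evW br tri var t :: 'k post_lie_term"
  have "lin_ext toA (res (op_trees n) x) = res {t. valid n t} (lin_ext toA x)" for x :: "'k post_lie_term"
  proof (rule lin_eqI[of "\<lambda>x. lin_ext toA (res (op_trees n) x)"])
    fix u :: "(post_lie_gen, nat) op_tree"
    show "lin_ext toA (res (op_trees n) (basis_vec u)) = (res {t. valid n t} (lin_ext toA (basis_vec u)) :: _ \<Rightarrow>\<^sub>0 'k)"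
    proof (cases "u \<in> op_trees n")
      case True
      then have "supp (toA u :: _ \<Rightarrow>\<^sub>0 'k) \<subseteq> {t. valid n t}" using valid_toA[of _ u n] by auto
      then show ?thesis using True by (simp add: res_id)
    next
      case False
      then have "supp (toA u :: _ \<Rightarrow>\<^sub>0 'k) \<inter> {t. valid n t} = {}" using valid_toA[of _ u n] by auto
      then show ?thesis using False by (simp add: res_0)
    qed
  qed (auto simp: is_lin_def)
  then have "toLW (res (op_trees n) ?x) = lmap eW (res {t. valid n t} (basis_vec t :: _ \<Rightarrow>\<^sub>0 'k))"
    by (simp only: toLW_eq toA_evW)
  then have "toLW (res (op_trees n) ?x) = basis_vec (eW t)" using assms by simp
  then show ?thesis by (intro exI[of _ "res (op_trees n) ?x"] conjI keys_res)
qed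

text \<open>Composition in the free operad is substitution, which \<open>toA_subst\<close> turns
  into evaluation and \<open>lw_comp_lin\<close> into the composition of \<open>LW\<close>.\<close>

theorem toLW_epi: "operad_epi free_binary_operad (LW :: ('k::field, nat ptree \<Rightarrow>\<^sub>0 'k) operad) (\<lambda>n. toLW)"
proof -
  let ?P = "free_binary_operad :: ('k, 'k post_lie_term) operad"
  let ?Q = "LW :: ('k, nat ptree \<Rightarrow>\<^sub>0 'k) operad"
  have sp [simp]: "opspace ?P n = free_space (op_trees n)" for n by (simp add: free_binary_operad_def)
  have sq [simp]: "opspace ?Q n = free_space (L_trees n \<union> W_trees n)" for n by (simp add: LW_def)
  have keys: "supp (toLW x) \<subseteq> L_trees n \<union> W_trees n"
    if "supp x \<subseteq> op_trees n" for n and x :: "'k post_lie_term"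
    unfolding toLW_def
  proof (intro keys_lin_ext_subset)
    fix u t assume "u \<in> supp x" "t \<in> supp (toA u :: _ \<Rightarrow>\<^sub>0 'k)"
    then have "valid n t" using valid_toA that by blast
    then have "eW t \<in> L_trees n \<union> W_trees n" using LW_basis_iff by blast
    then show "supp (basis_vec (eW t) :: _ \<Rightarrow>\<^sub>0 'k) \<subseteq> L_trees n \<union> W_trees n" by simp
  qed
  show ?thesis
  proof (rule operad_epi.intro)
    show "symmetric_operad ?P" by (rule free_operad)
  next
    fix n :: nat
    show "linear_map class_ring (opspace ?P n) (opspace ?Q n) toLW"
      unfolding sp sq by (rule is_lin_linear_map[OF is_lin_toLW keys])
    show "toLW ` opcarrier ?P n = opcarrier ?Q n"
    proof (intro equalityI subsetI)
      fix y assume "y \<in> toLW ` opcarrier ?P n"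
      then obtain x where "supp x \<subseteq> op_trees n" "y = toLW x" by auto
      then show "y \<in> opcarrier ?Q n" using keys[of x n] by simp
    next
      fix y assume "y \<in> opcarrier ?Q n"
      then have "\<forall>t\<in>supp y. \<exists>x. supp x \<subseteq> op_trees n \<and> toLW x = (basis_vec t :: _ \<Rightarrow>\<^sub>0 'k)"
        using toLW_surj_basis LW_basis_iff by (metis free_space_simps(1) sq subsetD)
      then obtain x where x: "\<forall>t\<in>supp y. supp (x t) \<subseteq> op_trees n \<and>
          toLW (x t) = (basis_vec t :: _ \<Rightarrow>\<^sub>0 'k)" by metis
      have "toLW (lin_ext x y) = lin_ext (\<lambda>t. toLW (x t)) y" by (rule lin_lin_ext[OF is_lin_toLW])
      also have "\<dots> = lin_ext basis_vec y" using x by (intro lin_ext_cong) auto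
      finally have "toLW (lin_ext x y) = y" by simp
      moreover have "supp (lin_ext x y) \<subseteq> op_trees n" using x by (intro keys_lin_ext_subset) auto
      ultimately show "y \<in> toLW ` opcarrier ?P n" by (intro image_eqI[of _ _ "lin_ext x y"]) auto
    qed
  next
    show "toLW (opunit ?P) = opunit ?Q"
      by (simp add: free_binary_operad_def LW_def toLW_def)
  next
    fix m n i and a b :: "'k post_lie_term"
    assume i: "1 \<le> i" "i \<le> m" and n: "(n::nat) \<ge> 1" and a: "a \<in> opcarrier ?P m" and b: "b \<in> opcarrier ?P n"
    have "toLW (basis_vec (op_tree_comp n i u v)) =
        bilin_ext (lw_comp n i) (toLW (basis_vec u)) (toLW (basis_vec v) :: _ \<Rightarrow>\<^sub>0 'k)"
      if u: "u \<in> op_trees m" and v: "v \<in> op_trees n" for u v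
    proof -
      let ?h = "\<lambda>j. toA (if j < i then Input j else if j = i then map_op_tree id (\<lambda>k. k + i - 1) v
          else Input (j + n - 1)) :: nat lw \<Rightarrow>\<^sub>0 'k"
      have "lmap eW (evW brL grL ?h T) = lin_ext (\<lambda>R. lw_comp n i (eW T) (eW R)) (toA v)"
        if "T \<in> supp (toA u :: _ \<Rightarrow>\<^sub>0 'k)" for T
      proof (rule lw_comp_lin[OF _ i n])
        show "valid m T" using that u valid_toA by blast
        show "valid n R" if "R \<in> supp (toA v :: _ \<Rightarrow>\<^sub>0 'k)" for R using that v valid_toA by blast
        show "?h i = lmap (map_lw (\<lambda>j. j + i - 1)) (toA v)" by (simp add: toA_map)
      qed auto
      then have "lin_ext (\<lambda>T. lmap eW (evW brL grL ?h T)) (toA u) =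
          lin_ext (\<lambda>T. lin_ext (\<lambda>R. lw_comp n i (eW T) (eW R)) (toA v)) (toA u)"
        by (rule lin_ext_cong[OF refl])
      then show ?thesis
        by (simp add: toLW_def op_tree_comp_def toA_subst lin_ext_lin_ext bilin_ext_def)
    qed
    note basis = this
    have "toLW (bilin_ext (\<lambda>T R. basis_vec (op_tree_comp n i T R)) a b) = bilin_ext (lw_comp n i) (toLW a) (toLW b)"
    proof (rule bilin_eqI[of "\<lambda>a b. toLW (bilin_ext (\<lambda>T R. basis_vec (op_tree_comp n i T R)) a b)"
          "\<lambda>a b. bilin_ext (lw_comp n i) (toLW a) (toLW b)"])
      fix r s assume "r \<in> supp a" "s \<in> supp b"
      then have "r \<in> op_trees m" "s \<in> op_trees n" using a b by auto
      from basis[OF this] show "toLW (bilin_ext (\<lambda>T R. basis_vec (op_tree_comp n i T R)) (basis_vec r) (basis_vec s)) =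
          (bilin_ext (lw_comp n i) (toLW (basis_vec r)) (toLW (basis_vec s)) :: _ \<Rightarrow>\<^sub>0 'k)"
        by (simp add: bilin_ext_basis)
    qed (simp_all add: is_lin_def is_lin_simps[OF is_lin_toLW])
    then show "toLW (opcomp ?P m n i a b) = opcomp ?Q m n i (toLW a) (toLW b)"
      by (simp add: free_binary_operad_def LW_def)
  next
    fix n \<sigma> and a :: "'k post_lie_term"
    show "toLW (opact ?P n \<sigma> a) = opact ?Q n \<sigma> (toLW a)"
      unfolding free_binary_operad_def LW_def operad.simps
      by (simp add: toLW_def lin_ext_lin_ext toA_map)
  qed
qed

lemma LW_operad: "symmetric_operad (LW :: ('k::field, nat ptree \<Rightarrow>\<^sub>0 'k) operad)"
  by (rule operad_epi.image_operad[OF toLW_epi])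

section \<open>Ideals of the free operad as ideals of the free algebra\<close>

text \<open>Trees whose inputs are labeled by an arbitrary finite set let partial compositions be replaced by
  substitutions; \<open>JJ\<close> extends an operadic ideal to such trees by relabeling.\<close>

definition op_on :: "nat set \<Rightarrow> ('g, nat) op_tree set" where
  "op_on S = {t. distinct (inputs t) \<and> set (inputs t) = S}"

lemma op_on_op_trees: "op_on {1..n} = op_trees n"
  by (simp add: op_on_def op_trees_def)

lemma inputs_nonempty [simp]: "inputs t \<noteq> []"
  by (induct t) simp_all

lemma op_on_empty: "op_on {} = {}"
  by (simp add: op_on_def)

lemma map_op_on:
  assumes "inj_on s S" "t \<in> op_on S"
  shows "map_op_tree id s t \<in> op_on (s ` S)"
  using assms by (auto simp: op_on_def inputs_map distinct_map)

definition subst1 :: "nat \<Rightarrow> ('g, nat) op_tree \<Rightarrow> ('g, nat) op_tree \<Rightarrow> ('g, nat) op_tree" where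
  "subst1 i v = op_subst (\<lambda>j. if j = i then v else Input j)"

text \<open>A single substitution on arbitrary label sets becomes a partial composition after
  relabeling, so closure properties of operadic ideals apply to it.\<close>

lemma obtain_labeling:
  assumes "finite S" "i \<in> S" "finite S'" "S' \<noteq> {}" "(S - {i}) \<inter> S' = {}"
  obtains \<sigma> \<tau> \<rho> where "bij_betw \<sigma> S {1..card S}" "bij_betw \<tau> S' {1..card S'}"
    "bij_betw \<rho> (S - {i} \<union> S') {1..card S + card S' - 1}"
    "\<And>u v :: ('g, nat) op_tree. u \<in> op_on S \<Longrightarrow> v \<in> op_on S' \<Longrightarrow>
      op_tree_comp (card S') (card S) (map_op_tree id \<sigma> u) (map_op_tree id \<tau> v) = map_op_tree id \<rho> (subst1 i v u)"
proof -
  let ?m = "card S" and ?n = "card S'"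
  have m: "?m \<ge> 1" and n: "?n \<ge> 1" using assms by (auto simp: Suc_le_eq card_gt_0_iff)
  have "card (S - {i}) = card {1..?m - 1}" using assms by simp
  then obtain s where s: "bij_betw s (S - {i}) {1..?m - 1}"
    using finite_same_card_bij[of "S - {i}" "{1..?m - 1}"] assms by auto
  obtain \<tau> where t: "bij_betw \<tau> S' {1..?n}"
    using finite_same_card_bij[of S' "{1..?n}"] assms by auto
  \<comment> \<open>The input \<open>i\<close> gets the last label, so that no other input has to be
    shifted when the block is inserted.\<close>
  define \<sigma> where "\<sigma> = s(i := ?m)"
  define \<rho> where "\<rho> j = (if j \<in> S' then \<tau> j + ?m - 1 else s j)" for j
  have sj: "s j \<in> {1..?m - 1}" if "j \<in> S" "j \<noteq> i" for j using bij_betwE[OF s] that by blast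
  have "bij_betw \<sigma> (S - {i}) {1..?m - 1}"
    using s by (rule bij_betw_cong[THEN iffD1, rotated]) (simp add: \<sigma>_def)
  moreover have "bij_betw \<sigma> {i} {?m}" by (simp add: \<sigma>_def)
  ultimately have "bij_betw \<sigma> (S - {i} \<union> {i}) ({1..?m - 1} \<union> {?m})"
    by (rule bij_betw_combine) (use m in auto)
  moreover have "S - {i} \<union> {i} = S" "{1..?m - 1} \<union> {?m} = {1..?m}" using assms(2) m by auto
  ultimately have 1: "bij_betw \<sigma> S {1..?m}" by simp
  have "bij_betw \<rho> (S - {i}) {1..?m - 1}"
    using s assms(5) by (intro bij_betw_cong[THEN iffD1, OF _ s]) (auto simp: \<rho>_def)
  moreover have "bij_betw \<rho> S' {?m..?m + ?n - 1}"
  proof -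
    have "bij_betw (\<lambda>j. j + (?m - 1)) {1..?n} {?m..?m + ?n - 1}"
      by (rule bij_betw_byWitness[of _ "\<lambda>j. j - (?m - 1)"]) (use m in auto)
    from bij_betw_trans[OF t this] show ?thesis
      by (rule bij_betw_cong[THEN iffD1, rotated]) (use m in \<open>simp add: \<rho>_def\<close>)
  qed
  ultimately have "bij_betw \<rho> (S - {i} \<union> S') ({1..?m - 1} \<union> {?m..?m + ?n - 1})"
    by (rule bij_betw_combine) (use m in auto)
  moreover have "{1..?m - 1} \<union> {?m..?m + ?n - 1} = {1..?m + ?n - 1}" using m n by auto
  ultimately have 3: "bij_betw \<rho> (S - {i} \<union> S') {1..?m + ?n - 1}" by simp
  have 4: "op_tree_comp ?n ?m (map_op_tree id \<sigma> u) (map_op_tree id \<tau> v) = map_op_tree id \<rho> (subst1 i v u)"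
    if u: "u \<in> op_on S" and v: "v \<in> op_on S'" for u v :: "('g, nat) op_tree"
    unfolding op_tree_comp_def subst1_def op_subst_map map_op_subst
  proof (rule op_subst_cong)
    fix j assume "j \<in> set (inputs u)"
    then have j: "j \<in> S" using u by (simp add: op_on_def)
    show "(if \<sigma> j < ?m then Input (\<sigma> j)
        else if \<sigma> j = ?m then map_op_tree id (\<lambda>k. k + ?m - 1) (map_op_tree id \<tau> v) else Input (\<sigma> j + ?n - 1)) =
       map_op_tree id \<rho> (if j = i then v else Input j)"
    proof (cases "j = i")
      case True
      have "map_op_tree id (\<lambda>k. \<tau> k + ?m - 1) v = map_op_tree id \<rho> v"
        using v by (intro map_op_tree_cong_inputs) (simp add: op_on_def \<rho>_def)
      then show ?thesis using True by (simp add: \<sigma>_def op_tree.map_comp o_def id_def)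
    next
      case False
      then have "j \<notin> S'" using j assms(5) by blast
      then show ?thesis using False sj[OF j False] m by (auto simp: \<sigma>_def \<rho>_def)
    qed
  qed
  show ?thesis by (rule that[OF 1 t 3 4])
qed

lemma subst1_in:
  fixes u v :: "('g, nat) op_tree"
  assumes "i \<in> S" "(S - {i}) \<inter> S' = {}" "u \<in> op_on S" "v \<in> op_on S'"
  shows "subst1 i v u \<in> op_on (S - {i} \<union> S')"
proof -
  have S: "finite S" "finite S'" "S' \<noteq> {}" using assms(3,4) by (auto simp: op_on_def)
  obtain \<sigma> \<tau> \<rho> where l: "bij_betw \<sigma> S {1..card S}" "bij_betw \<tau> S' {1..card S'}"
    "bij_betw \<rho> (S - {i} \<union> S') {1..card S + card S' - 1}"
    "\<And>u v :: ('g, nat) op_tree. u \<in> op_on S \<Longrightarrow> v \<in> op_on S' \<Longrightarrow>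
      op_tree_comp (card S') (card S) (map_op_tree id \<sigma> u) (map_op_tree id \<tau> v) = map_op_tree id \<rho> (subst1 i v u)"
    using obtain_labeling[OF S(1) assms(1) S(2,3) assms(2)] by metis
  have "map_op_tree id \<sigma> u \<in> op_trees (card S)" "map_op_tree id \<tau> v \<in> op_trees (card S')"
    using map_op_on[of \<sigma> S u] map_op_on[of \<tau> S' v] l(1,2) assms(3,4) by (auto simp: bij_betw_def op_on_op_trees[symmetric])
  moreover have "1 \<le> card S" "1 \<le> card S'" using S assms(1) by (auto simp: Suc_le_eq card_gt_0_iff)
  ultimately have "map_op_tree id \<rho> (subst1 i v u) \<in> op_trees (card S + card S' - 1)"
    unfolding l(4)[OF assms(3,4), symmetric] by (intro op_tree_comp_in) auto
  then have "distinct (inputs (subst1 i v u))" by (auto simp: op_trees_def inputs_map distinct_map)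
  moreover have "set (inputs (subst1 i v u)) = S - {i} \<union> S'"
    using assms by (auto simp: subst1_def inputs_op_subst op_on_def split: if_splits)
  ultimately show ?thesis by (simp add: op_on_def)
qed

locale free_ideal =
  fixes J :: "nat \<Rightarrow> (('g, nat) op_tree \<Rightarrow>\<^sub>0 'k::field) set"
  assumes ideal: "operad_ideal free_binary_operad J"
begin

lemma J_sub: "n \<ge> 1 \<Longrightarrow> VectorSpace.subspace class_ring (J n) (free_space (op_trees n))"
  using ideal by (simp add: operad_ideal_def free_binary_operad_def)

lemmas J_subD = subspaceD[OF J_sub]

lemma J_act: "n \<ge> 1 \<Longrightarrow> \<sigma> permutes {1..n} \<Longrightarrow> x \<in> J n \<Longrightarrow> lmap (map_op_tree id \<sigma>) x \<in> J n"
  using ideal by (simp add: operad_ideal_def free_binary_operad_def)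

lemma J_comp:
  "1 \<le> i \<Longrightarrow> i \<le> m \<Longrightarrow> n \<ge> 1 \<Longrightarrow> x \<in> J m \<Longrightarrow> v \<in> op_trees n \<Longrightarrow>
    lmap (\<lambda>u. op_tree_comp n i u v) x \<in> J (m + n - 1)"
  "1 \<le> i \<Longrightarrow> i \<le> m \<Longrightarrow> n \<ge> 1 \<Longrightarrow> u \<in> op_trees m \<Longrightarrow> x \<in> J n \<Longrightarrow>
    lmap (\<lambda>v. op_tree_comp n i u v) x \<in> J (m + n - 1)"
proof -
  assume i: "1 \<le> i" "i \<le> m" "n \<ge> 1"
  {
    assume "x \<in> J m" "v \<in> op_trees n"
    then have "opcomp free_binary_operad m n i x (basis_vec v) \<in> J (m + n - 1)"
      using ideal i by (simp add: operad_ideal_def free_binary_operad_def)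
    then show "lmap (\<lambda>u. op_tree_comp n i u v) x \<in> J (m + n - 1)"
      by (simp add: free_binary_operad_def bilin_ext_basis)
  }
  assume "u \<in> op_trees m" "x \<in> J n"
  then have "opcomp free_binary_operad m n i (basis_vec u) x \<in> J (m + n - 1)"
    using ideal i by (simp add: operad_ideal_def free_binary_operad_def)
  then show "lmap (\<lambda>v. op_tree_comp n i u v) x \<in> J (m + n - 1)"
    by (simp add: free_binary_operad_def bilin_ext_basis)
qed

definition JJ :: "nat set \<Rightarrow> (('g, nat) op_tree \<Rightarrow>\<^sub>0 'k) \<Rightarrow> bool" where
  "JJ S x \<longleftrightarrow> supp x \<subseteq> op_on S \<and>
    (\<forall>\<sigma>. bij_betw \<sigma> S {1..card S} \<longrightarrow> lmap (map_op_tree id \<sigma>) x \<in> J (card S))"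

text \<open>Two labelings of \<open>S\<close> differ by a permutation, and \<open>J\<close> is
  closed under the action; so one labeling suffices.\<close>

lemma JJ_I:
  assumes S: "finite S" "S \<noteq> {}" and x: "supp x \<subseteq> op_on S"
    and s: "bij_betw \<sigma> S {1..card S}" "lmap (map_op_tree id \<sigma>) x \<in> J (card S)"
  shows "JJ S x"
  unfolding JJ_def
proof (intro conjI allI impI)
  show "supp x \<subseteq> op_on S" by (rule x)
  fix \<sigma>' assume s': "bij_betw \<sigma>' S {1..card S}"
  define \<tau> where "\<tau> p = (if p \<in> {1..card S} then \<sigma>' (the_inv_into S \<sigma> p) else p)" for p
  have "bij_betw (\<lambda>p. \<sigma>' (the_inv_into S \<sigma> p)) {1..card S} {1..card S}"
    using bij_betw_trans[OF bij_betw_the_inv_into[OF s(1)] s'] by (simp add: o_def)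
  then have "bij_betw \<tau> {1..card S} {1..card S}"
    by (rule bij_betw_cong[THEN iffD1, rotated]) (simp add: \<tau>_def)
  moreover have "\<tau> p = p" if "p \<notin> {1..card S}" for p unfolding \<tau>_def using that by (rule if_not_P)
  ultimately have "\<tau> permutes {1..card S}" by (rule bij_imp_permutes)
  moreover have "card S \<ge> 1" using S by (simp add: Suc_le_eq card_gt_0_iff)
  ultimately have "lmap (map_op_tree id \<tau>) (lmap (map_op_tree id \<sigma>) x) \<in> J (card S)" by (intro J_act s)
  moreover have "lmap (map_op_tree id \<tau>) (lmap (map_op_tree id \<sigma>) x) = lmap (map_op_tree id \<sigma>') x"
    unfolding lin_ext_lin_ext
  proof (rule lin_ext_cong[OF refl])
    fix t assume "t \<in> supp x"
    then have t: "set (inputs t) = S" using x by (auto simp: op_on_def)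
    have "\<tau> (\<sigma> j) = \<sigma>' j" if "j \<in> S" for j
      using that bij_betwE[OF s(1)] s(1) by (simp add: \<tau>_def bij_betw_def the_inv_into_f_f)
    then have "map_op_tree id (\<lambda>j. \<tau> (\<sigma> j)) t = map_op_tree id \<sigma>' t"
      using t by (intro map_op_tree_cong_inputs) simp
    then show "lmap (map_op_tree id \<tau>) (basis_vec (map_op_tree id \<sigma> t)) = (basis_vec (map_op_tree id \<sigma>' t) :: _ \<Rightarrow>\<^sub>0 'k)"
      by (simp add: op_tree.map_comp o_def id_def)
  qed
  ultimately show "lmap (map_op_tree id \<sigma>') x \<in> J (card S)" by simp
qed

lemma JJ_subst:
  assumes "finite S" "i \<in> S" "finite S'" "S' \<noteq> {}" "(S - {i}) \<inter> S' = {}"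
  shows "JJ S x \<Longrightarrow> v \<in> op_on S' \<Longrightarrow> JJ (S - {i} \<union> S') (lmap (subst1 i v) x)"
    and "JJ S' x \<Longrightarrow> u \<in> op_on S \<Longrightarrow> JJ (S - {i} \<union> S') (lmap (\<lambda>v. subst1 i v u) x)"
proof -
  obtain \<sigma> \<tau> \<rho> where l: "bij_betw \<sigma> S {1..card S}" "bij_betw \<tau> S' {1..card S'}"
    "bij_betw \<rho> (S - {i} \<union> S') {1..card S + card S' - 1}"
    "\<And>u v :: ('g, nat) op_tree. u \<in> op_on S \<Longrightarrow> v \<in> op_on S' \<Longrightarrow>
      op_tree_comp (card S') (card S) (map_op_tree id \<sigma> u) (map_op_tree id \<tau> v) = map_op_tree id \<rho> (subst1 i v u)"
    using obtain_labeling[OF assms] by metis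
  have c: "card (S - {i} \<union> S') = card S + card S' - 1"
    using bij_betw_same_card[OF l(3)] by simp
  have pos: "1 \<le> card S" "1 \<le> card S'" using assms by (auto simp: Suc_le_eq card_gt_0_iff)
  have fin: "finite (S - {i} \<union> S')" "S - {i} \<union> S' \<noteq> {}" using assms by auto
  have tr: "map_op_tree id \<sigma> u \<in> op_trees (card S)" if "u \<in> op_on S" for u :: "('g, nat) op_tree"
    using map_op_on[of \<sigma> S u] l(1) that by (auto simp: bij_betw_def op_on_op_trees[symmetric])
  have tr': "map_op_tree id \<tau> u \<in> op_trees (card S')" if "u \<in> op_on S'" for u :: "('g, nat) op_tree"
    using map_op_on[of \<tau> S' u] l(2) that by (auto simp: bij_betw_def op_on_op_trees[symmetric])
  {
    assume x: "JJ S x" and v: "v \<in> op_on S'"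
    have k: "supp x \<subseteq> op_on S" using x by (simp add: JJ_def)
    have "lmap (\<lambda>u. op_tree_comp (card S') (card S) u (map_op_tree id \<tau> v)) (lmap (map_op_tree id \<sigma>) x) \<in> J (card S + card S' - 1)"
      using x l(1) pos by (intro J_comp tr' v) (auto simp: JJ_def)
    moreover have "lmap (\<lambda>u. op_tree_comp (card S') (card S) u (map_op_tree id \<tau> v)) (lmap (map_op_tree id \<sigma>) x) =
        lmap (map_op_tree id \<rho>) (lmap (subst1 i v) x)"
      unfolding lin_ext_lin_ext lin_ext_basis
      by (rule lin_ext_cong[OF refl]) (use k v l(4) in auto)
    ultimately have "lmap (map_op_tree id \<rho>) (lmap (subst1 i v) x) \<in> J (card (S - {i} \<union> S'))" by (simp only: c)
    moreover have "supp (lmap (subst1 i v) x :: _ \<Rightarrow>\<^sub>0 'k) \<subseteq> op_on (S - {i} \<union> S')"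
      using k v assms by (intro keys_lin_ext_subset) (auto intro!: subst1_in)
    ultimately show "JJ (S - {i} \<union> S') (lmap (subst1 i v) x)"
      using l(3) c by (intro JJ_I[OF fin, of _ \<rho>]) simp_all
  }
  assume x: "JJ S' x" and u: "u \<in> op_on S"
  have k: "supp x \<subseteq> op_on S'" using x by (simp add: JJ_def)
  have "lmap (\<lambda>v. op_tree_comp (card S') (card S) (map_op_tree id \<sigma> u) v) (lmap (map_op_tree id \<tau>) x) \<in> J (card S + card S' - 1)"
    using x l(2) pos by (intro J_comp(2) tr u) (auto simp: JJ_def)
  moreover have "lmap (\<lambda>v. op_tree_comp (card S') (card S) (map_op_tree id \<sigma> u) v) (lmap (map_op_tree id \<tau>) x) =
      lmap (map_op_tree id \<rho>) (lmap (\<lambda>v. subst1 i v u) x)"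
    unfolding lin_ext_lin_ext lin_ext_basis
    by (rule lin_ext_cong[OF refl]) (use k u l(4) in auto)
  ultimately have "lmap (map_op_tree id \<rho>) (lmap (\<lambda>v. subst1 i v u) x) \<in> J (card (S - {i} \<union> S'))" by (simp only: c)
  moreover have "supp (lmap (\<lambda>v. subst1 i v u) x :: _ \<Rightarrow>\<^sub>0 'k) \<subseteq> op_on (S - {i} \<union> S')"
    using k u assms by (intro keys_lin_ext_subset) (auto intro!: subst1_in)
  ultimately show "JJ (S - {i} \<union> S') (lmap (\<lambda>v. subst1 i v u) x)"
    using l(3) c by (intro JJ_I[OF fin, of _ \<rho>]) simp_all
qed

lemma JJ_linear:
  assumes "finite S" "S \<noteq> {}"
  shows "JJ S 0" "JJ S x \<Longrightarrow> JJ S y \<Longrightarrow> JJ S (x + y)" "JJ S x \<Longrightarrow> JJ S (scal c x)"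
proof -
  have "card S \<ge> 1" using assms by (simp add: Suc_le_eq card_gt_0_iff)
  note J = J_subD[OF this]
  show "JJ S 0" "JJ S x \<Longrightarrow> JJ S y \<Longrightarrow> JJ S (x + y)" "JJ S x \<Longrightarrow> JJ S (scal c x)"
    using J by (auto simp: JJ_def dest: keys_subset_closed(1)[THEN subsetD] keys_subset_closed(3)[THEN subsetD])
qed

text \<open>The product of \<open>u\<close> with a tree \<open>y\<close> is the substitution of
  \<open>u\<close> for a fresh input \<open>a\<close> in the product of \<open>Input a\<close> and
  \<open>y\<close>.\<close>

lemma JJ_App:
  assumes S: "finite S" "S \<noteq> {}" "S \<inter> set (inputs y) = {}" and y: "distinct (inputs y)" and x: "JJ S x"
  shows "JJ (S \<union> set (inputs y)) (lmap (\<lambda>u. App g u y) x)"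
    and "JJ (S \<union> set (inputs y)) (lmap (\<lambda>u. App g y u) x)"
proof -
  let ?Y = "set (inputs y)"
  obtain a where a: "a \<notin> S \<union> ?Y" using ex_new_if_finite[of "S \<union> ?Y"] S by auto
  have s: "subst1 a v y = y" for v
    unfolding subst1_def using a by (intro op_subst_id) auto
  have eq: "insert a ?Y - {a} \<union> S = S \<union> ?Y" using a by auto
  have T: "App g (Input a) y \<in> op_on (insert a ?Y)" "App g y (Input a) \<in> op_on (insert a ?Y)"
    using y a by (auto simp: op_on_def)
  have "subst1 a v (App g (Input a) y) = App g v y" "subst1 a v (App g y (Input a)) = App g y v" for v
    using s[of v] by (simp_all add: subst1_def)
  then show "JJ (S \<union> ?Y) (lmap (\<lambda>u. App g u y) x)" "JJ (S \<union> ?Y) (lmap (\<lambda>u. App g y u) x)"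
    using JJ_subst(2)[of "insert a ?Y" a S x, OF _ _ _ _ _ x T(1)] JJ_subst(2)[of "insert a ?Y" a S x, OF _ _ _ _ _ x T(2)]
      S a unfolding eq by auto
qed

text \<open>Substitution is carried out one input at a time. To avoid clashes the inputs are first
  renamed beyond all labels of the \<open>h j\<close>.\<close>

lemma JJ_substitute:
  assumes r: "r \<in> J k" and k: "k \<ge> 1"
    and h: "distinct (concat (map (\<lambda>j. inputs (h j)) [1..<Suc k]))"
  shows "JJ (\<Union>j\<in>{1..k}. set (inputs (h j))) (lmap (op_subst h) r)"
proof -
  let ?H = "\<lambda>j. set (inputs (h j))"
  have hd: "distinct (inputs (h j))" if "j \<in> {1..k}" for j
    using h that by (auto simp: distinct_concat_iff simp del: upt_Suc)
  have hdisj: "?H i \<inter> ?H j = {}" if "i \<in> {1..k}" "j \<in> {1..k}" "i < j" for i j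
  proof -
    have "distinct (concat (map (\<lambda>j. inputs (h j)) [1..<Suc k]))" by (rule h)
    from distinct_concat_map_nth[OF this, of "i - 1" "j - 1"] that show ?thesis by (simp del: upt_Suc)
  qed
  define U where "U = (\<Union>j\<in>{1..k}. ?H j)"
  define N where "N = Max U"
  have N: "p \<le> N" if "p \<in> ?H j" "j \<in> {1..k}" for p j
    unfolding N_def using that by (intro Max_ge) (auto simp: U_def)
  \<comment> \<open>Adding \<open>N\<close>, the largest label in the substituted trees, makes every
    \<open>a j\<close> with \<open>j \<ge> 1\<close> fresh.\<close>
  define a where "a j = j + N" for j
  \<comment> \<open>After \<open>l\<close> steps the labels are those of \<open>h 1\<close> up to
    \<open>h l\<close> and the renamed inputs still waiting.\<close>
  define S where "S l = a ` {Suc l..k} \<union> (\<Union>j\<in>{1..l}. ?H j)" for l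
  define f where "f l = (\<lambda>j. if j \<le> l then h j else Input (a j))" for l
  have rk: "supp r \<subseteq> op_trees k" by (rule J_subD(1)[OF k r])
  have "JJ (S l) (lmap (op_subst (f l)) r)" if "l \<le> k" for l
    using that
  proof (induct l)
    case 0
    have S0: "S 0 = a ` {1..k}" by (simp add: S_def)
    have inj: "inj_on a {1..k}" by (simp add: a_def inj_on_def)
    have sub: "op_subst (f 0) t = map_op_tree id a t" if "t \<in> op_trees k" for t :: "('g, nat) op_tree"
      unfolding op_subst_Input[symmetric] using that by (intro op_subst_cong) (auto simp: f_def op_trees_def)
    have card: "card (S 0) = k" unfolding S0 card_image[OF inj] by simp
    have bij: "bij_betw (\<lambda>p. p - N) (S 0) {1..card (S 0)}"
      unfolding card S0 by (rule bij_betw_byWitness[of _ a]) (auto simp: a_def)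
    have eq: "lmap (map_op_tree id (\<lambda>p. p - N)) (lmap (op_subst (f 0)) r) = r"
    proof -
      have "lmap (map_op_tree id (\<lambda>p. p - N)) (lmap (op_subst (f 0)) r) = lin_ext basis_vec r"
        unfolding lin_ext_lin_ext
      proof (rule lin_ext_cong[OF refl])
        fix t assume "t \<in> supp r"
        then have "t \<in> op_trees k" using rk by blast
        have "(\<lambda>p. p - N) \<circ> a = id" by (simp add: a_def fun_eq_iff)
        then show "lmap (map_op_tree id (\<lambda>p. p - N)) (basis_vec (op_subst (f 0) t)) = (basis_vec t :: _ \<Rightarrow>\<^sub>0 'k)"
          using sub[OF \<open>t \<in> op_trees k\<close>] by (simp add: op_tree.map_comp op_tree.map_id)
      qed
      then show ?thesis by simp
    qed
    have keys0: "supp (lmap (op_subst (f 0)) r :: _ \<Rightarrow>\<^sub>0 'k) \<subseteq> op_on (S 0)"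
    proof (intro keys_lin_ext_subset)
      fix t assume "t \<in> supp r"
      then have "t \<in> op_on {1..k}" using rk unfolding op_on_op_trees by blast
      from map_op_on[OF inj this] have "map_op_tree id a t \<in> op_on (S 0)" by (simp add: S0)
      moreover have "t \<in> op_trees k" using \<open>t \<in> op_on {1..k}\<close> by (simp only: op_on_op_trees)
      ultimately show "supp (basis_vec (op_subst (f 0) t) :: _ \<Rightarrow>\<^sub>0 'k) \<subseteq> op_on (S 0)"
        using sub by simp
    qed
    have mem: "lmap (map_op_tree id (\<lambda>p. p - N)) (lmap (op_subst (f 0)) r) \<in> J (card (S 0))"
      unfolding eq card by (rule r)
    show ?case by (rule JJ_I[OF _ _ keys0 bij mem]) (use k in \<open>simp_all add: S0\<close>)
  next
    case (Suc l)
    let ?i = "a (Suc l)"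
    have l: "Suc l \<in> {1..k}" "l \<le> k" using Suc(2) by auto
    have fresh: "a j \<notin> ?H i" if "i \<in> {1..k}" "j \<ge> 1" for i j
      using N[of "a j" i] that by (auto simp: a_def)
    have i: "?i \<in> S l" using l by (auto simp: S_def)
    have a_image: "a ` {Suc l..k} - {?i} = a ` {Suc (Suc l)..k}" by (auto simp: a_def)
    have SS: "S l - {?i} = a ` {Suc (Suc l)..k} \<union> (\<Union>j\<in>{1..l}. ?H j)"
    proof -
      have "?i \<notin> (\<Union>j\<in>{1..l}. ?H j)" using fresh l by auto
      then show ?thesis unfolding S_def Un_Diff a_image by simp
    qed
    have SSuc: "S l - {?i} \<union> ?H (Suc l) = S (Suc l)"
      unfolding SS by (auto simp: S_def atLeastAtMostSuc_conv)
    have disj: "(S l - {?i}) \<inter> ?H (Suc l) = {}"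
    proof -
      have "a ` {Suc (Suc l)..k} \<inter> ?H (Suc l) = {}" using fresh[OF l(1)] by auto
      moreover have "?H j \<inter> ?H (Suc l) = {}" if "j \<in> {1..l}" for j
        using that l by (intro hdisj) auto
      ultimately show ?thesis unfolding SS by blast
    qed
    have "JJ (S l - {?i} \<union> ?H (Suc l)) (lmap (subst1 ?i (h (Suc l))) (lmap (op_subst (f l)) r))"
      using hd[OF l(1)] by (intro JJ_subst(1) Suc(1) disj i l) (auto simp: S_def op_on_def)
    moreover have "lmap (subst1 ?i (h (Suc l))) (lmap (op_subst (f l)) r) = lmap (op_subst (f (Suc l))) r"
      unfolding lin_ext_lin_ext lin_ext_basis
    proof (rule lin_ext_cong[OF refl])
      fix t assume "t \<in> supp r"
      then have t: "set (inputs t) = {1..k}" using rk by (auto simp: op_trees_def)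
      have "subst1 ?i (h (Suc l)) (op_subst (f l) t) = op_subst (f (Suc l)) t"
        unfolding subst1_def op_subst_subst
      proof (rule op_subst_cong)
        fix j assume j: "j \<in> set (inputs t)"
        have "op_subst (\<lambda>p. if p = ?i then h (Suc l) else Input p) (h j) = h j"
          using fresh[of j "Suc l"] j t by (intro op_subst_id) auto
        then show "op_subst (\<lambda>p. if p = ?i then h (Suc l) else Input p) (f l j) = f (Suc l) j"
          by (auto simp: f_def a_def le_Suc_eq)
      qed
      then show "(basis_vec (subst1 ?i (h (Suc l)) (op_subst (f l) t)) :: _ \<Rightarrow>\<^sub>0 'k) = basis_vec (op_subst (f (Suc l)) t)"
        by simp
    qed
    ultimately show ?case unfolding SSuc by simp
  qed
  from this[of k] have "JJ (S k) (lmap (op_subst (f k)) r)" by simp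
  moreover have "lmap (op_subst (f k)) r = lmap (op_subst h) r"
  proof (rule lin_ext_cong[OF refl])
    fix t assume "t \<in> supp r"
    then have "set (inputs t) = {1..k}" using rk by (auto simp: op_trees_def)
    then have "op_subst (f k) t = op_subst h t" by (intro op_subst_cong) (auto simp: f_def)
    then show "(basis_vec (op_subst (f k) t) :: _ \<Rightarrow>\<^sub>0 'k) = basis_vec (op_subst h t)" by simp
  qed
  ultimately show ?thesis by (simp add: S_def)
qed

text \<open>Each multilinear component is tested by \<open>JJ\<close>. Trees with a repeated input
  lie in no \<open>op_on S\<close> and are unrestricted; this makes \<open>K\<close> an ideal for
  products of arbitrary terms, whose inputs may overlap.\<close>

definition K :: "(('g, nat) op_tree \<Rightarrow>\<^sub>0 'k) set" where
  "K = {x. \<forall>S. finite S \<and> S \<noteq> {} \<longrightarrow> JJ S (res (op_on S) x)}"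

lemma K_linear: "0 \<in> K" "x \<in> K \<Longrightarrow> y \<in> K \<Longrightarrow> x + y \<in> K" "x \<in> K \<Longrightarrow> scal c x \<in> K"
  by (auto simp: K_def JJ_linear)

lemma K_lin_ext: "(\<And>t. t \<in> supp x \<Longrightarrow> f t \<in> K) \<Longrightarrow> lin_ext f x \<in> K"
proof -
  have sum: "(\<And>s. s \<in> S \<Longrightarrow> g s \<in> K) \<Longrightarrow> sum g S \<in> K" for g :: "_ \<Rightarrow> _" and S
    by (induct S rule: infinite_finite_induct) (auto intro: K_linear)
  show "(\<And>t. t \<in> supp x \<Longrightarrow> f t \<in> K) \<Longrightarrow> lin_ext f x \<in> K"
    unfolding lin_ext_def by (intro sum K_linear)
qed

text \<open>The component of the product on \<open>S\<close> comes from the component of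
  \<open>x\<close> on \<open>S\<close> without the inputs of \<open>y\<close>; it vanishes if
  \<open>y\<close> does not fit into \<open>S\<close> with room to spare.\<close>

lemma K_App:
  assumes x: "x \<in> K"
  shows "lmap (\<lambda>u. App g u y) x \<in> K" "lmap (\<lambda>u. App g y u) x \<in> K"
proof -
  let ?Y = "set (inputs y)"
  have on: "App g u y \<in> op_on S \<longleftrightarrow> distinct (inputs y) \<and> ?Y \<subseteq> S \<and> u \<in> op_on (S - ?Y)"
    "App g y u \<in> op_on S \<longleftrightarrow> distinct (inputs y) \<and> ?Y \<subseteq> S \<and> u \<in> op_on (S - ?Y)" for u S
    by (auto simp: op_on_def)
  have *: "JJ S (res (op_on S) (lmap (\<lambda>u. App g u y) x)) \<and> JJ S (res (op_on S) (lmap (\<lambda>u. App g y u) x))"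
    if S: "finite S" "S \<noteq> {}" for S
  proof (cases "distinct (inputs y) \<and> ?Y \<subseteq> S \<and> S - ?Y \<noteq> {}")
    case True
    have r: "res (op_on S) (lmap (\<lambda>u. App g u y) x) = lmap (\<lambda>u. App g u y) (res (op_on (S - ?Y)) x)"
      "res (op_on S) (lmap (\<lambda>u. App g y u) x) = lmap (\<lambda>u. App g y u) (res (op_on (S - ?Y)) x)"
      using True by (auto simp: res_def lin_ext_lin_ext on intro!: lin_ext_cong)
    have "S - ?Y \<union> ?Y = S" using True by auto
    moreover have "JJ (S - ?Y) (res (op_on (S - ?Y)) x)" using x S True by (simp add: K_def)
    ultimately show ?thesis unfolding r using JJ_App[of "S - ?Y" y "res (op_on (S - ?Y)) x" g] True S by auto
  next
    case False
    then have "App g u y \<notin> op_on S" "App g y u \<notin> op_on S" for u unfolding on by (auto simp: op_on_empty)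
    then have "res (op_on S) (lmap (\<lambda>u. App g u y) x) = 0" "res (op_on S) (lmap (\<lambda>u. App g y u) x) = 0"
      by (simp_all add: res_def lin_ext_lin_ext)
    then show ?thesis using JJ_linear(1)[OF S] by simp
  qed
  then show "lmap (\<lambda>u. App g u y) x \<in> K" "lmap (\<lambda>u. App g y u) x \<in> K" by (simp_all add: K_def)
qed

text \<open>Each tree of \<open>r\<close> uses every input once, so all substituted trees have the
  same multiset of labels. Either it has a repetition and there is no multilinear component, or it
  is a set and \<open>JJ_substitute\<close> applies.\<close>

lemma K_substitute:
  assumes r: "r \<in> J k" and k: "k \<ge> 1"
  shows "lmap (op_subst h) r \<in> K"
proof -
  have rk: "supp r \<subseteq> op_trees k" by (rule J_subD(1)[OF k r])
  let ?l = "concat (map (\<lambda>j. inputs (h j)) [1..<Suc k])"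
  have m: "mset (inputs (op_subst h t)) = mset ?l" if "t \<in> op_trees k" for t :: "('g, nat) op_tree"
  proof -
    have "mset (inputs t) = mset [1..<Suc k]"
      unfolding mset_eq_upt_iff using that by (simp add: op_trees_def)
    then have "image_mset (\<lambda>j. mset (inputs (h j))) (mset (inputs t)) =
        image_mset (\<lambda>j. mset (inputs (h j))) (mset [1..<Suc k])" by (simp only:)
    moreover have "mset (concat (map g xs)) = sum_mset (image_mset (\<lambda>j. mset (g j)) (mset xs))"
      for g :: "nat \<Rightarrow> nat list" and xs by (induct xs) simp_all
    ultimately show ?thesis unfolding inputs_op_subst by (simp only:)
  qed
  have "set [1..<Suc k] = {1..k}" by (simp only: set_upt atLeastLessThanSuc_atLeastAtMost)
  then have sl: "set ?l = (\<Union>j\<in>{1..k}. set (inputs (h j)))"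
    by (simp only: set_concat set_map image_image)
  have on: "op_subst h t \<in> op_on S \<longleftrightarrow> distinct ?l \<and> set ?l = S" if "t \<in> op_trees k" for t :: "('g, nat) op_tree" and S
    unfolding op_on_def mem_Collect_eq
    using mset_eq_imp_distinct_iff[OF m[OF that]] mset_eq_setD[OF m[OF that]] by metis
  have "JJ S (res (op_on S) (lmap (op_subst h) r))" if S: "finite S" "S \<noteq> {}" for S
  proof (cases "distinct ?l \<and> set ?l = S")
    case True
    then have "supp (lmap (op_subst h) r :: _ \<Rightarrow>\<^sub>0 'k) \<subseteq> op_on S"
      using rk on by (intro keys_lin_ext_subset) auto
    then have "res (op_on S) (lmap (op_subst h) r) = lmap (op_subst h) r" by (rule res_id)
    moreover have "JJ S (lmap (op_subst h) r)"
      using JJ_substitute[OF r k, of h] True by (simp only: sl)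
    ultimately show ?thesis by simp
  next
    case False
    then have "op_subst h t \<notin> op_on S" if "t \<in> op_trees k" for t :: "('g, nat) op_tree"
      using on[OF that] by blast
    then have "lmap (op_subst h) r = res (- op_on S) (lmap (op_subst h) r)"
      using rk by (intro res_id[symmetric] keys_lin_ext_subset) auto
    then have "res (op_on S) (lmap (op_subst h) r) = 0"
      using keys_res[of "- op_on S" "lmap (op_subst h) r"] by (intro res_0) auto
    then show ?thesis using JJ_linear(1)[OF S] by simp
  qed
  then show ?thesis by (simp add: K_def)
qed

text \<open>The return from the algebra to the operad: in arity \<open>n\<close> the identity is a
  labeling of \<open>{1..n}\<close>.\<close>

lemma K_arity:
  assumes "x \<in> K" "supp x \<subseteq> op_trees n" "n \<ge> 1"
  shows "x \<in> J n"
proof -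
  have "JJ {1..n} (res (op_on {1..n}) x)" using assms(1,3) unfolding K_def by auto
  then have "JJ {1..n} x" unfolding op_on_op_trees res_id[OF assms(2)] .
  then have "lmap (map_op_tree id id) x \<in> J n" by (simp add: JJ_def bij_betw_def)
  then show ?thesis by (simp add: op_tree.map_id)
qed

end

section \<open>The isomorphism\<close>

abbreviation antisymmetry :: "'k::field post_lie_term \<Rightarrow> 'k post_lie_term \<Rightarrow> 'k post_lie_term" where
  "antisymmetry x y \<equiv> br x y + br y x"

abbreviation jacobi ::
    "'k::field post_lie_term \<Rightarrow> 'k post_lie_term \<Rightarrow> 'k post_lie_term \<Rightarrow> 'k post_lie_term" where
  "jacobi x y z \<equiv> br x (br y z) + br y (br z x) + br z (br x y)"

text \<open>The form of the Jacobi identity stating that bracketing with \<open>x\<close> is a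
  derivation of the bracket, which is the one in \<open>psb_relations\<close>.\<close>

abbreviation leibniz ::
    "'k::field post_lie_term \<Rightarrow> 'k post_lie_term \<Rightarrow> 'k post_lie_term \<Rightarrow> 'k post_lie_term" where
  "leibniz x y z \<equiv> br x (br y z) - br (br x y) z - br y (br x z)"

abbreviation derivation_rel ::
    "'k::field post_lie_term \<Rightarrow> 'k post_lie_term \<Rightarrow> 'k post_lie_term \<Rightarrow> 'k post_lie_term" where
  "derivation_rel x y z \<equiv> z \<rhd> br x y - (br (z \<rhd> x) y + br x (z \<rhd> y))"

abbreviation associator_rel ::
    "'k::field post_lie_term \<Rightarrow> 'k post_lie_term \<Rightarrow> 'k post_lie_term \<Rightarrow> 'k post_lie_term" where
  "associator_rel x y z \<equiv> br x y \<rhd> z - (assoc x y z - assoc y x z)"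

lemma post_lie_relations_eq:
  "post_lie_relations n = (if n = 2 then {antisymmetry (var 1) (var 2)}
    else if n = 3 then {jacobi (var 1) (var 2) (var 3), derivation_rel (var 1) (var 2) (var 3),
      associator_rel (var 1) (var 2) (var 3)} else {})"
  by (simp add: post_lie_relations_def Let_def)

lemma br_basis [simp]: "br (basis_vec s) (basis_vec t) = basis_vec (App Bracket s t)"
  by (simp add: br_def bilin_ext_basis)

lemma tri_basis [simp]: "basis_vec s \<rhd> basis_vec t = basis_vec (App Triangle s t)"
  by (simp add: tri_def bilin_ext_basis)

lemma sub_br: "lmap (op_subst h) (br x y) = br (lmap (op_subst h) x) (lmap (op_subst h) y)"
  by (simp add: br_def bilin_ext_def lin_ext_lin_ext)

lemma sub_tri: "lmap (op_subst h) (x \<rhd> y) = lmap (op_subst h) x \<rhd> lmap (op_subst h) y"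
  by (simp add: tri_def bilin_ext_def lin_ext_lin_ext)

lemma sub_var: "lmap (op_subst h) (var j) = basis_vec (h j)"
  by (simp add: var_def)

section \<open>Relations in the free algebra modulo an operadic ideal\<close>

locale post_lie_ideal = free_ideal J
  for J :: "nat \<Rightarrow> 'k::field post_lie_term set"
begin

lemma K_br: "x \<in> K \<Longrightarrow> br x y \<in> K" "x \<in> K \<Longrightarrow> br y x \<in> K"
proof -
  assume x: "x \<in> K"
  have "br x y = lin_ext (\<lambda>t. lmap (\<lambda>u. App Bracket u t) x) y"
    unfolding br_def bilin_ext_def by (rule lin_ext_swap)
  then show "br x y \<in> K" using K_App(1)[OF x] by (simp add: K_lin_ext)
  have "br y x = lin_ext (\<lambda>t. lmap (\<lambda>u. App Bracket t u) x) y" by (simp add: br_def bilin_ext_def)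
  then show "br y x \<in> K" using K_App(2)[OF x] by (simp add: K_lin_ext)
qed

lemma K_tri: "x \<in> K \<Longrightarrow> x \<rhd> y \<in> K" "x \<in> K \<Longrightarrow> y \<rhd> x \<in> K"
proof -
  assume x: "x \<in> K"
  have "x \<rhd> y = lin_ext (\<lambda>t. lmap (\<lambda>u. App Triangle u t) x) y"
    unfolding tri_def bilin_ext_def by (rule lin_ext_swap)
  then show "x \<rhd> y \<in> K" using K_App(1)[OF x] by (simp add: K_lin_ext)
  have "y \<rhd> x = lin_ext (\<lambda>t. lmap (\<lambda>u. App Triangle t u) x) y" by (simp add: tri_def bilin_ext_def)
  then show "y \<rhd> x \<in> K" using K_App(2)[OF x] by (simp add: K_lin_ext)
qed

lemma K_trilinear:
  assumes "\<And>y z. is_lin (\<lambda>x. F x y z)" "\<And>x z. is_lin (\<lambda>y. F x y z)" "\<And>x y. is_lin (\<lambda>z. F x y z)"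
    and "\<And>r s t. F (basis_vec r) (basis_vec s) (basis_vec t) \<in> K"
  shows "F x y z \<in> K"
proof -
  have "F x y z = lin_ext (\<lambda>r. lin_ext (\<lambda>s. lin_ext (\<lambda>t. F (basis_vec r) (basis_vec s) (basis_vec t)) z) y) x"
    by (simp only: lin_eq_lin_ext[OF assms(1), symmetric] lin_eq_lin_ext[OF assms(2), symmetric]
        lin_eq_lin_ext[OF assms(3), symmetric])
  also have "\<dots> \<in> K" by (intro K_lin_ext assms(4))
  finally show ?thesis .
qed

text \<open>By trilinearity it suffices to treat trees, and an instance on trees is a substitution
  into the relation on variables.\<close>

lemma K_relation:
  assumes "F (var 1) (var 2) (var 3) \<in> J k" "k \<ge> 1"
    and "\<And>h x y z. lmap (op_subst h) (F x y z) =
      F (lmap (op_subst h) x) (lmap (op_subst h) y) (lmap (op_subst h) z)"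
    and "\<And>y z. is_lin (\<lambda>x. F x y z)" "\<And>x z. is_lin (\<lambda>y. F x y z)" "\<And>x y. is_lin (\<lambda>z. F x y z)"
  shows "F x y z \<in> K"
proof (rule K_trilinear[OF assms(4-6)])
  fix r s t :: "(post_lie_gen, nat) op_tree"
  let ?h = "\<lambda>j::nat. if j = 1 then r else if j = 2 then s else t"
  have "lmap (op_subst ?h) (F (var 1) (var 2) (var 3)) \<in> K" by (rule K_substitute[OF assms(1,2)])
  then show "F (basis_vec r) (basis_vec s) (basis_vec t) \<in> K" unfolding assms(3) sub_var by simp
qed

lemma K_antisymmetry:
  assumes "antisymmetry (var 1) (var 2) \<in> J 2"
  shows "antisymmetry x y \<in> K"
proof -
  have b: "antisymmetry (basis_vec r) (basis_vec s) \<in> K" for r s :: "(post_lie_gen, nat) op_tree"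
  proof -
    let ?h = "\<lambda>j::nat. if j = 1 then r else s"
    have "lmap (op_subst ?h) (antisymmetry (var 1) (var 2)) \<in> K" by (rule K_substitute[OF assms]) simp
    then show ?thesis by (simp add: sub_br sub_var)
  qed
  have "antisymmetry x y = lin_ext (\<lambda>r. lin_ext (\<lambda>s. antisymmetry (basis_vec r) (basis_vec s)) y) x"
  proof (rule bilin_eqI[of "\<lambda>x y. antisymmetry x y"
        "\<lambda>x y. lin_ext (\<lambda>r. lin_ext (\<lambda>s. antisymmetry (basis_vec r) (basis_vec s)) y) x"])
  qed (auto simp: is_lin_def br_def simp del: br_basis)
  also have "\<dots> \<in> K" by (intro K_lin_ext b)
  finally show ?thesis .
qed

lemma jacobi_iff_leibniz:
  assumes a: "antisymmetry (var 1) (var 2) \<in> J 2"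
  shows "jacobi (var 1) (var 2) (var 3) \<in> J 3 \<longleftrightarrow> leibniz (var 1) (var 2) (var 3) \<in> J 3"
proof -
  let ?x = "var 1 :: 'k post_lie_term" and ?y = "var 2 :: 'k post_lie_term" and ?z = "var 3 :: 'k post_lie_term"
  \<comment> \<open>The difference of the two forms consists of two instances of antisymmetry: one
    inside a bracket with \<open>?y\<close>, the other with \<open>br ?x ?y\<close> as an
    argument.\<close>
  have "br ?y (antisymmetry ?z ?x) + antisymmetry ?z (br ?x ?y) \<in> K"
    by (intro K_linear K_br K_antisymmetry a)
  also have "br ?y (antisymmetry ?z ?x) + antisymmetry ?z (br ?x ?y) = jacobi ?x ?y ?z - leibniz ?x ?y ?z"
    by (simp add: br_def algebra_simps)
  finally have K: "jacobi ?x ?y ?z - leibniz ?x ?y ?z \<in> K" .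
  have k: "supp (jacobi ?x ?y ?z - leibniz ?x ?y ?z) \<subseteq> op_trees 3"
    unfolding var_def br_basis by (intro keys_subset_closed) (auto simp: op_trees_def)
  have d: "jacobi ?x ?y ?z - leibniz ?x ?y ?z \<in> J 3" by (rule K_arity[OF K k]) simp
  have "u \<in> J 3 \<longleftrightarrow> v \<in> J 3" if "u - v \<in> J 3" for u v
    using J_subD(3)[of 3 v "u - v"] J_subD(6)[of 3 u "u - v"] that by auto
  then show ?thesis using d by blast
qed

text \<open>Evaluation of bracketed trees in the free algebra is, modulo \<open>K\<close>, left
  inverse to \<open>toA\<close>; so an element killed by \<open>toLW\<close> lies in
  \<open>K\<close>. The two mixed relations are what makes this evaluation a homomorphism modulo
  \<open>K\<close>.\<close>

lemma ker_toLW: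
  assumes d: "derivation_rel (var 1) (var 2) (var 3) \<in> J 3" and r: "associator_rel (var 1) (var 2) (var 3) \<in> J 3"
    and x: "supp x \<subseteq> op_trees n" "n \<ge> 1" "toLW x = 0"
  shows "x \<in> J n"
proof -
  have K_d: "derivation_rel x y z \<in> K" for x y z
    by (rule K_relation[where F = derivation_rel, OF d])
      (simp_all add: sub_br sub_tri is_lin_def F.ops_simps)
  have K_r: "associator_rel x y z \<in> K" for x y z
    by (rule K_relation[where F = associator_rel, OF r])
      (simp_all add: sub_br sub_tri is_lin_def F.ops_simps assoc_def)
  interpret Q: algebra_modulo br tri K
    by unfold_locales
      (use K_linear K_br K_tri K_d K_r in \<open>auto simp: assoc_def\<close>)
  have cg: "Q.cg (lin_ext (evW br tri var) (toA u)) (basis_vec u)" for u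
  proof (induct u)
    case (Input j)
    then show ?case by (simp add: var_def)
  next
    case (App g s t)
    show ?case
    proof (cases g)
      case Bracket
      have "Q.cg (br (lin_ext (evW br tri var) (toA s)) (lin_ext (evW br tri var) (toA t)))
          (br (basis_vec s) (basis_vec t))"
        by (intro Q.cg_bk App)
      then show ?thesis by (simp add: Bracket Q.evW_brL)
    next
      case Triangle
      have "Q.cg (lin_ext (evW br tri var) (grL (toA s) (toA t)))
          (lin_ext (evW br tri var) (toA s) \<rhd> lin_ext (evW br tri var) (toA t))"
        by (rule Q.evW_grL)
      also have "Q.cg \<dots> (basis_vec s \<rhd> basis_vec t)"
        by (intro Q.cg_tri App)
      finally show ?thesis by (simp add: Triangle)
    qed
  qed
  \<comment> \<open>As \<open>eW\<close> is injective, vanishing under \<open>toLW\<close> means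
    vanishing already as a combination of bracketed trees.\<close>
  have "inv_into UNIV eW (eW t) = t" for t :: "nat lw" by (rule inv_f_f) (simp add: inj_def eW_inject)
  then have "lin_ext toA x = lmap (inv_into UNIV eW) (toLW x)"
    by (simp add: toLW_def lin_ext_lin_ext)
  then have "lin_ext (\<lambda>u. lin_ext (evW br tri var) (toA u)) x = 0"
    using x(3) by (simp add: lin_ext_lin_ext[symmetric])
  then have "Q.cg 0 (lin_ext basis_vec x)"
    using Q.cg_lin_ext[of x "\<lambda>u. lin_ext (evW br tri var) (toA u)" basis_vec] cg by simp
  then have "x \<in> K" using Q.cg_sym Q.cg_def by fastforce
  then show ?thesis using x by (intro K_arity)
qed

end

lemma toLW_br_var:
  "toLW (antisymmetry (var 1) (var 2)) =
    basis_vec (corolla (leaf 1) (leaf 2)) + basis_vec (corolla (leaf 2) (leaf 1))"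
  "toLW (leibniz (var 1) (var 2) (var 3)) =
    basis_vec (corolla (leaf 1) (corolla (leaf 2) (leaf 3)))
        - basis_vec (corolla (corolla (leaf 1) (leaf 2)) (leaf 3))
        - basis_vec (corolla (leaf 2) (corolla (leaf 1) (leaf 3)))"
  by (simp_all add: toLW_def var_def brL_basis)

lemma toLW_relations:
  "toLW (derivation_rel x y z) = 0" "toLW (associator_rel x y z) = 0"
  by (simp_all add: toLW_eq toA_br toA_tri grL_brL grL_brL_left assoc_def)

lemma relations_arity:
  "supp (antisymmetry (var 1) (var 2) :: 'k::field post_lie_term) \<subseteq> op_trees 2"
  "supp (jacobi (var 1) (var 2) (var 3) :: 'k post_lie_term) \<subseteq> op_trees 3"
  "supp (leibniz (var 1) (var 2) (var 3) :: 'k post_lie_term) \<subseteq> op_trees 3"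
  "supp (derivation_rel (var 1) (var 2) (var 3) :: 'k post_lie_term) \<subseteq> op_trees 3"
  "supp (associator_rel (var 1) (var 2) (var 3) :: 'k post_lie_term) \<subseteq> op_trees 3"
  unfolding var_def br_basis tri_basis assoc_def
  by (intro keys_subset_closed; auto simp: op_trees_def)+

theorem theorem11:
  shows "operad_isomorphic
           (PSB :: ('k::field_char_0, (nat ptree \<Rightarrow>\<^sub>0 'k) set) operad)
           (PostLie :: ('k, 'k post_lie_term set) operad)"
proof -
  let ?P = "free_binary_operad :: ('k, 'k post_lie_term) operad"
  let ?Q = "LW :: ('k, nat ptree \<Rightarrow>\<^sub>0 'k) operad"
  define J where "J = generated_ideal ?P post_lie_relations"
  define I where "I = generated_ideal ?Q psb_relations"
  interpret epi: operad_epi ?P ?Q "\<lambda>n. toLW" by (rule toLW_epi)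
  have sp: "opspace ?P n = free_space (op_trees n)" for n by (simp add: free_binary_operad_def)
  have sq: "opspace ?Q n = free_space (L_trees n \<union> W_trees n)" for n by (simp add: LW_def)
  have Jid: "operad_ideal ?P J"
    unfolding J_def
    by (rule generated_ideal_ideal[OF free_operad sp]) (auto simp: post_lie_relations_eq sp relations_arity[THEN subsetD] split: if_splits)
  interpret J: post_lie_ideal J by unfold_locales (rule Jid)
  \<comment> \<open>Both generators of the ideal of \<open>LW\<close> are images of relations in the
    bracket alone.\<close>
  have psb: "psb_relations n = (if n = 2 then {toLW (antisymmetry (var 1) (var 2))}
      else if n = 3 then {toLW (leibniz (var 1) (var 2) (var 3))} else {})" for n
    by (simp add: psb_relations_def toLW_br_var del: One_nat_def)
  have psb_carrier: "psb_relations n \<subseteq> opcarrier ?Q n" if "n \<ge> 1" for n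
    using epi.f_lin(1)[OF that] relations_arity(1,3) by (auto simp: psb sp)
  have Iid: "operad_ideal ?Q I"
    unfolding I_def by (rule generated_ideal_ideal[OF LW_operad sq psb_carrier])
  have rel: "antisymmetry (var 1) (var 2) \<in> J 2" "jacobi (var 1) (var 2) (var 3) \<in> J 3"
    "derivation_rel (var 1) (var 2) (var 3) \<in> J 3" "associator_rel (var 1) (var 2) (var 3) \<in> J 3"
    using generated_ideal_superset[of 2 post_lie_relations ?P] generated_ideal_superset[of 3 post_lie_relations ?P]
    by (simp_all add: J_def post_lie_relations_eq)
  have leib: "leibniz (var 1) (var 2) (var 3) \<in> J 3" using J.jacobi_iff_leibniz[OF rel(1)] rel(2) by simp
  have Isub: "VectorSpace.subspace class_ring (I n) (free_space (L_trees n \<union> W_trees n))" if "n \<ge> 1" for n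
    using Iid that by (simp add: operad_ideal_def sq)
  note lin = is_lin_simps[OF is_lin_toLW]

  \<comment> \<open>The preimage of \<open>I\<close>. It is an ideal containing the post-Lie
    relations, which shows that \<open>toLW\<close> maps \<open>J\<close> into
    \<open>I\<close>.\<close>
  define H where "H n = {x. supp x \<subseteq> op_trees n \<and> toLW x \<in> I n}" for n
  have Hid: "operad_ideal ?P H"
    unfolding operad_ideal_def
  proof (intro conjI allI ballI impI)
    fix n :: nat assume n: "n \<ge> 1"
    show "VectorSpace.subspace class_ring (H n) (opspace ?P n)"
      unfolding sp subspace_free_iff using subspaceD[OF Isub[OF n]]
      by (auto simp: H_def lin dest: keys_subset_closed(1)[THEN subsetD] keys_subset_closed(3)[THEN subsetD])
  next
    fix n \<sigma> x assume "x \<in> H n" "n \<ge> 1 \<and> \<sigma> permutes {1..n}"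
    then show "opact ?P n \<sigma> x \<in> H n"
      using epi.act[of n \<sigma> x] epi.closed(2)[of n \<sigma> x] Iid by (simp add: H_def sp operad_ideal_def)
  next
    fix m n i x b assume "x \<in> H m" "b \<in> opcarrier ?P n" "1 \<le> i \<and> i \<le> m \<and> n \<ge> 1"
    then show "opcomp ?P m n i x b \<in> H (m + n - 1)"
      using epi.comp[of i m n x b] epi.closed(1)[of i m n x b] epi.f_lin(1)[of n b] Iid
      by (simp add: H_def sp operad_ideal_def)
  next
    fix m n i a x assume "a \<in> opcarrier ?P m" "x \<in> H n" "1 \<le> i \<and> i \<le> m \<and> n \<ge> 1"
    then show "opcomp ?P m n i a x \<in> H (m + n - 1)"
      using epi.comp[of i m n a x] epi.closed(1)[of i m n a x] epi.f_lin(1)[of m a] Iid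
      by (simp add: H_def sp operad_ideal_def)
  qed
  interpret H: post_lie_ideal H by unfold_locales (rule Hid)
  have "psb_relations 2 \<subseteq> I 2" "psb_relations 3 \<subseteq> I 3" unfolding I_def by (intro generated_ideal_superset; simp)+
  then have Ha: "antisymmetry (var 1) (var 2) \<in> H 2" and Hl: "leibniz (var 1) (var 2) (var 3) \<in> H 3"
    using relations_arity(1,3) by (simp_all add: psb H_def)
  have "jacobi (var 1) (var 2) (var 3) \<in> H 3" using H.jacobi_iff_leibniz[OF Ha] Hl by simp
  \<comment> \<open>The mixed relations map to zero, hence into every ideal.\<close>
  moreover have "derivation_rel (var 1) (var 2) (var 3) \<in> H 3" "associator_rel (var 1) (var 2) (var 3) \<in> H 3"
    unfolding H_def mem_Collect_eq toLW_relations
    using relations_arity(4,5) subspaceD(2)[OF Isub[of 3]] by auto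
  ultimately have "post_lie_relations r \<subseteq> H r" for r using Ha by (simp add: post_lie_relations_eq)
  then have J_le_H: "J n \<subseteq> H n" for n unfolding J_def by (intro generated_ideal_least[OF Hid])

  \<comment> \<open>The image of \<open>J\<close>. Surjectivity of \<open>toLW\<close> makes it
    closed under composition with all of \<open>LW\<close>, and it contains the generators of
    \<open>I\<close>, so \<open>I\<close> lies in it.\<close>
  define M where "M n = toLW ` J n" for n
  have Mid: "operad_ideal ?Q M"
    unfolding operad_ideal_def
  proof (intro conjI allI ballI impI)
    fix n :: nat assume n: "n \<ge> 1"
    note Jn = J.J_subD[OF n]
    show "VectorSpace.subspace class_ring (M n) (opspace ?Q n)"
      unfolding sq subspace_free_iff M_def
    proof (intro conjI ballI allI)
      fix x assume "x \<in> toLW ` J n"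
      then obtain u where u: "u \<in> J n" "x = toLW u" by blast
      then show "supp x \<subseteq> L_trees n \<union> W_trees n"
        using Jn(1)[of u] epi.f_lin(1)[OF n, of u] by (simp add: sp sq)
      show "scal c x \<in> toLW ` J n" for c
        using u Jn(4)[of u c] by (intro image_eqI[of _ _ "scal c u"]) (simp_all add: lin)
      fix y assume "y \<in> toLW ` J n"
      then obtain v where v: "v \<in> J n" "y = toLW v" by blast
      then show "x + y \<in> toLW ` J n"
        using u Jn(3)[of u v] by (intro image_eqI[of _ _ "u + v"]) (simp_all add: lin)
    next
      show "0 \<in> toLW ` J n" using Jn(2) by (intro image_eqI[of _ _ 0]) (simp_all add: lin)
    qed
  next
    fix n \<sigma> x assume x: "x \<in> M n" and n: "n \<ge> 1 \<and> \<sigma> permutes {1..n}"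
    then obtain y where y: "y \<in> J n" "x = toLW y" by (auto simp: M_def)
    have "opact ?P n \<sigma> y \<in> J n" using Jid y n by (simp add: operad_ideal_def)
    moreover have "opact ?Q n \<sigma> x = toLW (opact ?P n \<sigma> y)"
      using epi.act[of n \<sigma> y] y n J.J_subD(1)[of n y] by (simp add: sp)
    ultimately show "opact ?Q n \<sigma> x \<in> M n" by (simp add: M_def)
  next
    fix m n i x b assume x: "x \<in> M m" and b: "b \<in> opcarrier ?Q n" and i: "1 \<le> i \<and> i \<le> m \<and> n \<ge> 1"
    obtain y where y: "y \<in> J m" "x = toLW y" using x by (auto simp: M_def)
    obtain c where c: "c \<in> opcarrier ?P n" "b = toLW c" using epi.pre[of n b] b i by blast
    have "opcomp ?P m n i y c \<in> J (m + n - 1)" using Jid y c i by (simp add: operad_ideal_def)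
    moreover have "opcomp ?Q m n i x b = toLW (opcomp ?P m n i y c)"
      using epi.comp[of i m n y c] y c i J.J_subD(1)[of m y] by (simp add: sp)
    ultimately show "opcomp ?Q m n i x b \<in> M (m + n - 1)" by (simp add: M_def)
  next
    fix m n i a x assume a: "a \<in> opcarrier ?Q m" and x: "x \<in> M n" and i: "1 \<le> i \<and> i \<le> m \<and> n \<ge> 1"
    obtain y where y: "y \<in> J n" "x = toLW y" using x by (auto simp: M_def)
    obtain c where c: "c \<in> opcarrier ?P m" "a = toLW c" using epi.pre[of m a] a i by force
    have "opcomp ?P m n i c y \<in> J (m + n - 1)" using Jid y c i by (simp add: operad_ideal_def)
    moreover have "opcomp ?Q m n i a x = toLW (opcomp ?P m n i c y)"
      using epi.comp[of i m n c y] y c i J.J_subD(1)[of n y] by (simp add: sp)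
    ultimately show "opcomp ?Q m n i a x \<in> M (m + n - 1)" by (simp add: M_def)
  qed
  have "psb_relations r \<subseteq> M r" for r using rel(1) leib by (simp add: psb M_def)
  then have I_le_M: "I n \<subseteq> M n" for n unfolding I_def by (intro generated_ideal_least[OF Mid])

  have iff: "toLW x \<in> I n \<longleftrightarrow> x \<in> J n" if n: "n \<ge> 1" and x: "supp x \<subseteq> op_trees n" for n x
  proof
    assume "toLW x \<in> I n"
    \<comment> \<open>An element of \<open>I\<close> is the image of some \<open>y\<close> in
      \<open>J\<close>; then \<open>x - y\<close> is in the kernel, which lies in \<open>J\<close>
      because the mixed relations do.\<close>
    then obtain y where y: "y \<in> J n" "toLW x = toLW y" using I_le_M by (auto simp: M_def)
    have "supp (x - y) \<subseteq> op_trees n" by (rule keys_subset_closed(2)[OF x J.J_subD(1)[OF n y(1)]])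
    moreover have "toLW (x - y) = 0" using y(2) by (simp only: lin) simp
    ultimately have "x - y \<in> J n" by (intro J.ker_toLW[OF rel(3,4)] n)
    then show "x \<in> J n" using J.J_subD(3)[OF n _ y(1), of "x - y"] by simp
  next
    assume "x \<in> J n"
    then show "toLW x \<in> I n" using J_le_H by (auto simp: H_def)
  qed
  have "operad_isomorphic (quotient_operad ?Q I) (quotient_operad ?P J)"
  proof (rule operad_epi_isomorphic)
    show "operad_epi ?P (quotient_operad ?Q I) (\<lambda>n x. I n +>\<^bsub>opspace ?Q n\<^esub> toLW x)"
      by (rule operad_epi_comp[OF toLW_epi quotient_epi[OF LW_operad sq Iid]])
    show "operad_epi ?P (quotient_operad ?P J) (\<lambda>n x. J n +>\<^bsub>opspace ?P n\<^esub> x)"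
      by (rule quotient_epi[OF free_operad sp Jid])
    fix n x y assume n: "(n::nat) \<ge> 1" and "x \<in> opcarrier ?P n" "y \<in> opcarrier ?P n"
    then have "supp (x - y) \<subseteq> op_trees n" by (simp add: sp keys_subset_closed)
    from iff[OF n this] show "I n +>\<^bsub>opspace ?Q n\<^esub> toLW x = I n +>\<^bsub>opspace ?Q n\<^esub> toLW y \<longleftrightarrow>
        J n +>\<^bsub>opspace ?P n\<^esub> x = J n +>\<^bsub>opspace ?P n\<^esub> y"
      unfolding sp sq coset_eq_iff[OF Isub[OF n]] coset_eq_iff[OF J.J_sub[OF n]] lin .
  qed
  then show ?thesis by (simp only: PSB_def PostLie_def I_def J_def)
qed

end
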